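(* Let $F$ be a field of characteristic different from $2$ and $3$, let $\varepsilon\in F^\times$, let $\mathcal C_\varepsilon$ be the smooth projective closure of the affine curve $x_1+x_2+x_3=0$, $x_1x_2x_3=\varepsilon$ (equivalently $xy(x+y)=-\varepsilon$ with $x=x_1,y=x_2$), and let $\mathcal E_\varepsilon$ be the projective Weierstrass curve $V^2=-4U^3-27\varepsilon^2$. The cyclic permutation $\rho(x_1,x_2,x_3)=(x_2,x_3,x_1)$ acts freely on $\mathcal C_\varepsilon$. The invariant functions $U=x_1x_2+x_1x_3+x_2x_3$, $V=(x_1-x_2)(x_2-x_3)(x_3-x_1)$ define an $F$-morphism $\pi_\varepsilon:\mathcal C_\varepsilon\to\mathcal E_\varepsilon$ invariant under $\rho$. After base change to $\overline F$, $\pi_\varepsilon$ is the finite étale quotient of $\mathcal C_{\varepsilon,\overline F}$ by $\langle\rho\rangle$; equivalently, after choosing any of the three points at infinity of $\mathcal C_{\varepsilon,\overline F}$ as origin, it is an étale $3$-isogeny of elliptic curves. *)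

theory Defs
  imports "HOL-Analysis.Cartesian_Space" "HOL-Algebra.Algebraic_Closure_Type"
begin

text \<open>
  Varieties over \<open>F\<close> are handled classically: through their points over an algebraic closure of
  \<open>F\<close>, with the Zariski topology and the sheaf of regular functions, the subfield \<open>F\<close> being
  remembered as the set \<open>k\<close> of admissible coefficients.
\<close>

subsection \<open>Projective space and forms\<close>

text \<open>A point of projective space is the set of all its homogeneous coordinate vectors.\<close>

definition pt :: "('k::field)^'n \<Rightarrow> ('k^'n) set" where
  "pt v = {c *s v | c. c \<noteq> 0}"

text \<open>
  Homogeneous polynomials of degree \<open>d\<close> with coefficients in the subfield \<open>k\<close>, as functions; they
  are only used over algebraically closed, hence infinite, fields, where a polynomial is determined
  by its function.
\<close>

inductive form :: "('k::field) set \<Rightarrow> nat \<Rightarrow> ('k^'n \<Rightarrow> 'k) \<Rightarrow> bool" for k where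
  form_const: "c \<in> k \<Longrightarrow> form k 0 (\<lambda>_. c)"
| form_coord: "form k 1 (\<lambda>v. v $ i)"
| form_add: "form k d p \<Longrightarrow> form k d q \<Longrightarrow> form k d (\<lambda>v. p v + q v)"
| form_mult: "form k d p \<Longrightarrow> form k e q \<Longrightarrow> form k (d + e) (\<lambda>v. p v * q v)"

definition nonvanishing :: "(('k::field)^'n \<Rightarrow> 'k) \<Rightarrow> ('k^'n) set set" where
  "nonvanishing H = {P. \<forall>v\<in>P. H v \<noteq> 0}"

definition proj_closure :: "(('k::field)^'n) set set \<Rightarrow> ('k^'n) set set" where
  "proj_closure S = {pt v | v. v \<noteq> 0 \<and>
     (\<forall>d p. form UNIV d p \<longrightarrow> (\<forall>w. w \<noteq> 0 \<and> pt w \<in> S \<longrightarrow> p w = 0) \<longrightarrow> p v = 0)}"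

text \<open>
  The last clause is the Jacobian criterion: if \<open>\<Phi> (v + s w) = p s\<close> identically in \<open>s\<close>, then the
  linear coefficient of \<open>p\<close> is the formal derivative of \<open>\<Phi>\<close> at \<open>v\<close> in direction \<open>w\<close>.
\<close>

definition smooth_plane_cubic :: "('k::field) set \<Rightarrow> ('k^3) set set \<Rightarrow> bool" where
  "smooth_plane_cubic k M \<longleftrightarrow> (\<exists>\<Phi>. form k 3 \<Phi> \<and> M = {pt v | v. v \<noteq> 0 \<and> \<Phi> v = 0} \<and>
     (\<forall>v. v \<noteq> 0 \<and> \<Phi> v = 0 \<longrightarrow>
        (\<exists>w p. (\<forall>s. \<Phi> (v + s *s w) = poly p s) \<and> poly.coeff p 1 \<noteq> 0)))"

text \<open>Morphisms of projective varieties that are defined over \<open>k\<close>.\<close>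

definition proj_morphism ::
  "('k::field) set \<Rightarrow> ('k^'n) set set \<Rightarrow> ('k^'m) set set \<Rightarrow> (('k^'n) set \<Rightarrow> ('k^'m) set) \<Rightarrow> bool" where
  "proj_morphism k M N f \<longleftrightarrow> f ` M \<subseteq> N \<and>
     (\<forall>P\<in>M. \<exists>d G. (\<forall>i. form k d (G i)) \<and> (\<forall>v\<in>P. (\<chi> i. G i v) \<noteq> 0) \<and>
        (\<forall>Q\<in>M. \<forall>v\<in>Q. (\<chi> i. G i v) \<noteq> 0 \<longrightarrow> f Q = pt (\<chi> i. G i v)))"


subsection \<open>Spaces with functions\<close>

text \<open>
  \<open>regular M U\<close> is the ring of regular functions on the open set \<open>U\<close>; its elements are total
  functions whose values outside \<open>U\<close> are irrelevant.
\<close>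

record ('p, 'k) fspace =
  pts :: "'p set"
  opens :: "'p set set"
  regular :: "'p set \<Rightarrow> ('p \<Rightarrow> 'k) set"

definition proj_var :: "(('k::field)^'n) set set \<Rightarrow> (('k^'n) set, 'k) fspace" where
  "proj_var M = \<lparr>
     pts = M,
     opens = {U. U \<subseteq> M \<and> (\<forall>P\<in>U. \<exists>d H. form UNIV d H \<and> P \<in> nonvanishing H \<and>
                                          M \<inter> nonvanishing H \<subseteq> U)},
     regular = (\<lambda>U. {f. \<forall>P\<in>U. \<exists>d G H. form UNIV d G \<and> form UNIV d H \<and> P \<in> nonvanishing H \<and>
                                (\<forall>Q\<in>U \<inter> nonvanishing H. \<forall>v\<in>Q. f Q = G v / H v)})\<rparr>"

text \<open>Affine \<open>m\<close>-space consists of the sequences that vanish from index \<open>m\<close> on.\<close>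

inductive aff_poly :: "((nat \<Rightarrow> 'k::field) \<Rightarrow> 'k) \<Rightarrow> bool" where
  aff_const: "aff_poly (\<lambda>_. c)"
| aff_coord: "aff_poly (\<lambda>x. x i)"
| aff_add: "aff_poly p \<Longrightarrow> aff_poly q \<Longrightarrow> aff_poly (\<lambda>x. p x + q x)"
| aff_mult: "aff_poly p \<Longrightarrow> aff_poly q \<Longrightarrow> aff_poly (\<lambda>x. p x * q x)"

definition aff_zeros :: "nat \<Rightarrow> ((nat \<Rightarrow> 'k::field) \<Rightarrow> 'k) set \<Rightarrow> (nat \<Rightarrow> 'k) set" where
  "aff_zeros m S = {x. (\<forall>i\<ge>m. x i = 0) \<and> (\<forall>p\<in>S. p x = 0)}"

definition aff_var :: "(nat \<Rightarrow> 'k::field) set \<Rightarrow> (nat \<Rightarrow> 'k, 'k) fspace" where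
  "aff_var Z = \<lparr>
     pts = Z,
     opens = {U. U \<subseteq> Z \<and> (\<forall>x\<in>U. \<exists>h. aff_poly h \<and> h x \<noteq> 0 \<and> {y\<in>Z. h y \<noteq> 0} \<subseteq> U)},
     regular = (\<lambda>U. {f. \<forall>x\<in>U. \<exists>g h. aff_poly g \<and> aff_poly h \<and> h x \<noteq> 0 \<and>
                                (\<forall>y\<in>U. h y \<noteq> 0 \<longrightarrow> f y = g y / h y)})\<rparr>"

definition open_sub :: "('p, 'k) fspace \<Rightarrow> 'p set \<Rightarrow> ('p, 'k) fspace" where
  "open_sub M W = \<lparr>pts = W, opens = {U \<in> opens M. U \<subseteq> W}, regular = regular M\<rparr>"

definition fs_iso :: "('p, 'k) fspace \<Rightarrow> ('q, 'k) fspace \<Rightarrow> ('p \<Rightarrow> 'q) \<Rightarrow> bool" where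
  "fs_iso M N \<phi> \<longleftrightarrow> bij_betw \<phi> (pts M) (pts N) \<and>
     (\<forall>U. U \<subseteq> pts M \<longrightarrow> (U \<in> opens M \<longleftrightarrow> \<phi> ` U \<in> opens N)) \<and>
     (\<forall>U\<in>opens M. \<forall>f. f \<circ> \<phi> \<in> regular M U \<longleftrightarrow> f \<in> regular N (\<phi> ` U))"

definition affine_fspace :: "('p, 'k::field) fspace \<Rightarrow> bool" where
  "affine_fspace M \<longleftrightarrow> (\<exists>m S \<phi>. (\<forall>p\<in>S. aff_poly p) \<and> fs_iso M (aff_var (aff_zeros m S)) \<phi>)"

definition preim :: "('p, 'k) fspace \<Rightarrow> ('p \<Rightarrow> 'q) \<Rightarrow> 'q set \<Rightarrow> 'p set" where
  "preim M f W = {P \<in> pts M. f P \<in> W}"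

definition fs_morphism :: "('p, 'k) fspace \<Rightarrow> ('q, 'k) fspace \<Rightarrow> ('p \<Rightarrow> 'q) \<Rightarrow> bool" where
  "fs_morphism M N f \<longleftrightarrow> f ` pts M \<subseteq> pts N \<and>
     (\<forall>W\<in>opens N. preim M f W \<in> opens M \<and> (\<forall>g\<in>regular N W. g \<circ> f \<in> regular M (preim M f W)))"


subsection \<open>Finite and etale morphisms, quotients\<close>

definition finite_morphism ::
  "('p, 'k::field) fspace \<Rightarrow> ('q, 'k) fspace \<Rightarrow> ('p \<Rightarrow> 'q) \<Rightarrow> bool" where
  "finite_morphism M N f \<longleftrightarrow> fs_morphism M N f \<and>
     (\<forall>y\<in>pts N. \<exists>W\<in>opens N. y \<in> W \<and> affine_fspace (open_sub N W) \<and> affine_fspace (open_sub M (preim M f W)) \<and>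
        (\<exists>B. finite B \<and> B \<subseteq> regular M (preim M f W) \<and>
           (\<forall>g\<in>regular M (preim M f W). \<exists>a. (\<forall>b\<in>B. a b \<in> regular N W) \<and>
              (\<forall>P\<in>preim M f W. g P = (\<Sum>b\<in>B. a b (f P) * b P)))))"

text \<open>
  The local ring at \<open>P\<close> is \<open>regular_at M P\<close> modulo equality \<open>near\<close> \<open>P\<close>.
\<close>

definition regular_at :: "('p, 'k) fspace \<Rightarrow> 'p \<Rightarrow> ('p \<Rightarrow> 'k) set" where
  "regular_at M P = {f. \<exists>U\<in>opens M. P \<in> U \<and> f \<in> regular M U}"

definition near :: "('p, 'k) fspace \<Rightarrow> 'p \<Rightarrow> ('p \<Rightarrow> bool) \<Rightarrow> bool" where
  "near M P A \<longleftrightarrow> (\<exists>U\<in>opens M. P \<in> U \<and> (\<forall>Q\<in>U. A Q))"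

text \<open>
  The maximal ideal at \<open>f P\<close> generates the maximal ideal at \<open>P\<close>; all residue fields are the
  algebraically closed ground field, so nothing has to be said about them.
\<close>

definition unramified_at ::
  "('p, 'k::field) fspace \<Rightarrow> ('q, 'k) fspace \<Rightarrow> ('p \<Rightarrow> 'q) \<Rightarrow> 'p \<Rightarrow> bool" where
  "unramified_at M N f P \<longleftrightarrow> (\<forall>g\<in>regular_at M P. g P = 0 \<longrightarrow>
     (\<exists>n::nat. \<exists>a h. (\<forall>i<n. a i \<in> regular_at N (f P) \<and> a i (f P) = 0 \<and> h i \<in> regular_at M P) \<and>
        near M P (\<lambda>Q. g Q = (\<Sum>i<n. a i (f Q) * h i Q))))"

text \<open>
  Flatness of the local ring at \<open>P\<close> over the local ring at \<open>f P\<close>, in the tensor-free form: every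
  linear relation over the base is a consequence of relations that hold in the base.
\<close>

definition flat_at ::
  "('p, 'k::field) fspace \<Rightarrow> ('q, 'k) fspace \<Rightarrow> ('p \<Rightarrow> 'q) \<Rightarrow> 'p \<Rightarrow> bool" where
  "flat_at M N f P \<longleftrightarrow> (\<forall>n::nat. \<forall>a g.
     (\<forall>i<n. a i \<in> regular_at N (f P) \<and> g i \<in> regular_at M P) \<longrightarrow>
     near M P (\<lambda>Q. (\<Sum>i<n. a i (f Q) * g i Q) = 0) \<longrightarrow>
     (\<exists>r::nat. \<exists>b h.
        (\<forall>j<r. h j \<in> regular_at M P) \<and>
        (\<forall>i<n. (\<forall>j<r. b i j \<in> regular_at N (f P)) \<and>
               near M P (\<lambda>Q. g i Q = (\<Sum>j<r. b i j (f Q) * h j Q))) \<and>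
        (\<forall>j<r. near N (f P) (\<lambda>R. (\<Sum>i<n. a i R * b i j R) = 0))))"

definition etale ::
  "('p, 'k::field) fspace \<Rightarrow> ('q, 'k) fspace \<Rightarrow> ('p \<Rightarrow> 'q) \<Rightarrow> bool" where
  "etale M N f \<longleftrightarrow> fs_morphism M N f \<and> (\<forall>P\<in>pts M. flat_at M N f P \<and> unramified_at M N f P)"

text \<open>
  \<open>N\<close> is the orbit space of \<open>M\<close> by the group \<open>G\<close>, as a set, as a topological space, and as a space
  with functions.
\<close>

definition quotient_morphism ::
  "('p, 'k::field) fspace \<Rightarrow> ('q, 'k) fspace \<Rightarrow> ('p \<Rightarrow> 'p) set \<Rightarrow> ('p \<Rightarrow> 'q) \<Rightarrow> bool" where
  "quotient_morphism M N G f \<longleftrightarrow> fs_morphism M N f \<and> f ` pts M = pts N \<and>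
     (\<forall>P\<in>pts M. \<forall>Q\<in>pts M. f P = f Q \<longleftrightarrow> (\<exists>g\<in>G. Q = g P)) \<and>
     (\<forall>W. W \<subseteq> pts N \<longrightarrow> (W \<in> opens N \<longleftrightarrow> preim M f W \<in> opens M)) \<and>
     (\<forall>W\<in>opens N. \<forall>h\<in>regular M (preim M f W).
        (\<forall>g\<in>G. \<forall>P\<in>preim M f W. h (g P) = h P) \<longrightarrow>
        (\<exists>a\<in>regular N W. \<forall>P\<in>preim M f W. h P = a (f P)))"


subsection \<open>Function fields, divisors and isogenies\<close>

text \<open>
  For irreducible \<open>M\<close>, the function field is \<open>rational M\<close> modulo \<open>generically\<close> equal.
\<close>

definition rational :: "('p, 'k) fspace \<Rightarrow> ('p \<Rightarrow> 'k) set" where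
  "rational M = {f. \<exists>U\<in>opens M. U \<noteq> {} \<and> f \<in> regular M U}"

definition generically :: "('p, 'k) fspace \<Rightarrow> ('p \<Rightarrow> bool) \<Rightarrow> bool" where
  "generically M A \<longleftrightarrow> (\<exists>U\<in>opens M. U \<noteq> {} \<and> (\<forall>Q\<in>U. A Q))"

text \<open>\<open>[K(M) : f\<^sup>* K(N)] = d\<close>, witnessed by a basis \<open>h\<close>.\<close>

definition has_degree ::
  "('p, 'k::field) fspace \<Rightarrow> ('q, 'k) fspace \<Rightarrow> ('p \<Rightarrow> 'q) \<Rightarrow> nat \<Rightarrow> bool" where
  "has_degree M N f d \<longleftrightarrow> (\<exists>h. (\<forall>i<d. h i \<in> rational M) \<and>
     (\<forall>g\<in>rational M. \<exists>a. (\<forall>i<d. a i \<in> rational N) \<and>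
        generically M (\<lambda>Q. g Q = (\<Sum>i<d. a i (f Q) * h i Q))) \<and>
     (\<forall>a. (\<forall>i<d. a i \<in> rational N) \<longrightarrow> generically M (\<lambda>Q. (\<Sum>i<d. a i (f Q) * h i Q) = 0) \<longrightarrow>
        (\<forall>i<d. generically N (\<lambda>R. a i R = 0))))"

definition uniformizer :: "('p, 'k::field) fspace \<Rightarrow> 'p \<Rightarrow> ('p \<Rightarrow> 'k) \<Rightarrow> bool" where
  "uniformizer M P t \<longleftrightarrow> t \<in> regular_at M P \<and> t P = 0 \<and>
     (\<forall>g\<in>regular_at M P. g P = 0 \<longrightarrow> (\<exists>h\<in>regular_at M P. near M P (\<lambda>Q. g Q = t Q * h Q)))"

definition has_order :: "('p, 'k::field) fspace \<Rightarrow> 'p \<Rightarrow> ('p \<Rightarrow> 'k) \<Rightarrow> int \<Rightarrow> bool" where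
  "has_order M P f n \<longleftrightarrow> (\<exists>t u. uniformizer M P t \<and> u \<in> regular_at M P \<and> u P \<noteq> 0 \<and>
     near M P (\<lambda>Q. Q \<noteq> P \<longrightarrow> f Q = t Q powi n * u Q))"

text \<open>
  The graph of the group law of the elliptic curve \<open>(M, z)\<close>: \<open>P + Q = R\<close> iff the divisor
  \<open>(P) + (Q) - (R) - (z)\<close> is principal.
  On a smooth plane cubic exactly one such \<open>R\<close> exists, by Riemann-Roch.
\<close>

definition ec_sum :: "('p, 'k::field) fspace \<Rightarrow> 'p \<Rightarrow> 'p \<Rightarrow> 'p \<Rightarrow> 'p \<Rightarrow> bool" where
  "ec_sum M z P Q R \<longleftrightarrow> (\<exists>f\<in>rational M. \<forall>S\<in>pts M.
     has_order M S f (of_bool (S = P) + of_bool (S = Q) - of_bool (S = R) - of_bool (S = z)))"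

definition elliptic_curve :: "(('k::field)^3) set set \<Rightarrow> ('k^3) set \<Rightarrow> bool" where
  "elliptic_curve M z \<longleftrightarrow> smooth_plane_cubic UNIV M \<and> z \<in> M"

definition isogeny :: "(('k::field)^3) set set \<Rightarrow> ('k^3) set \<Rightarrow> ('k^3) set set \<Rightarrow> ('k^3) set \<Rightarrow>
    (('k^3) set \<Rightarrow> ('k^3) set) \<Rightarrow> bool" where
  "isogeny M z N z' f \<longleftrightarrow> elliptic_curve M z \<and> elliptic_curve N z' \<and>
     fs_morphism (proj_var M) (proj_var N) f \<and> f z = z' \<and>
     (\<forall>P\<in>M. \<forall>Q\<in>M. \<forall>R\<in>M. ec_sum (proj_var M) z P Q R \<longrightarrow>
        ec_sum (proj_var N) z' (f P) (f Q) (f R)) \<and>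
     f ` M = N \<and> finite {P\<in>M. f P = z'}"


subsection \<open>The two curves\<close>

definition affine_C :: "'k::field \<Rightarrow> ('k \<times> 'k \<times> 'k) set" where
  "affine_C e = {(x1, x2, x3). x1 + x2 + x3 = 0 \<and> x1 * x2 * x3 = e}"

text \<open>
  The plane \<open>x1 + x2 + x3 = 0\<close> is coordinatised by \<open>x = x1\<close> and \<open>y = x2\<close>, and embedded into the
  projective plane as \<open>(x : y : 1)\<close>.
\<close>

definition curve_C :: "'a::field \<Rightarrow> ('a alg_closure ^ 3) set set" where
  "curve_C \<epsilon> = proj_closure {pt (vector [x1, x2, 1]) | x1 x2 x3. (x1, x2, x3) \<in> affine_C (to_ac \<epsilon>)}"

definition curve_E :: "'a::field \<Rightarrow> ('a alg_closure ^ 3) set set" where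
  "curve_E \<epsilon> = {pt (vector [u, v, w]) | u v w. vector [u, v, w] \<noteq> (0 :: 'a alg_closure ^ 3) \<and>
     v^2 * w = - 4 * u^3 - 27 * (to_ac \<epsilon>)^2 * w^3}"

text \<open>The linear extension of \<open>(x1, x2, x3) \<mapsto> (x2, x3, x1)\<close>, using \<open>x3 = - x1 - x2\<close>.\<close>

definition rho :: "(('k::field)^3) set \<Rightarrow> ('k^3) set" where
  "rho P = (\<lambda>v. vector [v $ 2, - v $ 1 - v $ 2, v $ 3]) ` P"

definition infinity_C :: "'a::field \<Rightarrow> ('a alg_closure ^ 3) set set" where
  "infinity_C \<epsilon> = {P \<in> curve_C \<epsilon>. \<forall>v\<in>P. v $ 3 = 0}"

text \<open>\<open>\<pi>\<close> is a morphism over \<open>F\<close> that is given by \<open>(U, V)\<close> on the affine curve.\<close>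

definition UV_morphism ::
  "'a::field \<Rightarrow> (('a alg_closure ^ 3) set \<Rightarrow> ('a alg_closure ^ 3) set) \<Rightarrow> bool" where
  "UV_morphism \<epsilon> \<pi> \<longleftrightarrow>
     proj_morphism (range (to_ac :: 'a \<Rightarrow> 'a alg_closure)) (curve_C \<epsilon>) (curve_E \<epsilon>) \<pi> \<and>
     (\<forall>x1 x2 x3. (x1, x2, x3) \<in> affine_C (to_ac \<epsilon>) \<longrightarrow>
        \<pi> (pt (vector [x1, x2, 1])) =
        pt (vector [x1 * x2 + x1 * x3 + x2 * x3, (x1 - x2) * (x2 - x3) * (x3 - x1), 1]))"

end

theory Submission
  imports Defs
begin

text \<open>
  Over the algebraic closure, with \<open>\<omega>\<close> a primitive cube root of unity, the eigenvectors
  \<open>a = x\<^sub>1 + \<omega> x\<^sub>2 + \<omega>\<^sup>2 x\<^sub>3\<close>, \<open>b = x\<^sub>1 + \<omega>\<^sup>2 x\<^sub>2 + \<omega> x\<^sub>3\<close> of \<open>\<rho>\<close> and a multiple \<open>c\<close> of the coordinate at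
  infinity turn the first curve into the Fermat cubic \<open>a\<^sup>3 + b\<^sup>3 + c\<^sup>3 = 0\<close>, on which \<open>\<rho>\<close> is diagonal.
  The map \<open>\<pi>\<close> becomes \<open>(a, b, c) \<mapsto> (a\<^sup>3, b\<^sup>3, c\<^sup>3, abc)\<close>, and the second curve becomes
  \<open>\<xi> + \<eta> + \<zeta> = 0\<close>, \<open>\<xi>\<eta>\<zeta> = \<tau>\<^sup>3\<close>.

  The norm from the Fermat cubic to a coordinate line shows that its Zariski topology is cofinite
  and that its local rings are discrete valuation rings. Traces along \<open>\<langle>\<rho>\<rangle>\<close> show that invariant regular
  functions descend, so that everything needed about the second curve follows from the first:
  a uniformizer downstairs pulls back to a uniformizer upstairs, whence \<open>\<pi>\<close> is unramified, and flat as
  the base is a valuation ring. Decomposing functions into \<open>\<rho>\<close>-eigenfunctions gives finiteness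
  and the degree, and the norm \<open>f \<mapsto> f \<cdot> f\<circ>\<rho> \<cdot> f\<circ>\<rho>\<^sup>2\<close> transports principal divisors, whence \<open>\<pi>\<close> is a
  homomorphism.
\<close>

text \<open>The Fermat shape is used because its three coordinates are interchangeable and at least
  two of them are nonzero at each point. After a rotation every local question lies in a chart with
  a and b nonzero, where c/a minus its value is a parameter. Irreducibility comes with the norm: a
  form that does not vanish identically on a chart has a nonzero norm, hence only finitely many
  zeros. Elements of \<open>regular\<close> are total functions with arbitrary values off their
  domain, so functions cannot simply be compared. The filter \<open>generic\<close> expresses
  equality in the function field, and equality of germs becomes generic equality together with
  equality of the two values at the point. Invertibility of 3 separates the eigenvalues of the
  rotation, allows averaging over it, and gives -1 - t^3 a simple zero. Invertibility of 2 allows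
  a^3 and b^3 to be recovered from their sum and difference, and makes the second curve
  smooth.\<close>

no_notation fps_nth (infixl "$" 75)

declare One_nat_def [simp del]

section \<open>Forms and points\<close>

lemma form_scale: "form k d p \<Longrightarrow> p (c *s v) = c ^ d * p v"
  by (induction rule: form.induct) (simp_all add: algebra_simps power_add)

lemma form_mono: "form k d p \<Longrightarrow> k \<subseteq> k' \<Longrightarrow> form k' d p"
  by (induction rule: form.induct) (auto intro: form.intros form_coord)

lemma form_cmult: "form k d p \<Longrightarrow> c \<in> k \<Longrightarrow> form k d (\<lambda>v. c * p v)"
  using form_mult[OF form_const] by fastforce

lemma form_diff: "form k d p \<Longrightarrow> form k d q \<Longrightarrow> - 1 \<in> k \<Longrightarrow> form k d (\<lambda>v. p v - q v)"
  using form_add[OF _ form_cmult, of k d p q "- 1"] by simp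

lemma form_uminus: "form k d p \<Longrightarrow> - 1 \<in> k \<Longrightarrow> form k d (\<lambda>v. - p v)"
  using form_cmult[of k d p "- 1"] by simp

lemma form_power: "form k d p \<Longrightarrow> 1 \<in> k \<Longrightarrow> form k (n * d) (\<lambda>v. p v ^ n)"
proof (induction n)
  case 0
  then show ?case using form_const[of 1 k] by simp
next
  case (Suc n)
  then show ?case using form_mult[of k d p "n * d"] by simp
qed

lemma form_compose:
  assumes "form k d p" and "\<And>i. form k m (G i)"
  shows "form k (d * m) (\<lambda>v. p (\<chi> i. G i v))"
  using assms(1)
proof (induction rule: form.induct)
  case (form_coord i)
  then show ?case using assms(2) by simp
next
  case (form_mult d p e q)
  then show ?case using form.form_mult by (fastforce simp: algebra_simps)
qed (auto intro: form.intros)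

text \<open>The constructor \<open>form_const\<close> gives the zero function in degree 0 only.
  Multiplying the d-th power of any coordinate by 0 gives it in degree d, as homogenisation and
  vanishing traces require.\<close>

lemma form_zero: "form UNIV d (\<lambda>_::'k::field^'n. 0)"
proof -
  have "form UNIV d (\<lambda>v::'k^'n. (v $ undefined) ^ d)"
    using form_power[OF form_coord, of UNIV d undefined] by simp
  from form_cmult[OF this, of 0] show ?thesis by simp
qed

lemma form_vector3:
  fixes f1 f2 f3 :: "'k::field^'n \<Rightarrow> 'k"
  assumes "form k d f1" "form k d f2" "form k d f3"
  shows "form k d (\<lambda>v. (vector [f1 v, f2 v, f3 v] :: 'k^3) $ i)"
  using exhaust_3[of i] assms by auto

lemma vec3_eta: "(vector [v $ 1, v $ 2, v $ 3] :: 'k::zero^3) = v"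
  by (simp add: vec_eq_iff forall_3)

lemma vec3_eq_iff: "(v :: 'k^3) = w \<longleftrightarrow> v $ 1 = w $ 1 \<and> v $ 2 = w $ 2 \<and> v $ 3 = w $ 3"
  by (simp add: vec_eq_iff forall_3)

lemma mem_pt: "w \<in> pt v \<longleftrightarrow> (\<exists>c. c \<noteq> 0 \<and> w = c *s v)"
  by (auto simp: pt_def)

lemma self_in_pt [simp]: "v \<in> pt v"
  unfolding mem_pt by (rule exI[of _ 1]) simp

lemma pt_scale:
  assumes "c \<noteq> 0"
  shows "pt (c *s v) = pt v"
proof (intro equalityI subsetI)
  fix w assume "w \<in> pt (c *s v)"
  then obtain d where "d \<noteq> 0" "w = d *s (c *s v)" by (auto simp: mem_pt)
  then show "w \<in> pt v"
    unfolding mem_pt using assms by (intro exI[of _ "d * c"]) (simp add: vec_eq_iff)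
next
  fix w assume "w \<in> pt v"
  then obtain d where "d \<noteq> 0" "w = d *s v" by (auto simp: mem_pt)
  then show "w \<in> pt (c *s v)"
    unfolding mem_pt using assms by (intro exI[of _ "d / c"]) (simp add: vec_eq_iff)
qed

lemma pt_eq_iff: "pt v = pt w \<longleftrightarrow> (\<exists>c. c \<noteq> 0 \<and> v = c *s w)"
  by (metis mem_pt pt_scale self_in_pt)

lemma nonvanishing_pt: "form k d H \<Longrightarrow> pt v \<in> nonvanishing H \<longleftrightarrow> H v \<noteq> 0"
  unfolding nonvanishing_def by (auto simp: mem_pt form_scale intro: exI[of _ 1])

text \<open>If all 2 x 2 minors vanish, one vector is a multiple of the other. This serves twice: to
  separate points by linear forms, and to show that two projective maps agree.\<close>

lemma pt_neq_imp_minor: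
  fixes v w :: "'k::field^'n"
  assumes "v \<noteq> 0" "w \<noteq> 0" "pt v \<noteq> pt w"
  shows "\<exists>i j. v $ i * w $ j - v $ j * w $ i \<noteq> 0"
proof (rule ccontr)
  assume "\<not> ?thesis"
  then have minors: "v $ i * w $ j = v $ j * w $ i" for i j by auto
  from assms obtain j where j: "w $ j \<noteq> 0" by (auto simp: vec_eq_iff)
  then have v: "v = (v $ j / w $ j) *s w"
    using minors[of _ j] by (auto simp: vec_eq_iff divide_simps)
  then have "v $ j / w $ j \<noteq> 0" using \<open>v \<noteq> 0\<close> by (metis vector_smult_lzero)
  with v assms(3) show False by (metis pt_scale)
qed

text \<open>A nonzero minor of v and w, read as a function of its first vector, is a linear form
  that vanishes at w but not at v.\<close>

lemma separating_linear_form: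
  fixes v w :: "'k::field^'n"
  assumes "v \<noteq> 0" "w \<noteq> 0" "pt v \<noteq> pt w"
  obtains l where "form UNIV 1 l" "l v \<noteq> 0" "l w = 0"
proof -
  from pt_neq_imp_minor[OF assms] obtain i j where ij: "v $ i * w $ j - v $ j * w $ i \<noteq> 0"
    by auto
  have "form UNIV 1 (\<lambda>x. w $ j * x $ i - w $ i * x $ j)"
    by (intro form_diff form_cmult form_coord) auto
  moreover have "w $ j * v $ i - w $ i * v $ j \<noteq> 0" using ij by (simp add: mult.commute)
  moreover have "w $ j * w $ i - w $ i * w $ j = 0" by (simp add: mult.commute)
  ultimately show ?thesis by (rule that)
qed

text \<open>Take the product of one separating linear form per point of \<open>S\<close>. The exact
  degree \<open>card S\<close> matters later, when a degree has to be made divisible by 3.\<close>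

lemma avoiding_form:
  fixes v :: "'k::field^'n"
  assumes "v \<noteq> 0" and "finite S" "\<And>Q. Q \<in> S \<Longrightarrow> \<exists>w. w \<noteq> 0 \<and> Q = pt w" "pt v \<notin> S"
  shows "\<exists>l. form UNIV (card S) l \<and> l v \<noteq> 0 \<and> (\<forall>w. pt w \<in> S \<longrightarrow> l w = 0)"
  using assms(2-)
proof (induction S rule: finite_induct)
  case empty
  then show ?case using form_const[of 1 UNIV] by (intro exI[of _ "\<lambda>_. 1"]) auto
next
  case (insert Q S)
  then obtain l where l: "form UNIV (card S) l" "l v \<noteq> 0" "\<And>w. pt w \<in> S \<Longrightarrow> l w = 0" by auto
  from insert obtain w where w: "w \<noteq> 0" "Q = pt w" by auto
  with insert.prems assms(1) obtain m where m: "form UNIV 1 m" "m v \<noteq> 0" "m w = 0"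
    using separating_linear_form[of v w] by auto
  have "m x = 0" if "pt x = Q" for x
    using that w m form_scale[OF m(1)] by (auto simp: pt_eq_iff)
  moreover have "form UNIV (card (insert Q S)) (\<lambda>v. m v * l v)"
    using form_mult[OF m(1) l(1)] insert by (simp add: add.commute One_nat_def)
  ultimately show ?case using l m by (intro exI[of _ "\<lambda>v. m v * l v"]) auto
qed

section \<open>Regular functions on subsets of projective space\<close>

text \<open>For forms of equal degree the value does not depend on the chosen representative
  (\<open>ratio_pt\<close>), so this is the rational function G / H as a total function on
  points.\<close>

definition ratio :: "('k::field^'n \<Rightarrow> 'k) \<Rightarrow> ('k^'n \<Rightarrow> 'k) \<Rightarrow> ('k^'n) set \<Rightarrow> 'k" where
  "ratio G H Q = G (SOME v. v \<in> Q) / H (SOME v. v \<in> Q)"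

lemma ratio_pt:
  assumes "form k d G" "form k d H"
  shows "ratio G H (pt v) = G v / H v"
proof -
  have "(SOME w. w \<in> pt v) \<in> pt v" by (rule someI[of _ v]) simp
  then obtain c where c: "c \<noteq> 0" "(SOME w. w \<in> pt v) = c *s v" by (auto simp: mem_pt)
  show ?thesis
    unfolding ratio_def c(2) using c(1) by (simp add: form_scale[OF assms(1)] form_scale[OF assms(2)])
qed

locale proj_set =
  fixes M :: "('k::field^'n) set set"
  assumes repr: "P \<in> M \<Longrightarrow> \<exists>v. v \<noteq> 0 \<and> P = pt v"
begin

abbreviation "\<M> \<equiv> proj_var M"

lemma pts_M [simp]: "pts \<M> = M"
  by (simp add: proj_var_def)

lemma mem_repr: "P \<in> M \<Longrightarrow> v \<in> P \<Longrightarrow> v \<noteq> 0 \<and> P = pt v"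
  by (metis mem_pt pt_scale repr vector_mul_eq_0)

lemma mem_opens: "U \<in> opens \<M> \<longleftrightarrow> U \<subseteq> M \<and>
    (\<forall>P\<in>U. \<exists>d H. form UNIV d H \<and> P \<in> nonvanishing H \<and> M \<inter> nonvanishing H \<subseteq> U)"
  by (simp add: proj_var_def)

lemma mem_regular: "f \<in> regular \<M> U \<longleftrightarrow>
    (\<forall>P\<in>U. \<exists>d G H. form UNIV d G \<and> form UNIV d H \<and> P \<in> nonvanishing H \<and>
       (\<forall>Q\<in>U \<inter> nonvanishing H. \<forall>v\<in>Q. f Q = G v / H v))"
  by (simp add: proj_var_def)

lemma opens_subset: "U \<in> opens \<M> \<Longrightarrow> U \<subseteq> M"
  by (auto simp: proj_var_def)

lemma opens_basic: "form UNIV d H \<Longrightarrow> M \<inter> nonvanishing H \<in> opens \<M>"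
  by (auto simp: proj_var_def)

text \<open>A germ is a single fraction valid wherever its denominator is nonzero. The local
  fraction G / H is valid on an open set only. Expanding it by a form \<open>H0\<close> whose
  nonvanishing locus lies in that set removes the open set from the description.\<close>

lemma regular_at_iff:
  "f \<in> regular_at \<M> P \<longleftrightarrow> P \<in> M \<and> (\<exists>d G H. form UNIV d G \<and> form UNIV d H \<and>
     P \<in> nonvanishing H \<and> (\<forall>v. pt v \<in> M \<longrightarrow> H v \<noteq> 0 \<longrightarrow> f (pt v) = G v / H v))" (is "?l \<longleftrightarrow> ?r")
proof
  assume ?l
  then obtain U where U: "U \<in> opens \<M>" "P \<in> U" "f \<in> regular \<M> U" by (auto simp: regular_at_def)
  from U obtain d G H where GH: "form UNIV d G" "form UNIV d H" "P \<in> nonvanishing H"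
    "\<forall>Q\<in>U \<inter> nonvanishing H. \<forall>v\<in>Q. f Q = G v / H v" unfolding mem_regular by blast
  from U obtain e H0 where H0: "form UNIV e H0" "P \<in> nonvanishing H0" "M \<inter> nonvanishing H0 \<subseteq> U"
    unfolding mem_opens by blast
  have PM: "P \<in> M" using U opens_subset by auto
  have *: "f (pt v) = G v * H0 v / (H v * H0 v)" if "pt v \<in> M" "H v * H0 v \<noteq> 0" for v
  proof -
    have "pt v \<in> U" "pt v \<in> nonvanishing H"
      using that H0 GH nonvanishing_pt[OF GH(2)] nonvanishing_pt[OF H0(1)] by auto
    then have "f (pt v) = G v / H v" using GH(4) self_in_pt by blast
    then show ?thesis using that by simp
  qed
  have "P \<in> nonvanishing (\<lambda>v. H v * H0 v)" using GH H0 by (auto simp: nonvanishing_def)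
  with PM * form_mult[OF GH(1) H0(1)] form_mult[OF GH(2) H0(1)] show ?r
    by (intro conjI exI[of _ "d + e"] exI[of _ "\<lambda>v. G v * H0 v"] exI[of _ "\<lambda>v. H v * H0 v"]) auto
next
  assume ?r
  then obtain d G H where GH: "P \<in> M" "form UNIV d G" "form UNIV d H" "P \<in> nonvanishing H"
    "\<And>v. pt v \<in> M \<Longrightarrow> H v \<noteq> 0 \<Longrightarrow> f (pt v) = G v / H v" by auto
  have "\<forall>Q\<in>M \<inter> nonvanishing H. \<forall>v\<in>Q. f Q = G v / H v"
  proof (intro ballI)
    fix Q v assume "Q \<in> M \<inter> nonvanishing H" "v \<in> Q"
    then show "f Q = G v / H v" using GH(5)[of v] mem_repr[of Q v] by (simp add: nonvanishing_def)
  qed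
  then have "f \<in> regular \<M> (M \<inter> nonvanishing H)"
    using GH(2-4) unfolding mem_regular by blast
  then show ?l using GH opens_basic by (auto simp: regular_at_def)
qed

lemma regular_atE:
  assumes "f \<in> regular_at \<M> P" "P = pt v0"
  obtains d G H where "form UNIV d G" "form UNIV d H" "H v0 \<noteq> 0"
    "\<And>v. pt v \<in> M \<Longrightarrow> H v \<noteq> 0 \<Longrightarrow> f (pt v) = G v / H v"
  using assms unfolding regular_at_iff by (auto simp: nonvanishing_pt)

lemma regular_atI:
  assumes "pt v0 \<in> M" "form UNIV d G" "form UNIV d H" "H v0 \<noteq> 0"
    "\<And>v. pt v \<in> M \<Longrightarrow> H v \<noteq> 0 \<Longrightarrow> f (pt v) = G v / H v"
  shows "f \<in> regular_at \<M> (pt v0)"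
  unfolding regular_at_iff
  using assms nonvanishing_pt[OF assms(3)] by (intro conjI exI[of _ d] exI[of _ G] exI[of _ H]) auto

lemma regular_iff:
  assumes "U \<in> opens \<M>"
  shows "f \<in> regular \<M> U \<longleftrightarrow> (\<forall>P\<in>U. f \<in> regular_at \<M> P)"
proof
  assume "f \<in> regular \<M> U"
  then show "\<forall>P\<in>U. f \<in> regular_at \<M> P" using assms by (auto simp: regular_at_def)
next
  assume *: "\<forall>P\<in>U. f \<in> regular_at \<M> P"
  have "\<exists>d G H. form UNIV d G \<and> form UNIV d H \<and> P \<in> nonvanishing H \<and>
       (\<forall>Q\<in>U \<inter> nonvanishing H. \<forall>v\<in>Q. f Q = G v / H v)" if "P \<in> U" for P
  proof -
    from * that obtain d G H where GH: "form UNIV d G" "form UNIV d H" "P \<in> nonvanishing H"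
      "\<And>v. pt v \<in> M \<Longrightarrow> H v \<noteq> 0 \<Longrightarrow> f (pt v) = G v / H v"
      unfolding regular_at_iff by blast
    have "\<forall>Q\<in>U \<inter> nonvanishing H. \<forall>v\<in>Q. f Q = G v / H v"
    proof (intro ballI)
      fix Q v assume "Q \<in> U \<inter> nonvanishing H" "v \<in> Q"
      then show "f Q = G v / H v" using GH(4)[of v] mem_repr[of Q v] opens_subset[OF assms]
        by (auto simp add: nonvanishing_def)
    qed
    with GH show ?thesis by blast
  qed
  then show "f \<in> regular \<M> U" unfolding mem_regular by blast
qed

lemma regular_at_mem: "f \<in> regular_at \<M> P \<Longrightarrow> P \<in> M"
  by (simp add: regular_at_iff)

lemma regular_at_ratio:
  assumes "P \<in> M" "form UNIV d G" "form UNIV d H" "P \<in> nonvanishing H"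
  shows "ratio G H \<in> regular_at \<M> P"
  unfolding regular_at_iff using assms by (auto simp: ratio_pt[OF assms(2,3)])

lemma regular_at_const [intro]: "P \<in> M \<Longrightarrow> (\<lambda>_. c) \<in> regular_at \<M> P"
  unfolding regular_at_iff using form_const[of c UNIV] form_const[of 1 UNIV]
  by (intro conjI exI[of _ 0] exI[of _ "\<lambda>_. c"] exI[of _ "\<lambda>_. 1"]) (auto simp: nonvanishing_def)

lemma regular_at_add [intro]:
  assumes "f \<in> regular_at \<M> P" "g \<in> regular_at \<M> P"
  shows "(\<lambda>Q. f Q + g Q) \<in> regular_at \<M> P"
proof -
  from assms(1) have "P \<in> M" by (rule regular_at_mem)
  then obtain v0 where v0: "P = pt v0" using repr by auto
  from regular_atE[OF assms(1) v0] obtain d G H where 1: "form UNIV d G" "form UNIV d H"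
    "H v0 \<noteq> 0" "\<And>v. pt v \<in> M \<Longrightarrow> H v \<noteq> 0 \<Longrightarrow> f (pt v) = G v / H v" by blast
  from regular_atE[OF assms(2) v0] obtain e G' H' where 2: "form UNIV e G'" "form UNIV e H'"
    "H' v0 \<noteq> 0" "\<And>v. pt v \<in> M \<Longrightarrow> H' v \<noteq> 0 \<Longrightarrow> g (pt v) = G' v / H' v" by blast
  show ?thesis unfolding v0
  proof (rule regular_atI)
    show "form UNIV (d + e) (\<lambda>v. G v * H' v + H v * G' v)"
      by (intro form_add form_mult 1 2)
    show "form UNIV (d + e) (\<lambda>v. H v * H' v)" by (intro form_mult 1 2)
  qed (use 1 2 \<open>P \<in> M\<close> v0 in \<open>auto simp: add_frac_eq mult.commute\<close>)
qed

lemma regular_at_mult [intro]: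
  assumes "f \<in> regular_at \<M> P" "g \<in> regular_at \<M> P"
  shows "(\<lambda>Q. f Q * g Q) \<in> regular_at \<M> P"
proof -
  from assms(1) have "P \<in> M" by (rule regular_at_mem)
  then obtain v0 where v0: "P = pt v0" using repr by auto
  from regular_atE[OF assms(1) v0] obtain d G H where 1: "form UNIV d G" "form UNIV d H"
    "H v0 \<noteq> 0" "\<And>v. pt v \<in> M \<Longrightarrow> H v \<noteq> 0 \<Longrightarrow> f (pt v) = G v / H v" by blast
  from regular_atE[OF assms(2) v0] obtain e G' H' where 2: "form UNIV e G'" "form UNIV e H'"
    "H' v0 \<noteq> 0" "\<And>v. pt v \<in> M \<Longrightarrow> H' v \<noteq> 0 \<Longrightarrow> g (pt v) = G' v / H' v" by blast
  show ?thesis unfolding v0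
  proof (rule regular_atI)
    show "form UNIV (d + e) (\<lambda>v. G v * G' v)" by (intro form_mult 1 2)
    show "form UNIV (d + e) (\<lambda>v. H v * H' v)" by (intro form_mult 1 2)
  qed (use 1 2 \<open>P \<in> M\<close> v0 in auto)
qed

lemma regular_at_inverse:
  assumes "f \<in> regular_at \<M> P" "f P \<noteq> 0"
  shows "(\<lambda>Q. inverse (f Q)) \<in> regular_at \<M> P"
proof -
  from assms(1) have "P \<in> M" by (rule regular_at_mem)
  then obtain v0 where v0: "P = pt v0" using repr by auto
  from regular_atE[OF assms(1) v0] obtain d G H where 1: "form UNIV d G" "form UNIV d H"
    "H v0 \<noteq> 0" "\<And>v. pt v \<in> M \<Longrightarrow> H v \<noteq> 0 \<Longrightarrow> f (pt v) = G v / H v" by blast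
  have "G v0 \<noteq> 0" using 1(3,4) assms(2) v0 \<open>P \<in> M\<close> by auto
  show ?thesis unfolding v0
  proof (rule regular_atI)
    \<comment> \<open>The inverse is H / G, expanded by \<open>H\<close>: where the denominator G H
      is nonzero, so is \<open>H\<close>, and only there is f known to be G / H.\<close>
    show "form UNIV (d + d) (\<lambda>v. H v * H v)" by (intro form_mult 1)
    show "form UNIV (d + d) (\<lambda>v. G v * H v)" by (intro form_mult 1)
  qed (use 1 \<open>P \<in> M\<close> v0 \<open>G v0 \<noteq> 0\<close> in auto)
qed

lemma regular_at_cmult: "f \<in> regular_at \<M> P \<Longrightarrow> (\<lambda>Q. c * f Q) \<in> regular_at \<M> P"
  by (intro regular_at_mult regular_at_const) (auto dest: regular_at_mem)

lemma regular_at_diff: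
  "f \<in> regular_at \<M> P \<Longrightarrow> g \<in> regular_at \<M> P \<Longrightarrow> (\<lambda>Q. f Q - g Q) \<in> regular_at \<M> P"
  using regular_at_add[OF _ regular_at_cmult[of g P "-1"], of f] by simp

lemma regular_at_power: "f \<in> regular_at \<M> P \<Longrightarrow> (\<lambda>Q. f Q ^ n) \<in> regular_at \<M> P"
  by (induction n) (auto dest: regular_at_mem)

lemma regular_at_powi:
  assumes "f \<in> regular_at \<M> P" "f P \<noteq> 0"
  shows "(\<lambda>Q. f Q powi n) \<in> regular_at \<M> P"
  using assms by (cases "0 \<le> n")
    (simp_all add: power_int_def regular_at_power regular_at_power[OF regular_at_inverse])

lemma regular_at_sum:
  "finite A \<Longrightarrow> P \<in> M \<Longrightarrow> (\<And>i. i \<in> A \<Longrightarrow> f i \<in> regular_at \<M> P) \<Longrightarrow>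
    (\<lambda>Q. \<Sum>i\<in>A. f i Q) \<in> regular_at \<M> P"
  by (induction A rule: finite_induct) auto

lemma near_iff_form:
  "near \<M> P A \<longleftrightarrow> P \<in> M \<and> (\<exists>d H. form UNIV d H \<and> P \<in> nonvanishing H \<and>
     (\<forall>Q\<in>M \<inter> nonvanishing H. A Q))" (is "?l \<longleftrightarrow> ?r")
proof
  assume ?l
  then obtain U where U: "U \<in> opens \<M>" "P \<in> U" "\<forall>Q\<in>U. A Q" by (auto simp: near_def)
  from U(1,2) obtain d H where "form UNIV d H" "P \<in> nonvanishing H" "M \<inter> nonvanishing H \<subseteq> U"
    unfolding mem_opens by blast
  then show ?r using U opens_subset by (intro conjI exI[of _ d] exI[of _ H]) auto
next
  assume ?r
  then obtain d H where "P \<in> M" "form UNIV d H" "P \<in> nonvanishing H" "\<forall>Q\<in>M \<inter> nonvanishing H. A Q"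
    by auto
  with opens_basic show ?l unfolding near_def by blast
qed

lemma opens_iff_near: "U \<in> opens \<M> \<longleftrightarrow> U \<subseteq> M \<and> (\<forall>P\<in>U. near \<M> P (\<lambda>Q. Q \<in> U))"
  unfolding near_iff_form mem_opens subset_eq ball_conj_distrib by satx

lemma near_nonzero:
  assumes "f \<in> regular_at \<M> P" "f P \<noteq> 0"
  shows "near \<M> P (\<lambda>Q. f Q \<noteq> 0)"
proof -
  from assms(1) have "P \<in> M" by (rule regular_at_mem)
  then obtain v0 where v0: "P = pt v0" using repr by auto
  from regular_atE[OF assms(1) v0] obtain d G H where 1: "form UNIV d G" "form UNIV d H"
    "H v0 \<noteq> 0" "\<And>v. pt v \<in> M \<Longrightarrow> H v \<noteq> 0 \<Longrightarrow> f (pt v) = G v / H v" by blast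
  have GH: "form UNIV (d + d) (\<lambda>v. G v * H v)" by (intro form_mult 1)
  have "f Q \<noteq> 0" if "Q \<in> M \<inter> nonvanishing (\<lambda>v. G v * H v)" for Q
    using that repr[of Q] 1(4) by (auto simp: nonvanishing_pt[OF GH])
  moreover have "P \<in> nonvanishing (\<lambda>v. G v * H v)"
    using assms(2) 1(3,4) v0 \<open>P \<in> M\<close> by (auto simp: nonvanishing_pt[OF GH])
  ultimately show ?thesis unfolding near_iff_form using GH \<open>P \<in> M\<close> by blast
qed

end

text \<open>Substituting forms of one common degree into a form gives a form again. Hence basic open
  sets pull back to basic open sets and fractions to fractions.\<close>

lemma fs_morphism_by_forms:
  fixes M :: "('k::field^'n) set set" and N :: "('k^'m) set set"
  assumes "proj_set M" "proj_set N" and f: "\<And>P. P \<in> M \<Longrightarrow> f P \<in> N"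
    and F: "\<And>i. form UNIV m (F i)" "\<And>v. pt v \<in> M \<Longrightarrow> f (pt v) = pt (\<chi> i. F i v)"
  shows "fs_morphism (proj_var M) (proj_var N) f"
    and "P \<in> M \<Longrightarrow> g \<in> regular_at (proj_var N) (f P) \<Longrightarrow> g \<circ> f \<in> regular_at (proj_var M) P"
proof -
  interpret M: proj_set M by fact
  interpret N: proj_set N by fact
  have near: "near (proj_var M) P (\<lambda>Q. A (f Q))" if "P \<in> M" "near (proj_var N) (f P) A" for P A
  proof -
    from that obtain d H where H: "form UNIV d H" "f P \<in> nonvanishing H"
      "\<forall>Q\<in>N \<inter> nonvanishing H. A Q" by (auto simp: N.near_iff_form)
    have HF: "form UNIV (d * m) (\<lambda>v. H (\<chi> i. F i v))" by (intro form_compose H F)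
    have "Q \<in> nonvanishing (\<lambda>v. H (\<chi> i. F i v)) \<longleftrightarrow> f Q \<in> nonvanishing H" if "Q \<in> M" for Q
      using M.repr[OF that] that by (auto simp: nonvanishing_pt[OF HF] nonvanishing_pt[OF H(1)] F(2))
    with H that f HF show ?thesis unfolding M.near_iff_form by blast
  qed
  have reg: "g \<circ> f \<in> regular_at (proj_var M) P"
    if "P \<in> M" "g \<in> regular_at (proj_var N) (f P)" for P g
  proof -
    from M.repr \<open>P \<in> M\<close> obtain v0 where v0: "P = pt v0" by auto
    have fP: "f P = pt (\<chi> i. F i v0)" using F(2) that v0 by auto
    from N.regular_atE[OF that(2) fP] obtain d G H where 1: "form UNIV d G" "form UNIV d H"
      "H (\<chi> i. F i v0) \<noteq> 0" "\<And>v. pt v \<in> N \<Longrightarrow> H v \<noteq> 0 \<Longrightarrow> g (pt v) = G v / H v" by blast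
    show ?thesis unfolding v0
    proof (rule M.regular_atI)
      show "form UNIV (d * m) (\<lambda>v. G (\<chi> i. F i v))" by (intro form_compose 1 F)
      show "form UNIV (d * m) (\<lambda>v. H (\<chi> i. F i v))" by (intro form_compose 1 F)
      fix v assume "pt v \<in> M" "H (\<chi> i. F i v) \<noteq> 0"
      then show "(g \<circ> f) (pt v) = G (\<chi> i. F i v) / H (\<chi> i. F i v)"
        using 1(4) f F(2) by (metis comp_apply)
    qed (use that v0 1 in auto)
  qed
  show "g \<circ> f \<in> regular_at (proj_var M) P" if "P \<in> M" "g \<in> regular_at (proj_var N) (f P)"
    using reg that by blast
  show "fs_morphism (proj_var M) (proj_var N) f"
    unfolding fs_morphism_def M.pts_M N.pts_M
  proof (intro conjI ballI)
    show "f ` M \<subseteq> N" using f by auto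
    fix W assume W: "W \<in> opens (proj_var N)"
    have "near (proj_var M) P (\<lambda>Q. f Q \<in> W)" if "P \<in> M" "f P \<in> W" for P
      using near[OF that(1), of "\<lambda>R. R \<in> W"] W that by (auto simp: N.opens_iff_near)
    then have "near (proj_var M) P (\<lambda>Q. Q \<in> M \<and> f Q \<in> W)" if "P \<in> M" "f P \<in> W" for P
      using that unfolding M.near_iff_form by blast
    then show op: "preim (proj_var M) f W \<in> opens (proj_var M)"
      unfolding M.opens_iff_near by (auto simp: preim_def)
    fix g assume "g \<in> regular (proj_var N) W"
    then show "g \<circ> f \<in> regular (proj_var M) (preim (proj_var M) f W)"
      unfolding M.regular_iff[OF op] N.regular_iff[OF W] by (auto simp: preim_def intro: reg)
  qed
qed

section \<open>Affine charts\<close>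

definition of_seq :: "(nat \<Rightarrow> 'k::zero) \<Rightarrow> 'k^3" where
  "of_seq x = vector [x 0, x 1, x 2]"

definition to_seq :: "'k::zero^3 \<Rightarrow> nat \<Rightarrow> 'k" where
  "to_seq v i = (if i = 0 then v $ 1 else if i = 1 then v $ 2 else if i = 2 then v $ 3 else 0)"

text \<open>The representative on which \<open>L\<close> has the value 1. The complement of the line
  is thus realised inside affine 3-space, on the plane L = 1, without choosing two affine
  coordinates.\<close>

definition chart :: "('k::field^3 \<Rightarrow> 'k) \<Rightarrow> ('k^3) set \<Rightarrow> nat \<Rightarrow> 'k" where
  "chart L P = (let v = (SOME v. v \<in> P) in to_seq (inverse (L v) *s v))"

lemma of_seq_to_seq [simp]: "of_seq (to_seq v) = (v :: 'k::zero^3)"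
  by (simp add: of_seq_def to_seq_def vec3_eq_iff)

lemma to_seq_of_seq: "\<forall>i\<ge>3. x (i::nat) = 0 \<Longrightarrow> to_seq (of_seq x) = x"
proof
  fix i :: nat assume x: "\<forall>i\<ge>3. x i = 0"
  consider "i = 0" | "i = 1" | "i = 2" | "i \<ge> 3" by linarith
  then show "to_seq (of_seq x) i = x i"
    by cases (use x in \<open>auto simp: to_seq_def of_seq_def\<close>)
qed

lemma chart_pt:
  assumes "form k 1 L"
  shows "chart L (pt v) = to_seq (inverse (L v) *s v)"
proof -
  have "(SOME w. w \<in> pt v) \<in> pt v" by (rule someI[of _ v]) simp
  then obtain c where c: "c \<noteq> 0" "(SOME w. w \<in> pt v) = c *s v" by (auto simp: mem_pt)
  have "inverse (L (c *s v)) *s (c *s v) = inverse (L v) *s v"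
    using c(1) by (simp add: form_scale[OF assms] vec_eq_iff)
  then show ?thesis by (simp only: chart_def Let_def c(2))
qed

lemma form_aff_poly: "form k d p \<Longrightarrow> aff_poly (\<lambda>x. p (of_seq x))"
proof (induction rule: form.induct)
  case (form_coord i)
  then show ?case using exhaust_3[of i] by (auto simp: of_seq_def intro: aff_coord)
qed (auto intro: aff_poly.intros)

text \<open>Multiplying by a power of \<open>L\<close> clears the denominators of a polynomial in
  the coordinates divided by \<open>L\<close>. Summands of different degrees are equalised by
  further powers of \<open>L\<close>.\<close>

lemma homogenize:
  assumes "aff_poly h" and L: "form UNIV 1 L"
  shows "\<exists>d H. form UNIV d H \<and> (\<forall>v. L v \<noteq> 0 \<longrightarrow> H v = L v ^ d * h (to_seq (inverse (L v) *s v)))"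
  using assms(1)
proof (induction rule: aff_poly.induct)
  case (aff_const c)
  show ?case by (rule exI[of _ 0], rule exI[of _ "\<lambda>_. c"]) (auto intro: form_const)
next
  case (aff_coord i)
  consider "i = 0" | "i = 1" | "i = 2" | "i \<ge> 3" by linarith
  then show ?case
  proof cases
    case 1
    then show ?thesis
      by (intro exI[of _ 1] exI[of _ "\<lambda>v. v $ 1"]) (auto simp: to_seq_def intro: form_coord)
  next
    case 2
    then show ?thesis
      by (intro exI[of _ 1] exI[of _ "\<lambda>v. v $ 2"]) (auto simp: to_seq_def intro: form_coord)
  next
    case 3
    then show ?thesis
      by (intro exI[of _ 1] exI[of _ "\<lambda>v. v $ 3"]) (auto simp: to_seq_def intro: form_coord)
  next
    case 4
    then show ?thesis
      by (intro exI[of _ 1] exI[of _ "\<lambda>v. 0"]) (auto simp: to_seq_def intro: form_zero)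
  qed
next
  case (aff_add p q)
  then obtain d P e Q where *: "form UNIV d P" "form UNIV e Q"
    "\<And>v. L v \<noteq> 0 \<Longrightarrow> P v = L v ^ d * p (to_seq (inverse (L v) *s v))"
    "\<And>v. L v \<noteq> 0 \<Longrightarrow> Q v = L v ^ e * q (to_seq (inverse (L v) *s v))" by blast
  have L': "form UNIV n (\<lambda>v. L v ^ n)" for n using form_power[OF L, of n] by simp
  have "form UNIV (d + e) (\<lambda>v. P v * L v ^ e + L v ^ d * Q v)"
    by (intro form_add form_mult * L')
  then show ?case
    by (intro exI[of _ "d + e"] exI[of _ "\<lambda>v. P v * L v ^ e + L v ^ d * Q v"])
      (auto simp: * power_add algebra_simps)
next
  case (aff_mult p q)
  then obtain d P e Q where *: "form UNIV d P" "form UNIV e Q"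
    "\<And>v. L v \<noteq> 0 \<Longrightarrow> P v = L v ^ d * p (to_seq (inverse (L v) *s v))"
    "\<And>v. L v \<noteq> 0 \<Longrightarrow> Q v = L v ^ e * q (to_seq (inverse (L v) *s v))" by blast
  have "form UNIV (d + e) (\<lambda>v. P v * Q v)"
    by (intro form_mult *)
  then show ?case
    by (intro exI[of _ "d + e"] exI[of _ "\<lambda>v. P v * Q v"])
      (auto simp: * power_add algebra_simps)
qed

lemma affine_complement_of_line:
  fixes L \<Phi> :: "'k::field^3 \<Rightarrow> 'k"
  assumes L: "form UNIV 1 L" and \<Phi>: "form UNIV n \<Phi>" and M: "M = {pt v | v. v \<noteq> 0 \<and> \<Phi> v = 0}"
  shows "affine_fspace (open_sub (proj_var M) (M \<inter> nonvanishing L))"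
proof -
  interpret proj_set M by unfold_locales (auto simp: M)
  define W where "W = M \<inter> nonvanishing L"
  define S where "S = {\<lambda>x. \<Phi> (of_seq x), \<lambda>x. L (of_seq x) + - 1}"
  define Z where "Z = aff_zeros 3 S"
  have memM: "pt v \<in> M \<longleftrightarrow> v \<noteq> 0 \<and> \<Phi> v = 0" for v
  proof
    assume "pt v \<in> M"
    then obtain w c where "w \<noteq> 0" "\<Phi> w = 0" "c \<noteq> 0" "v = c *s w" by (auto simp: M pt_eq_iff)
    then show "v \<noteq> 0 \<and> \<Phi> v = 0" by (simp add: form_scale[OF \<Phi>])
  qed (auto simp: M)
  have memW: "pt v \<in> W \<longleftrightarrow> v \<noteq> 0 \<and> \<Phi> v = 0 \<and> L v \<noteq> 0" for v
    by (auto simp: W_def memM nonvanishing_pt[OF L])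
  have memZ: "x \<in> Z \<longleftrightarrow> (\<forall>i\<ge>3. x i = 0) \<and> \<Phi> (of_seq x) = 0 \<and> L (of_seq x) = 1" for x
    by (auto simp: Z_def aff_zeros_def S_def)
  have S: "\<forall>p\<in>S. aff_poly p"
    using form_aff_poly[OF \<Phi>] aff_add[OF form_aff_poly[OF L] aff_const[of "- 1"]]
    unfolding S_def by blast
  have Wrep: "\<exists>v. Q = pt v \<and> v \<noteq> 0 \<and> \<Phi> v = 0 \<and> L v \<noteq> 0" if "Q \<in> W" for Q
    using that repr[of Q] memW by (auto simp: W_def)
  have chart: "chart L (pt v) = to_seq (inverse (L v) *s v)" for v
    by (rule chart_pt[OF L])
  have L0: "L 0 = 0" using form_scale[OF L, of 0 0] by simp
  have inW: "pt (of_seq x) \<in> W" if "x \<in> Z" for x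
    using that L0 by (auto simp: memZ memW)
  have inZ: "chart L Q \<in> Z" if "Q \<in> W" for Q
    using Wrep[OF that]
    by (auto simp: memZ chart form_scale[OF L] form_scale[OF \<Phi>]) (simp add: to_seq_def)
  have ret: "pt (of_seq (chart L Q)) = Q" if "Q \<in> W" for Q
    using Wrep[OF that] by (auto simp: chart pt_scale)
  have forth: "chart L (pt (of_seq x)) = x" if "x \<in> Z" for x
    using that by (auto simp: chart memZ to_seq_of_seq)
  have "bij_betw (chart L) W Z"
    by (rule bij_betw_byWitness[of _ "\<lambda>x. pt (of_seq x)"]) (use inW inZ ret forth in auto)
  moreover have "U \<in> opens (proj_var M) \<longleftrightarrow> chart L ` U \<in> opens (aff_var Z)" if U: "U \<subseteq> W" for U
  proof
    assume op: "U \<in> opens (proj_var M)"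
    have "\<exists>h. aff_poly h \<and> h (chart L P) \<noteq> 0 \<and> {y \<in> Z. h y \<noteq> 0} \<subseteq> chart L ` U" if P: "P \<in> U" for P
    proof -
      from op P obtain d H where H: "form UNIV d H" "P \<in> nonvanishing H" "M \<inter> nonvanishing H \<subseteq> U"
        unfolding mem_opens by blast
      obtain v where v: "P = pt v" "v \<noteq> 0" "\<Phi> v = 0" "L v \<noteq> 0" using Wrep P U by blast
      have "H (of_seq (chart L P)) \<noteq> 0"
        using H(2) v by (simp add: chart form_scale[OF H(1)] nonvanishing_pt[OF H(1)])
      moreover have "y \<in> chart L ` U" if "y \<in> Z" "H (of_seq y) \<noteq> 0" for y
      proof -
        have "pt (of_seq y) \<in> U"
          using that inW[OF that(1)] H(3) by (auto simp: W_def nonvanishing_pt[OF H(1)])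
        then show ?thesis using forth[OF that(1)] by (metis image_eqI)
      qed
      ultimately show ?thesis using form_aff_poly[OF H(1)] by blast
    qed
    then show "chart L ` U \<in> opens (aff_var Z)" using inZ U by (auto simp: aff_var_def)
  next
    assume op: "chart L ` U \<in> opens (aff_var Z)"
    have "\<exists>d H. form UNIV d H \<and> P \<in> nonvanishing H \<and> M \<inter> nonvanishing H \<subseteq> U" if P: "P \<in> U" for P
    proof -
      from op P obtain h where h: "aff_poly h" "h (chart L P) \<noteq> 0" "{y \<in> Z. h y \<noteq> 0} \<subseteq> chart L ` U"
        by (auto simp: aff_var_def)
      from homogenize[OF h(1) L] obtain d H where H: "form UNIV d H"
        "\<And>v. L v \<noteq> 0 \<Longrightarrow> H v = L v ^ d * h (to_seq (inverse (L v) *s v))" by blast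
      have LH: "form UNIV (1 + d) (\<lambda>v. L v * H v)" by (intro form_mult L H)
      obtain v where v: "P = pt v" "v \<noteq> 0" "\<Phi> v = 0" "L v \<noteq> 0" using Wrep P U by blast
      have "P \<in> nonvanishing (\<lambda>v. L v * H v)"
        using h(2) v by (simp add: nonvanishing_pt[OF LH] H(2) chart)
      moreover have "Q \<in> U" if "Q \<in> M" "Q \<in> nonvanishing (\<lambda>v. L v * H v)" for Q
      proof -
        obtain w where w: "Q = pt w" "w \<noteq> 0" using repr \<open>Q \<in> M\<close> by blast
        then have "L w \<noteq> 0" "H w \<noteq> 0" using that by (auto simp: nonvanishing_pt[OF LH])
        then have QW: "Q \<in> W" and "h (chart L Q) \<noteq> 0"
          using w that by (auto simp: W_def nonvanishing_pt[OF L] H(2) chart)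
        then have "chart L Q \<in> chart L ` U" using h(3) inZ by auto
        then show ?thesis using ret[OF QW] ret U by (metis imageE subsetD)
      qed
      ultimately show ?thesis using LH by blast
    qed
    then show "U \<in> opens (proj_var M)" using U unfolding mem_opens W_def by blast
  qed
  moreover have "f \<circ> chart L \<in> regular (proj_var M) U \<longleftrightarrow> f \<in> regular (aff_var Z) (chart L ` U)"
    if U: "U \<in> opens (proj_var M)" "U \<subseteq> W" for U f
  proof
    assume reg: "f \<circ> chart L \<in> regular (proj_var M) U"
    have "\<exists>g h. aff_poly g \<and> aff_poly h \<and> h (chart L P) \<noteq> 0 \<and>
        (\<forall>y\<in>chart L ` U. h y \<noteq> 0 \<longrightarrow> f y = g y / h y)" if P: "P \<in> U" for P
    proof -
      from reg P obtain d G H where GH: "form UNIV d G" "form UNIV d H" "P \<in> nonvanishing H"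
        "\<forall>Q\<in>U \<inter> nonvanishing H. \<forall>v\<in>Q. (f \<circ> chart L) Q = G v / H v"
        unfolding mem_regular by blast
      obtain v where v: "P = pt v" "v \<noteq> 0" "\<Phi> v = 0" "L v \<noteq> 0" using Wrep P U by blast
      have "H (of_seq (chart L P)) \<noteq> 0"
        using GH(3) v by (simp add: chart form_scale[OF GH(2)] nonvanishing_pt[OF GH(2)])
      moreover have "f (chart L Q) = G (of_seq (chart L Q)) / H (of_seq (chart L Q))"
        if "Q \<in> U" "H (of_seq (chart L Q)) \<noteq> 0" for Q
      proof -
        have Q: "pt (of_seq (chart L Q)) = Q" using ret that U by auto
        then have "of_seq (chart L Q) \<in> Q" by (metis self_in_pt)
        moreover have "Q \<in> nonvanishing H"
          using that Q nonvanishing_pt[OF GH(2), of "of_seq (chart L Q)"] by simp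
        ultimately show ?thesis using GH(4) that by auto
      qed
      ultimately show ?thesis
        using form_aff_poly[OF GH(1)] form_aff_poly[OF GH(2)]
        by (intro exI[of _ "\<lambda>x. G (of_seq x)"] exI[of _ "\<lambda>x. H (of_seq x)"]) auto
    qed
    then show "f \<in> regular (aff_var Z) (chart L ` U)" by (auto simp: aff_var_def)
  next
    assume reg: "f \<in> regular (aff_var Z) (chart L ` U)"
    have "\<exists>d G H. form UNIV d G \<and> form UNIV d H \<and> P \<in> nonvanishing H \<and>
       (\<forall>Q\<in>U \<inter> nonvanishing H. \<forall>v\<in>Q. (f \<circ> chart L) Q = G v / H v)" if P: "P \<in> U" for P
    proof -
      from reg P obtain g h where gh: "aff_poly g" "aff_poly h" "h (chart L P) \<noteq> 0"
        "\<And>Q. Q \<in> U \<Longrightarrow> h (chart L Q) \<noteq> 0 \<Longrightarrow> f (chart L Q) = g (chart L Q) / h (chart L Q)"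
        by (auto simp: aff_var_def)
      from homogenize[OF gh(1) L] obtain d G where G: "form UNIV d G"
        "\<And>v. L v \<noteq> 0 \<Longrightarrow> G v = L v ^ d * g (to_seq (inverse (L v) *s v))" by blast
      from homogenize[OF gh(2) L] obtain e H where H: "form UNIV e H"
        "\<And>v. L v \<noteq> 0 \<Longrightarrow> H v = L v ^ e * h (to_seq (inverse (L v) *s v))" by blast
      have L': "form UNIV n (\<lambda>v. L v ^ n)" for n using form_power[OF L, of n] by simp
      \<comment> \<open>Numerator and denominator were homogenised to different degrees; the
        crosswise powers of \<open>L\<close> give both the degree d + e.\<close>
      have 1: "form UNIV (d + e) (\<lambda>v. G v * L v ^ e)" by (intro form_mult G L')
      have 2: "form UNIV (d + e) (\<lambda>v. L v ^ d * H v)" by (intro form_mult H L')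
      obtain v where v: "P = pt v" "v \<noteq> 0" "\<Phi> v = 0" "L v \<noteq> 0" using Wrep P U by blast
      have "P \<in> nonvanishing (\<lambda>v. L v ^ d * H v)"
        using gh(3) v by (simp add: nonvanishing_pt[OF 2] H(2) chart)
      moreover have "(f \<circ> chart L) Q = G w * L w ^ e / (L w ^ d * H w)"
        if Q: "Q \<in> U \<inter> nonvanishing (\<lambda>v. L v ^ d * H v)" "w \<in> Q" for Q w
      proof -
        have "Q \<in> W" using Q U by auto
        then have Qw: "Q = pt w" using Q mem_repr unfolding W_def by blast
        then have "L w \<noteq> 0" using \<open>Q \<in> W\<close> memW by auto
        moreover have "L w ^ d * H w \<noteq> 0" using Q Qw nonvanishing_pt[OF 2] by auto
        ultimately show ?thesis using gh(4)[of Q] Q Qw by (simp add: G(2) H(2) chart)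
      qed
      ultimately show ?thesis using 1 2 by blast
    qed
    then show "f \<circ> chart L \<in> regular (proj_var M) U" unfolding mem_regular by blast
  qed
  ultimately have "fs_iso (open_sub (proj_var M) W) (aff_var Z) (chart L)"
    unfolding fs_iso_def by (auto simp: open_sub_def aff_var_def)
  then show ?thesis unfolding affine_fspace_def W_def[symmetric] Z_def using S by blast
qed

section \<open>Curves with the cofinite topology\<close>

text \<open>The filter of cofinite subsets of \<open>M\<close>. On a curve these are the sets that
  contain a nonempty open set, so eventual equality is equality in the function field.\<close>

definition generic :: "'p set \<Rightarrow> 'p filter" where
  "generic M = inf cofinite (principal M)"

lemma eventually_generic: "eventually A (generic M) \<longleftrightarrow> finite {Q \<in> M. \<not> A Q}"
  by (simp add: generic_def eventually_inf_principal eventually_cofinite)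

text \<open>Around each point of \<open>U\<close>, a form vanishing on the finite complement but not
  at the point cuts out a basic neighbourhood inside \<open>U\<close>.\<close>

lemma (in proj_set) cofinite_opens:
  assumes "U \<subseteq> M" "finite (M - U)"
  shows "U \<in> opens \<M>"
  unfolding mem_opens
proof (intro conjI ballI)
  fix P assume "P \<in> U"
  then obtain v where v: "v \<noteq> 0" "P = pt v" using assms repr by blast
  have "\<exists>l. form UNIV (card (M - U)) l \<and> l v \<noteq> 0 \<and> (\<forall>w. pt w \<in> M - U \<longrightarrow> l w = 0)"
    by (rule avoiding_form) (use v \<open>P \<in> U\<close> assms repr in auto)
  then obtain d l where l: "form UNIV d l" "l v \<noteq> 0" "\<And>w. pt w \<in> M - U \<Longrightarrow> l w = 0" by blast
  have "M \<inter> nonvanishing l \<subseteq> U"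
  proof
    fix Q assume Q: "Q \<in> M \<inter> nonvanishing l"
    then obtain w where "Q = pt w" using repr by blast
    with Q l show "Q \<in> U" by (auto simp: nonvanishing_pt[OF l(1)])
  qed
  then show "\<exists>d H. form UNIV d H \<and> P \<in> nonvanishing H \<and> M \<inter> nonvanishing H \<subseteq> U"
    using l v by (intro exI[of _ d] exI[of _ l]) (auto simp: nonvanishing_pt[OF l(1)])
qed fact

locale zcurve = proj_set +
  assumes infinite_M: "infinite M"
    and finite_compl: "U \<in> opens \<M> \<Longrightarrow> U \<noteq> {} \<Longrightarrow> finite (M - U)"
begin

abbreviation "gen \<equiv> generic M"

lemma gen_not_bot: "gen \<noteq> bot"
  using infinite_M unfolding trivial_limit_def eventually_generic by auto

lemma gen_const [simp]: "(\<forall>\<^sub>F Q in gen. c) \<longleftrightarrow> c"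
  using infinite_M unfolding eventually_generic by (cases c) auto

text \<open>The nonempty open sets are exactly the cofinite ones, so a neighbourhood of P is a
  cofinite set containing P. From here on open sets can be replaced by one filter and one
  value.\<close>

lemma near_iff: "near \<M> P A \<longleftrightarrow> P \<in> M \<and> A P \<and> (\<forall>\<^sub>F Q in gen. A Q)"
proof
  assume "near \<M> P A"
  then obtain U where U: "U \<in> opens \<M>" "P \<in> U" "\<forall>Q\<in>U. A Q" by (auto simp: near_def)
  then have "finite (M - U)" using finite_compl by auto
  then have "finite {Q \<in> M. \<not> A Q}" by (rule rev_finite_subset) (use U in auto)
  then show "P \<in> M \<and> A P \<and> (\<forall>\<^sub>F Q in gen. A Q)" using U opens_subset by (auto simp: eventually_generic)
next
  assume *: "P \<in> M \<and> A P \<and> (\<forall>\<^sub>F Q in gen. A Q)"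
  have "M - {Q \<in> M. A Q} = {Q \<in> M. \<not> A Q}" by auto
  then have "finite (M - {Q \<in> M. A Q})" using * by (simp add: eventually_generic)
  then have "{Q \<in> M. A Q} \<in> opens \<M>" by (intro cofinite_opens) auto
  with * show "near \<M> P A" unfolding near_def by (intro bexI[of _ "{Q \<in> M. A Q}"]) auto
qed

lemma generically_iff: "generically \<M> A \<longleftrightarrow> (\<forall>\<^sub>F Q in gen. A Q)"
proof
  assume "generically \<M> A"
  then obtain P where "near \<M> P A" unfolding generically_def near_def by blast
  then show "\<forall>\<^sub>F Q in gen. A Q" by (simp add: near_iff)
next
  assume *: "\<forall>\<^sub>F Q in gen. A Q"
  then have "\<forall>\<^sub>F P in gen. P \<in> M \<and> A P" by (simp add: eventually_generic cong: conj_cong)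
  then obtain P where "P \<in> M \<and> A P" using eventually_happens'[OF gen_not_bot] by blast
  then have "near \<M> P A" using * by (simp add: near_iff)
  then show "generically \<M> A" unfolding generically_def near_def by blast
qed

text \<open>Continuity: if the difference were nonzero at P, it would be nonzero at almost all
  points.\<close>

lemma regular_at_eq_at:
  assumes "f \<in> regular_at \<M> P" "g \<in> regular_at \<M> P" "\<forall>\<^sub>F Q in gen. f Q = g Q"
  shows "f P = g P"
proof (rule ccontr)
  assume "f P \<noteq> g P"
  then have "near \<M> P (\<lambda>Q. f Q - g Q \<noteq> 0)"
    using regular_at_diff[OF assms(1,2)] by (intro near_nonzero) auto
  then have "\<forall>\<^sub>F Q in gen. f Q - g Q \<noteq> 0" by (simp add: near_iff)
  with assms(3) have "\<forall>\<^sub>F Q in gen. False" by eventually_elim auto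
  then show False by simp
qed

lemma near_eq_iff:
  assumes "f \<in> regular_at \<M> P" "g \<in> regular_at \<M> P"
  shows "near \<M> P (\<lambda>Q. f Q = g Q) \<longleftrightarrow> (\<forall>\<^sub>F Q in gen. f Q = g Q)"
  using assms regular_at_eq_at regular_at_mem by (auto simp: near_iff)

lemma eventually_nonzero:
  assumes "f \<in> regular_at \<M> P" "f P \<noteq> 0"
  shows "\<forall>\<^sub>F Q in gen. f Q \<noteq> 0"
  using near_nonzero[OF assms] by (simp add: near_iff)

text \<open>Deleting the finitely many points where f and g differ leaves an open neighbourhood of
  P, because P itself is not one of them.\<close>

lemma regular_at_cong:
  assumes "f \<in> regular_at \<M> P" "\<forall>\<^sub>F Q in gen. f Q = g Q" "f P = g P"
  shows "g \<in> regular_at \<M> P"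
proof -
  from assms(1) obtain U where U: "U \<in> opens \<M>" "P \<in> U" "f \<in> regular \<M> U"
    by (auto simp: regular_at_def)
  define V where "V = {Q \<in> U. f Q = g Q}"
  have "finite (M - V)"
  proof (rule finite_subset)
    show "M - V \<subseteq> (M - U) \<union> {Q \<in> M. f Q \<noteq> g Q}" by (auto simp: V_def)
    show "finite ((M - U) \<union> {Q \<in> M. f Q \<noteq> g Q})"
      using assms(2) finite_compl[OF U(1)] U(2) by (auto simp: eventually_generic)
  qed
  moreover have "V \<subseteq> U" by (auto simp: V_def)
  ultimately have V: "V \<in> opens \<M>" using opens_subset[OF U(1)] by (intro cofinite_opens) auto
  have "f \<in> regular \<M> V" using U(3) \<open>V \<subseteq> U\<close> unfolding regular_iff[OF V] regular_iff[OF U(1)] by auto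
  then have "g \<in> regular \<M> V"
    unfolding mem_regular by (simp add: V_def cong: ball_cong_simp conj_cong)
  moreover have "P \<in> V" using U(2) assms(3) by (simp add: V_def)
  ultimately show ?thesis using V unfolding regular_at_def by blast
qed

lemma rational_iff: "f \<in> rational \<M> \<longleftrightarrow> (\<exists>P. f \<in> regular_at \<M> P)"
  by (auto simp: rational_def regular_at_def)

lemma rational_iff_gen: "f \<in> rational \<M> \<longleftrightarrow> (\<forall>\<^sub>F P in gen. f \<in> regular_at \<M> P)"
proof
  assume "f \<in> rational \<M>"
  then obtain U where U: "U \<in> opens \<M>" "U \<noteq> {}" "f \<in> regular \<M> U" by (auto simp: rational_def)
  then have "{P \<in> M. f \<notin> regular_at \<M> P} \<subseteq> M - U" by (auto simp: regular_iff)
  then show "\<forall>\<^sub>F P in gen. f \<in> regular_at \<M> P"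
    using finite_compl[OF U(1,2)] finite_subset by (auto simp: eventually_generic)
next
  assume "\<forall>\<^sub>F P in gen. f \<in> regular_at \<M> P"
  then have "\<exists>P. f \<in> regular_at \<M> P" using eventually_happens'[OF gen_not_bot] by blast
  then show "f \<in> rational \<M>" by (simp add: rational_iff)
qed

lemma uniformizer_iff:
  "uniformizer \<M> P t \<longleftrightarrow> t \<in> regular_at \<M> P \<and> t P = 0 \<and>
    (\<forall>g\<in>regular_at \<M> P. g P = 0 \<longrightarrow> (\<exists>h\<in>regular_at \<M> P. \<forall>\<^sub>F Q in gen. g Q = t Q * h Q))"
  unfolding uniformizer_def by (auto simp: near_iff intro: regular_at_mem)

end

text \<open>The local ring at P is a discrete valuation ring with parameter t, expressed without a
  valuation: each germ is zero or a power of t times a unit.\<close>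

definition (in zcurve) dvr_at :: "('a^'b) set \<Rightarrow> (('a^'b) set \<Rightarrow> 'a) \<Rightarrow> bool" where
  "dvr_at P t \<longleftrightarrow> uniformizer \<M> P t \<and> (\<forall>\<^sub>F Q in gen. t Q \<noteq> 0) \<and>
     (\<forall>g\<in>regular_at \<M> P. (\<forall>\<^sub>F Q in gen. g Q = 0) \<or>
        (\<exists>n u. u \<in> regular_at \<M> P \<and> u P \<noteq> 0 \<and> (\<forall>\<^sub>F Q in gen. g Q = t Q ^ n * u Q)))"

locale smooth_zcurve = zcurve +
  assumes ex_dvr: "P \<in> M \<Longrightarrow> \<exists>t. dvr_at P t"
begin

lemma uniformizer_nonzero:
  assumes "uniformizer \<M> P t"
  shows "\<forall>\<^sub>F Q in gen. t Q \<noteq> 0"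
proof -
  have "P \<in> M" using assms regular_at_mem by (auto simp: uniformizer_iff)
  then obtain t' where t': "dvr_at P t'" using ex_dvr by blast
  then obtain h where "\<forall>\<^sub>F Q in gen. t' Q = t Q * h Q"
    using assms by (auto simp: dvr_at_def uniformizer_iff)
  moreover have "\<forall>\<^sub>F Q in gen. t' Q \<noteq> 0" using t' by (simp add: dvr_at_def)
  ultimately show ?thesis by eventually_elim auto
qed

lemma uniformizer_unit:
  assumes t: "uniformizer \<M> P t" and t': "uniformizer \<M> P t'"
  obtains u where "u \<in> regular_at \<M> P" "u P \<noteq> 0" "\<forall>\<^sub>F Q in gen. t' Q = t Q * u Q"
proof -
  obtain h where h: "h \<in> regular_at \<M> P" "\<forall>\<^sub>F Q in gen. t' Q = t Q * h Q"
    using t t' by (auto simp: uniformizer_iff)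
  obtain h' where h': "h' \<in> regular_at \<M> P" "\<forall>\<^sub>F Q in gen. t Q = t' Q * h' Q"
    using t t' by (auto simp: uniformizer_iff)
  have "\<forall>\<^sub>F Q in gen. h Q * h' Q = 1"
    using h(2) h'(2) uniformizer_nonzero[OF t] uniformizer_nonzero[OF t']
    by eventually_elim (simp add: field_simps)
  then have "h P * h' P = 1"
    using h(1) h'(1) by (intro regular_at_eq_at[of "\<lambda>Q. h Q * h' Q" P "\<lambda>_. 1"])
      (auto intro: regular_at_mem)
  then have "h P \<noteq> 0" by auto
  with h show ?thesis using that by blast
qed

text \<open>In a valuation ring a finitely generated ideal is generated by one of the generators,
  namely one of least order. This is the only property of the base that flatness uses.\<close>

lemma common_divisor:
  assumes "P \<in> M" "\<And>i. i < n \<Longrightarrow> a i \<in> regular_at \<M> P" "\<not> (\<forall>i<n. \<forall>\<^sub>F Q in gen. a i Q = 0)"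
  obtains i0 q where "i0 < (n::nat)" "\<forall>\<^sub>F Q in gen. a i0 Q \<noteq> 0"
    "\<And>i. i < n \<Longrightarrow> q i \<in> regular_at \<M> P" "\<And>i. i < n \<Longrightarrow> \<forall>\<^sub>F Q in gen. a i Q = q i Q * a i0 Q"
proof -
  obtain t where t: "dvr_at P t" using ex_dvr assms(1) by blast
  have tr: "t \<in> regular_at \<M> P" using t by (simp add: dvr_at_def uniformizer_iff)
  have tn: "\<forall>\<^sub>F Q in gen. t Q \<noteq> 0" using t by (simp add: dvr_at_def)
  define I where "I = {i. i < n \<and> \<not> (\<forall>\<^sub>F Q in gen. a i Q = 0)}"
  have "\<forall>i\<in>I. \<exists>k u. u \<in> regular_at \<M> P \<and> u P \<noteq> 0 \<and> (\<forall>\<^sub>F Q in gen. a i Q = t Q ^ k * u Q)"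
    using t assms(2) by (auto simp: dvr_at_def I_def)
  from bchoice[OF this] obtain k where
    "\<forall>i\<in>I. \<exists>u. u \<in> regular_at \<M> P \<and> u P \<noteq> 0 \<and> (\<forall>\<^sub>F Q in gen. a i Q = t Q ^ k i * u Q)" by blast
  from bchoice[OF this] obtain u where ku: "\<And>i. i \<in> I \<Longrightarrow> u i \<in> regular_at \<M> P" "\<And>i. i \<in> I \<Longrightarrow> u i P \<noteq> 0"
    "\<And>i. i \<in> I \<Longrightarrow> \<forall>\<^sub>F Q in gen. a i Q = t Q ^ k i * u i Q" by blast
  have "I \<noteq> {}" "finite I" using assms(3) by (auto simp: I_def)
  then obtain i0 where i0: "i0 \<in> I" "\<And>i. i \<in> I \<Longrightarrow> k i0 \<le> (k i :: nat)"
    using arg_min_if_finite[of I k] by (metis not_le)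
  have u0: "\<forall>\<^sub>F Q in gen. u i0 Q \<noteq> 0" using eventually_nonzero ku i0 by blast
  define q where "q i = (if i \<in> I then (\<lambda>Q. t Q ^ (k i - k i0) * u i Q * inverse (u i0 Q)) else (\<lambda>_. 0))" for i
  show ?thesis
  proof (rule that)
    show "i0 < n" using i0 by (simp add: I_def)
    show "\<forall>\<^sub>F Q in gen. a i0 Q \<noteq> 0"
      using ku(3)[OF i0(1)] tn u0 by eventually_elim auto
    show "q i \<in> regular_at \<M> P" if "i < n" for i
      unfolding q_def using assms(1) tr ku i0 regular_at_inverse[OF ku(1,2)[OF i0(1)]]
      by (auto intro!: regular_at_power regular_at_mult)
    show "\<forall>\<^sub>F Q in gen. a i Q = q i Q * a i0 Q" if "i < n" for i
    proof (cases "i \<in> I")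
      case True
      show ?thesis using ku(3)[OF True] ku(3)[OF i0(1)] u0
      proof eventually_elim
        case (elim Q)
        have "t Q ^ k i = t Q ^ (k i - k i0) * t Q ^ k i0"
          using i0(2)[OF True] by (simp flip: power_add)
        then show ?case using elim True by (simp add: q_def)
      qed
    next
      case False
      then have "\<forall>\<^sub>F Q in gen. a i Q = 0" using that by (auto simp: I_def)
      then show ?thesis using False by (simp add: q_def)
    qed
  qed
qed

end

text \<open>Divide a relation by its coefficient of least order, which stays nonzero generically
  after pullback. The relation then expresses one g as a combination of the others with coefficients
  from the base, and this elimination is the required consequence of relations in the base.\<close>

lemma flat_at_smooth_zcurve:
  assumes "zcurve M" "smooth_zcurve N" "P \<in> M" "f P \<in> N"
    and pull: "\<And>g. g \<in> regular_at (proj_var N) (f P) \<Longrightarrow> g \<circ> f \<in> regular_at (proj_var M) P"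
    and ev: "\<And>A. \<forall>\<^sub>F R in generic N. A R \<Longrightarrow> \<forall>\<^sub>F Q in generic M. A (f Q)"
  shows "flat_at (proj_var M) (proj_var N) f P"
proof -
  interpret M: zcurve M by fact
  interpret N: smooth_zcurve N by fact
  show ?thesis unfolding flat_at_def
  proof (intro allI impI)
    fix n :: nat and a g
    assume ag: "\<forall>i<n. a i \<in> regular_at (proj_var N) (f P) \<and> g i \<in> regular_at (proj_var M) P"
      and "near (proj_var M) P (\<lambda>Q. (\<Sum>i<n. a i (f Q) * g i Q) = 0)"
    then have rel: "\<forall>\<^sub>F Q in M.gen. (\<Sum>i<n. a i (f Q) * g i Q) = 0" by (simp add: M.near_iff)
    show "\<exists>r::nat. \<exists>b h.
        (\<forall>j<r. h j \<in> regular_at (proj_var M) P) \<and>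
        (\<forall>i<n. (\<forall>j<r. b i j \<in> regular_at (proj_var N) (f P)) \<and>
               near (proj_var M) P (\<lambda>Q. g i Q = (\<Sum>j<r. b i j (f Q) * h j Q))) \<and>
        (\<forall>j<r. near (proj_var N) (f P) (\<lambda>R. (\<Sum>i<n. a i R * b i j R) = 0))"
    proof (cases "\<forall>i<n. \<forall>\<^sub>F R in N.gen. a i R = 0")
      case True
      show ?thesis
      \<comment> \<open>If all coefficients vanish, the identity matrix together with g itself is a
        witness.\<close>
      proof (intro exI[of _ n] exI[of _ "\<lambda>i j _. of_bool (i = j)"] exI[of _ g] conjI allI impI)
        fix j assume j: "j < n"
        have "a j (f P) = 0"
          using N.regular_at_eq_at[of "a j" "f P" "\<lambda>_. 0"] True ag j assms(4) by auto
        moreover have "(\<Sum>i<n. a i R * of_bool (i = j)) = a j R" for R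
          using j by (simp add: of_bool_def if_distrib[of "\<lambda>x. _ * x"] sum.delta cong: if_cong)
        ultimately show "near (proj_var N) (f P) (\<lambda>R. (\<Sum>i<n. a i R * of_bool (i = j)) = 0)"
          using True j assms(4) by (simp add: N.near_iff)
      next
        fix i assume i: "i < n"
        have "(\<Sum>j<n. of_bool (i = j) * g j Q) = g i Q" for Q
          using i by (simp add: of_bool_def if_distrib[of "\<lambda>x. x * _"] sum.delta cong: if_cong)
        then show "near (proj_var M) P (\<lambda>Q. g i Q = (\<Sum>j<n. of_bool (i = j) * g j Q))"
          using assms(3) by (simp add: M.near_iff)
      qed (use ag assms(4) in auto)
    next
      case False
      obtain i0 q where i0: "i0 < n" "\<forall>\<^sub>F R in N.gen. a i0 R \<noteq> 0"
        and q: "\<And>i. i < n \<Longrightarrow> q i \<in> regular_at (proj_var N) (f P)"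
          "\<And>i. i < n \<Longrightarrow> \<forall>\<^sub>F R in N.gen. a i R = q i R * a i0 R"
        by (rule N.common_divisor[OF assms(4) _ False]) (use ag in auto)
      have q_all: "\<forall>\<^sub>F R in N.gen. \<forall>i\<in>{..<n}. a i R = q i R * a i0 R"
        using q(2) by (intro eventually_ball_finite) auto
      \<comment> \<open>The identity matrix with row \<open>i0\<close> replaced by the entries - q
        j. Column \<open>i0\<close> is zero, which keeps the size n and avoids renumbering. In each
        other column j the relation reads a j - a i0 q j = 0.\<close>
      define b where "b i j = (if i = i0 then (if j = i0 then (\<lambda>_. 0) else (\<lambda>R. - 1 * q j R))
        else (\<lambda>_. of_bool (i = j)))" for i j
      have b_reg: "b i j \<in> regular_at (proj_var N) (f P)" if "j < n" for i j
        unfolding b_def using q(1)[OF that] assms(4) N.regular_at_cmult[of "q j" "f P" "-1"] by auto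
      show ?thesis
      proof (intro exI[of _ n] exI[of _ b] exI[of _ g] conjI allI impI)
        fix i assume i: "i < n"
        have reg: "(\<lambda>Q. \<Sum>j<n. b i j (f Q) * g j Q) \<in> regular_at (proj_var M) P"
          using b_reg pull ag assms(3) by (intro M.regular_at_sum M.regular_at_mult) (auto simp: comp_def)
        have "\<forall>\<^sub>F Q in M.gen. g i Q = (\<Sum>j<n. b i j (f Q) * g j Q)"
        proof (cases "i = i0")
          case True
          show ?thesis using rel ev[OF q_all] ev[OF i0(2)]
          proof eventually_elim
            case (elim Q)
            have "(\<Sum>i<n. a i (f Q) * g i Q) = a i0 (f Q) * (\<Sum>i<n. q i (f Q) * g i Q)"
              unfolding sum_distrib_left by (intro sum.cong) (use elim in auto)
            then have "(\<Sum>i<n. q i (f Q) * g i Q) = 0" using elim by simp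
            then have "q i0 (f Q) * g i0 Q + (\<Sum>i\<in>{..<n} - {i0}. q i (f Q) * g i Q) = 0"
              using i0 by (simp add: sum.remove[of _ i0])
            moreover have "q i0 (f Q) = 1" using bspec[OF elim(2), of i0] elim(3) i0(1) by simp
            moreover have "(\<Sum>j<n. b i0 j (f Q) * g j Q) = (\<Sum>i\<in>{..<n} - {i0}. - (q i (f Q) * g i Q))"
              using i0 by (subst sum.remove[of _ i0]) (auto simp: b_def intro: sum.cong)
            ultimately show ?case using True by (simp add: sum_negf add_eq_0_iff2)
          qed
        next
          case False
          have "(\<Sum>j<n. of_bool (i = j) * g j Q) = g i Q" for Q
            using i by (simp add: of_bool_def if_distrib[of "\<lambda>x. x * _"] sum.delta cong: if_cong)
          then show ?thesis using False by (simp add: b_def)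
        qed
        then show "near (proj_var M) P (\<lambda>Q. g i Q = (\<Sum>j<n. b i j (f Q) * g j Q))"
          using M.near_eq_iff[OF _ reg, of "g i"] ag i by auto
      next
        fix j assume j: "j < n"
        have reg: "(\<lambda>R. \<Sum>i<n. a i R * b i j R) \<in> regular_at (proj_var N) (f P)"
          using b_reg[OF j] ag assms(4) by (intro N.regular_at_sum N.regular_at_mult) auto
        have "\<forall>\<^sub>F R in N.gen. (\<Sum>i<n. a i R * b i j R) = 0"
          using q(2)[OF j]  q(2)[OF i0(1)] i0(2)
        proof eventually_elim
          case (elim R)
          have 1: "(\<Sum>i\<in>{..<n} - {i0}. a i R * b i j R) = (\<Sum>i\<in>{..<n} - {i0}. a i R * of_bool (i = j))"
            by (intro sum.cong) (auto simp: b_def)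
          have 2: "\<dots> = (if j = i0 then 0 else a j R)"
            using j by (auto simp: of_bool_def if_distrib[of "\<lambda>x. _ * x"] sum.delta cong: if_cong)
          show ?case using 1 2 elim i0(1) by (auto simp: sum.remove[of _ i0] b_def mult.commute)
        qed
        then show "near (proj_var N) (f P) (\<lambda>R. (\<Sum>i<n. a i R * b i j R) = 0)"
          using N.near_eq_iff[OF reg, of "\<lambda>_. 0"] assms(4) by auto
      qed (use ag b_reg in auto)
    qed
  qed
qed

section \<open>The Fermat cubic\<close>

text \<open>
  A function of the form \<open>A + B s + C s\<^sup>2\<close> on the curve \<open>s\<^sup>3 = \<sigma>(t)\<close> has the norm
  \<open>A\<^sup>3 + \<sigma> B\<^sup>3 + \<sigma>\<^sup>2 C\<^sup>3 - 3 \<sigma> A B C\<close> over the \<open>t\<close>-line. If \<open>\<sigma>\<close> has a simple zero at \<open>r\<close>, then the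
  first three terms have distinct orders modulo 3 there, so that the norm vanishes only for \<open>0\<close>.
\<close>

lemma cubic_norm_eq_0_imp_dvd:
  fixes A B C \<sigma> \<sigma>' :: "'k::field poly"
  assumes \<sigma>: "\<sigma> = [:-r, 1:] * \<sigma>'" "poly \<sigma>' r \<noteq> 0"
  shows "A ^ 3 + \<sigma> * B ^ 3 + \<sigma>\<^sup>2 * C ^ 3 = 3 * \<sigma> * A * B * C \<Longrightarrow>
    [:-r, 1:] ^ n dvd A \<and> [:-r, 1:] ^ n dvd B \<and> [:-r, 1:] ^ n dvd C"
proof (induction n arbitrary: A B C)
  case (Suc n)
  define x where "x = [:-r, 1:]"
  have x0: "x \<noteq> 0" "poly x r = 0" by (simp_all add: x_def)
  have \<sigma>x: "\<sigma> = x * \<sigma>'" by (simp add: \<sigma> x_def)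
  have root: "\<exists>q. p = x * q" if "poly p r = 0" for p :: "'k poly"
    using that by (auto simp: poly_eq_0_iff_dvd dvd_def x_def)
  have "poly (A ^ 3 + \<sigma> * B ^ 3 + \<sigma>\<^sup>2 * C ^ 3) r = poly (3 * \<sigma> * A * B * C) r"
    using Suc.prems by simp
  then have "poly A r = 0" by (simp add: \<sigma>x x0)
  then obtain A' where A': "A = x * A'" using root by blast
  have "x * (x\<^sup>2 * A' ^ 3 + \<sigma>' * B ^ 3 + x * \<sigma>'\<^sup>2 * C ^ 3) = x * (3 * x * \<sigma>' * A' * B * C)"
    using Suc.prems unfolding A' \<sigma>x by (simp add: power2_eq_square power3_eq_cube algebra_simps)
  then have eq1: "x\<^sup>2 * A' ^ 3 + \<sigma>' * B ^ 3 + x * \<sigma>'\<^sup>2 * C ^ 3 = 3 * x * \<sigma>' * A' * B * C"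
    using x0 by simp
  then have "poly (x\<^sup>2 * A' ^ 3 + \<sigma>' * B ^ 3 + x * \<sigma>'\<^sup>2 * C ^ 3) r = poly (3 * x * \<sigma>' * A' * B * C) r"
    by (simp only:)
  then have "poly B r = 0" using \<sigma>(2) x0 by simp
  then obtain B' where B': "B = x * B'" using root by blast
  have "x * (x * A' ^ 3 + x\<^sup>2 * \<sigma>' * B' ^ 3 + \<sigma>'\<^sup>2 * C ^ 3) = x * (3 * x * \<sigma>' * A' * B' * C)"
    using eq1 unfolding B' by (simp add: power2_eq_square power3_eq_cube algebra_simps)
  then have eq2: "x * A' ^ 3 + x\<^sup>2 * \<sigma>' * B' ^ 3 + \<sigma>'\<^sup>2 * C ^ 3 = 3 * x * \<sigma>' * A' * B' * C"
    using x0 by simp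
  then have "poly (x * A' ^ 3 + x\<^sup>2 * \<sigma>' * B' ^ 3 + \<sigma>'\<^sup>2 * C ^ 3) r = poly (3 * x * \<sigma>' * A' * B' * C) r"
    by (simp only:)
  then have "poly C r = 0" using \<sigma>(2) x0 by simp
  then obtain C' where C': "C = x * C'" using root by blast
  \<comment> \<open>The quotients by x satisfy the original equation again, so the descent can be
    repeated any number of times.\<close>
  have "x * (A' ^ 3 + \<sigma> * B' ^ 3 + \<sigma>\<^sup>2 * C' ^ 3) = x * (3 * \<sigma> * A' * B' * C')"
    using eq2 unfolding C' \<sigma>x by (simp add: power2_eq_square power3_eq_cube algebra_simps)
  then have "A' ^ 3 + \<sigma> * B' ^ 3 + \<sigma>\<^sup>2 * C' ^ 3 = 3 * \<sigma> * A' * B' * C'"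
    using x0 by simp
  from Suc.IH[OF this] show ?case
    unfolding A' B' C' power_Suc x_def[symmetric] by (auto intro: mult_dvd_mono)
qed simp

lemma cubic_norm_eq_0_imp_eq_0:
  fixes A B C \<sigma> \<sigma>' :: "'k::field poly"
  assumes "\<sigma> = [:-r, 1:] * \<sigma>'" "poly \<sigma>' r \<noteq> 0"
    and "A ^ 3 + \<sigma> * B ^ 3 + \<sigma>\<^sup>2 * C ^ 3 - 3 * \<sigma> * A * B * C = 0"
  shows "A = 0 \<and> B = 0 \<and> C = 0"
proof -
  have "p = 0" if "\<And>n. [:-r, 1:] ^ n dvd p" for p :: "'k poly"
  proof (rule ccontr)
    assume "p \<noteq> 0"
    then have "Polynomial.degree ([:-r, 1:] ^ Suc (Polynomial.degree p)) \<le> Polynomial.degree p"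
      using that dvd_imp_degree_le by blast
    then show False by (simp only: degree_linear_power)
  qed
  then show ?thesis
    using cubic_norm_eq_0_imp_dvd[OF assms(1,2), of A B C] assms(3) by auto
qed

text \<open>Otherwise the product of all X - x, increased by 1, would be a nonconstant polynomial
  without a root.\<close>

lemma infinite_alg_closed: "infinite (UNIV :: 'k::alg_closed_field set)"
proof
  assume fin: "finite (UNIV :: 'k set)"
  define p :: "'k poly" where "p = (\<Prod>x\<in>UNIV. [:-x, 1:])"
  have "Polynomial.degree p = card (UNIV :: 'k set)"
    unfolding p_def by (subst degree_prod_eq_sum_degree) auto
  then have "Polynomial.degree (p + 1) > 0"
    using fin by (simp add: degree_add_eq_left card_gt_0_iff)
  then obtain x where "poly (p + 1) x = 0" using alg_closed_imp_poly_has_root by blast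
  moreover have "poly p x = 0" using fin unfolding p_def by (simp add: poly_prod prod_zero_iff)
  ultimately show False by simp
qed

lemma finite_cube_roots: "finite {s::'k::field. s ^ 3 = k}"
proof -
  have "{s. s ^ 3 = k} = {s. poly [:-k, 0, 0, 1:] s = 0}" by (auto simp: power3_eq_cube algebra_simps)
  then show ?thesis using poly_roots_finite[of "[:-k, 0, 0, 1:]"] by simp
qed

lemma (in proj_set) regular_at_poly:
  "f \<in> regular_at \<M> P \<Longrightarrow> (\<lambda>Q. poly p (f Q)) \<in> regular_at \<M> P"
  by (induction p) (auto intro!: regular_at_add regular_at_mult regular_at_const dest: regular_at_mem)

text \<open>Either g is a unit at P, or a factor t can be cancelled from both sides. It is applied
  to a function whose multiple, its norm, has a visible order.\<close>

lemma (in zcurve) divisor_of_uniformizer_power: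
  assumes t: "uniformizer \<M> P t" "\<forall>\<^sub>F Q in gen. t Q \<noteq> 0"
    and u: "u \<in> regular_at \<M> P" "u P \<noteq> 0" and g': "g' \<in> regular_at \<M> P"
  shows "g \<in> regular_at \<M> P \<Longrightarrow> \<forall>\<^sub>F Q in gen. g Q * g' Q = t Q ^ k * u Q \<Longrightarrow>
    \<exists>j w. w \<in> regular_at \<M> P \<and> w P \<noteq> 0 \<and> (\<forall>\<^sub>F Q in gen. g Q = t Q ^ j * w Q)"
proof (induction k arbitrary: g)
  case 0
  have "g P * g' P = u P"
    using 0 u g' by (intro regular_at_eq_at[of "\<lambda>Q. g Q * g' Q" P u]) auto
  then show ?case using 0 u by (intro exI[of _ 0] exI[of _ g]) auto
next
  case (Suc k)
  show ?case
  proof (cases "g P = 0")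
    case True
    then obtain h where h: "h \<in> regular_at \<M> P" "\<forall>\<^sub>F Q in gen. g Q = t Q * h Q"
      using t(1) Suc.prems by (auto simp: uniformizer_iff)
    have "\<forall>\<^sub>F Q in gen. h Q * g' Q = t Q ^ k * u Q"
      using h(2) t(2) Suc.prems(2) by eventually_elim auto
    from Suc.IH[OF h(1) this] obtain j w where jw: "w \<in> regular_at \<M> P" "w P \<noteq> 0"
      "\<forall>\<^sub>F Q in gen. h Q = t Q ^ j * w Q" by blast
    have "\<forall>\<^sub>F Q in gen. g Q = t Q ^ Suc j * w Q" using h(2) jw(3) by eventually_elim simp
    with jw show ?thesis by blast
  next
    case False
    then show ?thesis using Suc.prems by (intro exI[of _ 0] exI[of _ g]) auto
  qed
qed

text \<open>The coordinates are abstract linear forms, so that permuting them gives another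
  instance. Facts are proved on one chart and carried to the others by \<open>rotate\<close> and
  \<open>swap\<close>.\<close>

locale fermat_cubic =
  fixes M :: "('k::alg_closed_field^3) set set" and a b c :: "'k^3 \<Rightarrow> 'k"
  assumes three: "(3::'k) \<noteq> 0"
    and linear: "form UNIV 1 a" "form UNIV 1 b" "form UNIV 1 c"
    and span: "\<And>i. \<exists>\<alpha> \<beta> \<gamma>. \<forall>v. v $ i = \<alpha> * a v + \<beta> * b v + \<gamma> * c v"
    and onto: "\<And>x y z. \<exists>v. a v = x \<and> b v = y \<and> c v = z"
    and M_eq: "M = {pt v | v. v \<noteq> 0 \<and> a v ^ 3 + b v ^ 3 + c v ^ 3 = 0}"
begin

lemma rotate: "fermat_cubic M b c a"
proof
  show "\<exists>\<alpha> \<beta> \<gamma>. \<forall>v. v $ i = \<alpha> * b v + \<beta> * c v + \<gamma> * a v" for i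
    using span[of i] by (metis add.assoc add.commute)
  show "\<exists>v. b v = x \<and> c v = y \<and> a v = z" for x y z using onto by blast
qed (auto simp: three linear M_eq add.commute add.left_commute)

lemma swap: "fermat_cubic M b a c"
proof
  show "\<exists>\<alpha> \<beta> \<gamma>. \<forall>v. v $ i = \<alpha> * b v + \<beta> * a v + \<gamma> * c v" for i
    using span[of i] by (metis add.commute)
  show "\<exists>v. b v = x \<and> a v = y \<and> c v = z" for x y z using onto by blast
qed (auto simp: three linear M_eq add.commute add.left_commute)

sublocale proj_set M
  by unfold_locales (auto simp: M_eq)

lemma scale: "a (k *s v) = k * a v" "b (k *s v) = k * b v" "c (k *s v) = k * c v"
  using form_scale[OF linear(1)] form_scale[OF linear(2)] form_scale[OF linear(3)] by simp_all

lemma vec_eqI: "a v = a w \<Longrightarrow> b v = b w \<Longrightarrow> c v = c w \<Longrightarrow> v = w"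
  unfolding vec_eq_iff by (metis span)

lemma eq_0_iff: "v = 0 \<longleftrightarrow> a v = 0 \<and> b v = 0 \<and> c v = 0"
  using scale[of 0 v] vec_eqI[of v 0] scale[of 0 0] by auto

lemma mem_M: "pt v \<in> M \<longleftrightarrow> v \<noteq> 0 \<and> a v ^ 3 + b v ^ 3 + c v ^ 3 = 0"
proof
  assume "pt v \<in> M"
  then obtain w k where "w \<noteq> 0" "a w ^ 3 + b w ^ 3 + c w ^ 3 = 0" "k \<noteq> 0" "v = k *s w"
    by (auto simp: M_eq pt_eq_iff)
  then show "v \<noteq> 0 \<and> a v ^ 3 + b v ^ 3 + c v ^ 3 = 0"
    by (simp add: scale power_mult_distrib flip: distrib_left)
qed (auto simp: M_eq)

lemma two_nonzero:
  assumes "pt v \<in> M"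
  shows "a v \<noteq> 0 \<or> b v \<noteq> 0" "a v \<noteq> 0 \<or> c v \<noteq> 0" "b v \<noteq> 0 \<or> c v \<noteq> 0"
  using assms by (auto simp: mem_M eq_0_iff)

text \<open>Division with remainder by the monic equation of the curve in b: on a = 1, powers of b
  from the third on are replaced by polynomials in c.\<close>

lemma normal_form:
  assumes "form UNIV d G"
  shows "\<exists>A B C. \<forall>v. a v = 1 \<longrightarrow> b v ^ 3 = - 1 - c v ^ 3 \<longrightarrow>
    G v = poly A (c v) + poly B (c v) * b v + poly C (c v) * (b v)\<^sup>2"
  using assms
proof (induction rule: form.induct)
  case (form_const k)
  show ?case by (rule exI[of _ "[:k:]"], rule exI[of _ 0], rule exI[of _ 0]) auto
next
  case (form_coord i)
  from span[of i] obtain \<alpha> \<beta> \<gamma> where "\<And>v. v $ i = \<alpha> * a v + \<beta> * b v + \<gamma> * c v" by blast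
  then show ?case
    by (intro exI[of _ "[:\<alpha>, \<gamma>:]"] exI[of _ "[:\<beta>:]"] exI[of _ 0]) auto
next
  case (form_add d p q)
  then obtain A B C A' B' C' where
    "\<And>v. a v = 1 \<Longrightarrow> b v ^ 3 = - 1 - c v ^ 3 \<Longrightarrow>
      p v = poly A (c v) + poly B (c v) * b v + poly C (c v) * (b v)\<^sup>2"
    "\<And>v. a v = 1 \<Longrightarrow> b v ^ 3 = - 1 - c v ^ 3 \<Longrightarrow>
      q v = poly A' (c v) + poly B' (c v) * b v + poly C' (c v) * (b v)\<^sup>2" by blast
  then show ?case
    by (intro exI[of _ "A + A'"] exI[of _ "B + B'"] exI[of _ "C + C'"]) (auto simp: algebra_simps)
next
  case (form_mult d p e q)
  then obtain A B C A' B' C' where pq: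
    "\<And>v. a v = 1 \<Longrightarrow> b v ^ 3 = - 1 - c v ^ 3 \<Longrightarrow>
      p v = poly A (c v) + poly B (c v) * b v + poly C (c v) * (b v)\<^sup>2"
    "\<And>v. a v = 1 \<Longrightarrow> b v ^ 3 = - 1 - c v ^ 3 \<Longrightarrow>
      q v = poly A' (c v) + poly B' (c v) * b v + poly C' (c v) * (b v)\<^sup>2" by blast
  define \<sigma> :: "'k poly" where "\<sigma> = [:-1, 0, 0, -1:]"
  have \<sigma>: "poly \<sigma> t = - 1 - t ^ 3" for t by (simp add: \<sigma>_def power3_eq_cube)
  show ?case
  proof (rule exI[of _ "A * A' + \<sigma> * (B * C' + C * B')"], rule exI[of _ "A * B' + B * A' + \<sigma> * C * C'"],
      rule exI[of _ "A * C' + B * B' + C * A'"], intro allI impI)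
    fix v assume v: "a v = 1" "b v ^ 3 = - 1 - c v ^ 3"
    have "poly \<sigma> (c v) = b v ^ 3" using v \<sigma> by simp
    then show "p v * q v = poly (A * A' + \<sigma> * (B * C' + C * B')) (c v)
       + poly (A * B' + B * A' + \<sigma> * C * C') (c v) * b v
       + poly (A * C' + B * B' + C * A') (c v) * (b v)\<^sup>2"
      unfolding pq(1)[OF v] pq(2)[OF v] by (simp add: power2_eq_square power3_eq_cube algebra_simps)
  qed
qed

lemma regular_coord:
  assumes "P \<in> M" "P \<in> nonvanishing a"
  shows "ratio b a \<in> regular_at \<M> P" "ratio c a \<in> regular_at \<M> P"
  using assms by (auto intro: regular_at_ratio linear)

lemma ratio_coord: "ratio b a (pt v) = b v / a v" "ratio c a (pt v) = c v / a v"
  by (rule ratio_pt linear)+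

lemma chart_point:
  assumes "pt v \<in> M" "a v \<noteq> 0"
  shows "(b v / a v) ^ 3 = - 1 - (c v / a v) ^ 3"
proof -
  have "a v ^ 3 + b v ^ 3 + c v ^ 3 = 0" using assms by (simp add: mem_M)
  then have "b v ^ 3 = - (a v ^ 3) - c v ^ 3" by Groebner_Basis.algebra
  then show ?thesis using assms(2) by (simp add: power_divide divide_simps)
qed

text \<open>The identity x^3 + y^3 + z^3 - 3xyz = (x + y + z)(x^2 + y^2 + z^2 - xy - yz - zx), taken
  at x = A, y = B s, z = C s^2 with s^3 = \<sigma>(t), multiplies the normal form of
  \<open>G\<close> to a polynomial in t alone.\<close>

lemma chart_norm:
  assumes G: "form UNIV d G" and v0: "pt v0 \<in> M" "a v0 \<noteq> 0" "G v0 \<noteq> 0"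
  shows "\<exists>N g'. N \<noteq> 0 \<and> (\<forall>P\<in>M \<inter> nonvanishing a. g' \<in> regular_at \<M> P) \<and>
    (\<forall>v. pt v \<in> M \<longrightarrow> a v \<noteq> 0 \<longrightarrow> G v / a v ^ d * g' (pt v) = poly N (c v / a v))"
proof -
  obtain A B C where ABC: "\<And>v. a v = 1 \<Longrightarrow> b v ^ 3 = - 1 - c v ^ 3 \<Longrightarrow>
    G v = poly A (c v) + poly B (c v) * b v + poly C (c v) * (b v)\<^sup>2"
    using normal_form[OF G] by blast
  have Gv: "G v / a v ^ d = poly A (c v / a v) + poly B (c v / a v) * (b v / a v)
      + poly C (c v / a v) * (b v / a v)\<^sup>2" if "pt v \<in> M" "a v \<noteq> 0" for v
    using ABC[of "inverse (a v) *s v"] chart_point[OF that] that(2)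
    by (simp add: scale form_scale[OF G] field_simps)
  define \<sigma> :: "'k poly" where "\<sigma> = [:-1, 0, 0, -1:]"
  define N where "N = A ^ 3 + \<sigma> * B ^ 3 + \<sigma>\<^sup>2 * C ^ 3 - 3 * \<sigma> * A * B * C"
  \<comment> \<open>The second factor of that identity, sorted by powers of s after replacing s^3 by
    \<sigma>(t).\<close>
  define g' where "g' Q = poly (A\<^sup>2 - \<sigma> * B * C) (ratio c a Q)
      + poly (\<sigma> * C\<^sup>2 - A * B) (ratio c a Q) * ratio b a Q
      + poly (B\<^sup>2 - A * C) (ratio c a Q) * (ratio b a Q)\<^sup>2" for Q
  show ?thesis
  proof (intro exI[of _ N] exI[of _ g'] conjI ballI allI impI)
    show "N \<noteq> 0"
    proof
      assume "N = 0"
      \<comment> \<open>The zero -1 of -1 - t^3 is simple, because the cofactor has the value -3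
        there.\<close>
      have "\<sigma> = [:- (- 1), 1:] * [:-1, 1, -1:]" by (simp add: \<sigma>_def)
      moreover have "poly [:-1, 1, -1:] (- 1 :: 'k) \<noteq> 0" using three by simp
      ultimately have "A = 0 \<and> B = 0 \<and> C = 0"
        using \<open>N = 0\<close> unfolding N_def by (rule cubic_norm_eq_0_imp_eq_0)
      then show False using Gv[OF v0(1,2)] v0 by simp
    qed
    show "g' \<in> regular_at \<M> P" if "P \<in> M \<inter> nonvanishing a" for P
      unfolding g'_def using that
      by (intro regular_at_add regular_at_mult regular_at_poly regular_at_power regular_coord) auto
    show "G v / a v ^ d * g' (pt v) = poly N (c v / a v)" if v: "pt v \<in> M" "a v \<noteq> 0" for v
    proof -
      define s t where "s = b v / a v" and "t = c v / a v"
      have \<sigma>: "poly \<sigma> t = s ^ 3"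
        using chart_point[OF v] unfolding s_def[symmetric] t_def[symmetric]
        by (simp add: \<sigma>_def power3_eq_cube)
      show ?thesis
        unfolding Gv[OF v] g'_def ratio_coord N_def s_def[symmetric] t_def[symmetric]
        by (simp add: \<sigma>) Groebner_Basis.algebra
    qed
  qed
qed

lemma finite_fibre: "finite {Q \<in> M \<inter> nonvanishing a. ratio c a Q \<in> T}" if "finite T"
proof -
  let ?f = "\<lambda>Q. (ratio b a Q, ratio c a Q)"
  let ?X = "{Q \<in> M \<inter> nonvanishing a. ratio c a Q \<in> T}"
  have rep: "\<exists>v. Q = pt v \<and> a v = 1" if "Q \<in> ?X" for Q
  proof -
    from that repr obtain v where v: "Q = pt v" by blast
    then have "a v \<noteq> 0" using that nonvanishing_pt[OF linear(1)] by auto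
    then show ?thesis using v by (intro exI[of _ "inverse (a v) *s v"]) (simp add: scale pt_scale)
  qed
  have "inj_on ?f ?X"
  proof (rule inj_onI)
    fix Q R assume Q: "Q \<in> ?X" and R: "R \<in> ?X" and eq: "?f Q = ?f R"
    obtain v where v: "Q = pt v" "a v = 1" using rep Q by blast
    obtain w where w: "R = pt w" "a w = 1" using rep R by blast
    have "v = w" using eq v w by (intro vec_eqI) (auto simp: ratio_coord)
    then show "Q = R" using v w by simp
  qed
  have "?f ` ?X \<subseteq> (\<Union>t\<in>T. {s. s ^ 3 = - 1 - t ^ 3}) \<times> T"
  proof (rule image_subsetI)
    fix Q assume Q: "Q \<in> ?X"
    then obtain v where v: "Q = pt v" "a v = 1" using rep by blast
    then show "?f Q \<in> (\<Union>t\<in>T. {s. s ^ 3 = - 1 - t ^ 3}) \<times> T"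
      using Q chart_point[of v] by (auto simp: ratio_coord)
  qed
  moreover have "finite ((\<Union>t\<in>T. {s. s ^ 3 = - 1 - t ^ 3}) \<times> T)"
    using that finite_cube_roots by (intro finite_cartesian_product finite_UN_I)
  ultimately have "finite (?f ` ?X)" using finite_subset by blast
  then show ?thesis using \<open>inj_on ?f ?X\<close> by (rule finite_imageD)
qed

text \<open>On the line a = 0 the coordinate b is nonzero, so these points form the fibre of a/b
  over 0 in the rotated chart.\<close>

lemma finite_line: "finite {Q \<in> M. Q \<notin> nonvanishing a}"
proof -
  interpret R: fermat_cubic M b c a by (rule rotate)
  have "{Q \<in> M. Q \<notin> nonvanishing a} \<subseteq> {Q \<in> M \<inter> nonvanishing b. ratio a b Q \<in> {0}}"
  proof
    fix Q assume Q: "Q \<in> {Q \<in> M. Q \<notin> nonvanishing a}"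
    then obtain v where v: "Q = pt v" using repr by blast
    then have "a v = 0" using Q nonvanishing_pt[OF linear(1)] by auto
    then show "Q \<in> {Q \<in> M \<inter> nonvanishing b. ratio a b Q \<in> {0}}"
      using Q v two_nonzero[of v] by (auto simp: nonvanishing_pt[OF linear(2)] R.ratio_coord)
  qed
  then show ?thesis using R.finite_fibre[of "{0}"] finite_subset by blast
qed

text \<open>A zero of \<open>G\<close> off the line a = 0 lies over a root of the norm polynomial,
  and both the roots and the fibres over them are finite.\<close>

lemma finite_zeros_chart:
  assumes G: "form UNIV d G" and v0: "pt v0 \<in> M" "a v0 \<noteq> 0" "G v0 \<noteq> 0"
  shows "finite {Q \<in> M. Q \<notin> nonvanishing G}"
proof -
  obtain N g' where N: "N \<noteq> 0" "\<And>P. P \<in> M \<Longrightarrow> P \<in> nonvanishing a \<Longrightarrow> g' \<in> regular_at \<M> P"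
    "\<And>v. pt v \<in> M \<Longrightarrow> a v \<noteq> 0 \<Longrightarrow> G v / a v ^ d * g' (pt v) = poly N (c v / a v)"
    using chart_norm[OF assms] by blast
  have "{Q \<in> M. Q \<notin> nonvanishing G} \<subseteq>
      {Q \<in> M. Q \<notin> nonvanishing a} \<union> {Q \<in> M \<inter> nonvanishing a. ratio c a Q \<in> {t. poly N t = 0}}"
  proof
    fix Q assume Q: "Q \<in> {Q \<in> M. Q \<notin> nonvanishing G}"
    then obtain v where v: "Q = pt v" using repr by blast
    then have "G v = 0" using Q nonvanishing_pt[OF G] by auto
    then show "Q \<in> {Q \<in> M. Q \<notin> nonvanishing a} \<union>
        {Q \<in> M \<inter> nonvanishing a. ratio c a Q \<in> {t. poly N t = 0}}"
      using Q v N(3)[of v] by (auto simp: nonvanishing_pt[OF linear(1)] ratio_coord)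
  qed
  then show ?thesis
    using finite_line finite_fibre[OF poly_roots_finite[OF N(1)]] finite_subset by blast
qed

lemma finite_zeros:
  assumes G: "form UNIV d G" and v0: "pt v0 \<in> M" "G v0 \<noteq> 0"
  shows "finite {Q \<in> M. Q \<notin> nonvanishing G}"
proof (cases "a v0 = 0")
  case True
  then have "b v0 \<noteq> 0" using two_nonzero v0 by blast
  then show ?thesis using fermat_cubic.finite_zeros_chart[OF rotate] assms by blast
qed (use finite_zeros_chart assms in blast)

sublocale zcurve M
proof
  have "t \<in> ratio c a ` M" for t
  proof -
    obtain s where s: "s ^ 3 = - 1 - t ^ 3" using nth_root_exists[of 3] by auto
    obtain v where v: "a v = 1" "b v = s" "c v = t" using onto by blast
    then have "pt v \<in> M" using s by (auto simp: mem_M eq_0_iff)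
    then show ?thesis using v by (intro image_eqI[of _ _ "pt v"]) (auto simp: ratio_coord)
  qed
  then have "UNIV \<subseteq> ratio c a ` M" by auto
  then show "infinite M" using infinite_alg_closed finite_subset by blast
  fix U assume U: "U \<in> opens \<M>" "U \<noteq> {}"
  then obtain P d H where P: "P \<in> U" "form UNIV d H" "P \<in> nonvanishing H" "M \<inter> nonvanishing H \<subseteq> U"
    unfolding mem_opens by blast
  moreover obtain v where v: "P = pt v" using P(1) U repr opens_subset by blast
  ultimately have "finite {Q \<in> M. Q \<notin> nonvanishing H}"
    using U opens_subset finite_zeros[OF P(2), of v] nonvanishing_pt[OF P(2)] by blast
  moreover have "M - U \<subseteq> {Q \<in> M. Q \<notin> nonvanishing H}" using P by auto
  ultimately show "finite (M - U)" using finite_subset by blast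
qed

lemma eventually_chart: "\<forall>\<^sub>F Q in gen. \<exists>v. Q = pt v \<and> pt v \<in> M \<and> a v \<noteq> 0"
proof -
  have "{Q \<in> M. \<not> (\<exists>v. Q = pt v \<and> pt v \<in> M \<and> a v \<noteq> 0)} \<subseteq> {Q \<in> M. Q \<notin> nonvanishing a}"
    using repr nonvanishing_pt[OF linear(1)] by blast
  then show ?thesis unfolding eventually_generic using finite_line finite_subset by blast
qed

text \<open>Divisibility of G - G(v0) by t - t0 passes to sums, and to products by xy - x0 y0 = (x -
  x0) y + x0 (y - y0). So only the coordinates have to be treated, and there only s needs the
  equation of the curve.\<close>

lemma local_expansion:
  assumes v0: "pt v0 \<in> M" "a v0 \<noteq> 0" "b v0 \<noteq> 0" and G: "form UNIV d G"
  shows "\<exists>h\<in>regular_at \<M> (pt v0). \<forall>\<^sub>F Q in gen. \<forall>v. Q = pt v \<longrightarrow>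
    G v / a v ^ d - G v0 / a v0 ^ d = (c v / a v - c v0 / a v0) * h Q"
  using G
proof (induction rule: form.induct)
  case (form_const k)
  show ?case using v0 by (intro bexI[of _ "\<lambda>_. 0"]) auto
next
  case (form_coord i)
  from span[of i] obtain \<alpha> \<beta> \<gamma> where coord: "\<And>v. v $ i = \<alpha> * a v + \<beta> * b v + \<gamma> * c v" by blast
  define s0 t0 where "s0 = b v0 / a v0" and "t0 = c v0 / a v0"
  \<comment> \<open>The cofactors in s^3 - s0^3 = (s - s0) S and t^3 - t0^3 = (t - t0) T. The curve
    gives (s - s0) S = - (t - t0) T, and S is invertible at the point since its value 3 s0^2 is
    nonzero.\<close>
  define S T where "S = (\<lambda>Q. (ratio b a Q)\<^sup>2 + s0 * ratio b a Q + s0\<^sup>2)"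
    and "T = (\<lambda>Q. (ratio c a Q)\<^sup>2 + t0 * ratio c a Q + t0\<^sup>2)"
  have nv: "pt v0 \<in> nonvanishing a" using v0 by (simp add: nonvanishing_pt[OF linear(1)])
  have S: "S \<in> regular_at \<M> (pt v0)" and T: "T \<in> regular_at \<M> (pt v0)"
    unfolding S_def T_def
    by (intro regular_at_add regular_at_power regular_at_cmult regular_coord regular_at_const v0 nv)+
  have "S (pt v0) = 3 * s0\<^sup>2"
    by (simp add: S_def ratio_coord s0_def[symmetric] power2_eq_square)
  then have S0: "S (pt v0) \<noteq> 0" using three v0 by (simp add: s0_def)
  define h where "h = (\<lambda>Q. \<beta> * (- 1 * (T Q * inverse (S Q))) + \<gamma>)"
  have "h \<in> regular_at \<M> (pt v0)"
    unfolding h_def by (intro regular_at_add regular_at_cmult regular_at_mult regular_at_inverse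
        regular_at_const v0 S T S0)
  moreover have "\<forall>\<^sub>F Q in gen. \<forall>v. Q = pt v \<longrightarrow>
      v $ i / a v ^ 1 - v0 $ i / a v0 ^ 1 = (c v / a v - c v0 / a v0) * h Q"
    using eventually_nonzero[OF S S0] eventually_chart
  proof eventually_elim
    case (elim Q)
    show ?case
    proof (intro allI impI)
      fix v assume v: "Q = pt v"
      then have "pt v \<in> M" using elim by metis
      moreover have "a v \<noteq> 0"
        using elim v nonvanishing_pt[OF linear(1)] by metis
      ultimately have "pt v \<in> M" "a v \<noteq> 0" by simp_all
      define s t where "s = b v / a v" and "t = c v / a v"
      have "s ^ 3 = - 1 - t ^ 3" using chart_point[OF \<open>pt v \<in> M\<close> \<open>a v \<noteq> 0\<close>] by (simp add: s_def t_def)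
      moreover have "s0 ^ 3 = - 1 - t0 ^ 3" using chart_point[OF v0(1,2)] by (simp add: s0_def t0_def)
      moreover have SQ: "S Q = s\<^sup>2 + s0 * s + s0\<^sup>2" and TQ: "T Q = t\<^sup>2 + t0 * t + t0\<^sup>2"
        by (simp_all add: S_def T_def v ratio_coord s_def t_def)
      ultimately have "(s - s0) * S Q = - (t - t0) * T Q"
        unfolding SQ TQ by Groebner_Basis.algebra
      then have s: "s - s0 = (t - t0) * (- 1 * (T Q * inverse (S Q)))"
        using elim(1) by (simp add: field_simps)
      have "v $ i / a v ^ 1 - v0 $ i / a v0 ^ 1 = \<beta> * (s - s0) + \<gamma> * (t - t0)"
        unfolding coord s_def t_def s0_def t0_def using \<open>a v \<noteq> 0\<close> v0(2) by (simp add: field_simps)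
      also have "\<dots> = (t - t0) * h Q" unfolding s h_def by (simp add: algebra_simps)
      finally show "v $ i / a v ^ 1 - v0 $ i / a v0 ^ 1 = (c v / a v - c v0 / a v0) * h Q"
        by (simp add: t_def t0_def)
    qed
  qed
  ultimately show ?case by blast
next
  case (form_add d p q)
  then obtain h h' where h: "h \<in> regular_at \<M> (pt v0)" "h' \<in> regular_at \<M> (pt v0)"
    "\<forall>\<^sub>F Q in gen. \<forall>v. Q = pt v \<longrightarrow> p v / a v ^ d - p v0 / a v0 ^ d = (c v / a v - c v0 / a v0) * h Q"
    "\<forall>\<^sub>F Q in gen. \<forall>v. Q = pt v \<longrightarrow> q v / a v ^ d - q v0 / a v0 ^ d = (c v / a v - c v0 / a v0) * h' Q"
    by blast
  show ?case
  proof (rule bexI[of _ "\<lambda>Q. h Q + h' Q"])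
    show "\<forall>\<^sub>F Q in gen. \<forall>v. Q = pt v \<longrightarrow> (p v + q v) / a v ^ d - (p v0 + q v0) / a v0 ^ d
        = (c v / a v - c v0 / a v0) * (h Q + h' Q)"
      using h(3,4)
    proof eventually_elim
      case (elim Q)
      show ?case
      proof (intro allI impI)
        fix v assume "Q = pt v"
        with elim have "p v / a v ^ d - p v0 / a v0 ^ d = (c v / a v - c v0 / a v0) * h Q"
          "q v / a v ^ d - q v0 / a v0 ^ d = (c v / a v - c v0 / a v0) * h' Q" by blast+
        then show "(p v + q v) / a v ^ d - (p v0 + q v0) / a v0 ^ d
            = (c v / a v - c v0 / a v0) * (h Q + h' Q)"
          unfolding distrib_left by (metis (no_types) add_diff_add add_divide_distrib)
      qed
    qed
  qed (use h in auto)
next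
  case (form_mult d p e q)
  then obtain h h' where h: "h \<in> regular_at \<M> (pt v0)" "h' \<in> regular_at \<M> (pt v0)"
    "\<forall>\<^sub>F Q in gen. \<forall>v. Q = pt v \<longrightarrow> p v / a v ^ d - p v0 / a v0 ^ d = (c v / a v - c v0 / a v0) * h Q"
    "\<forall>\<^sub>F Q in gen. \<forall>v. Q = pt v \<longrightarrow> q v / a v ^ e - q v0 / a v0 ^ e = (c v / a v - c v0 / a v0) * h' Q"
    by blast
  have ae: "form UNIV n (\<lambda>v. a v ^ n)" for n using form_power[OF linear(1), of n] by simp
  have nv: "pt v0 \<in> nonvanishing (\<lambda>v. a v ^ e)" using v0 by (simp add: nonvanishing_pt[OF ae])
  show ?case
  proof (rule bexI[of _ "\<lambda>Q. h Q * ratio q (\<lambda>v. a v ^ e) Q + p v0 / a v0 ^ d * h' Q"])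
    show "\<forall>\<^sub>F Q in gen. \<forall>v. Q = pt v \<longrightarrow> (p v * q v) / a v ^ (d + e) - (p v0 * q v0) / a v0 ^ (d + e)
        = (c v / a v - c v0 / a v0) * (h Q * ratio q (\<lambda>v. a v ^ e) Q + p v0 / a v0 ^ d * h' Q)"
      using h(3,4)
    proof eventually_elim
      case (elim Q)
      show ?case
      proof (intro allI impI)
        fix v assume v: "Q = pt v"
        define x x0 y y0 z where "x = p v / a v ^ d" and "x0 = p v0 / a v0 ^ d"
          and "y = q v / a v ^ e" and "y0 = q v0 / a v0 ^ e" and "z = c v / a v - c v0 / a v0"
        have xy: "x - x0 = z * h Q" "y - y0 = z * h' Q"
          using elim v by (auto simp: x_def x0_def y_def y0_def z_def)
        have r: "ratio q (\<lambda>v. a v ^ e) Q = y"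
          unfolding v y_def by (rule ratio_pt[OF form_mult(2) ae])
        have "(p v * q v) / a v ^ (d + e) - (p v0 * q v0) / a v0 ^ (d + e) = x * y - x0 * y0"
          by (simp add: x_def x0_def y_def y0_def power_add)
        also have "\<dots> = (x - x0) * y + x0 * (y - y0)" by (simp add: algebra_simps)
        also have "\<dots> = z * (h Q * y + x0 * h' Q)" unfolding xy by (simp add: algebra_simps)
        finally show "(p v * q v) / a v ^ (d + e) - (p v0 * q v0) / a v0 ^ (d + e)
          = (c v / a v - c v0 / a v0) * (h Q * ratio q (\<lambda>v. a v ^ e) Q + p v0 / a v0 ^ d * h' Q)"
          unfolding r z_def x0_def .
      qed
    qed
    show "(\<lambda>Q. h Q * ratio q (\<lambda>v. a v ^ e) Q + p v0 / a v0 ^ d * h' Q) \<in> regular_at \<M> (pt v0)"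
      by (intro regular_at_add regular_at_mult regular_at_cmult regular_at_ratio[OF v0(1) form_mult(2) ae nv]
          regular_at_const h v0)
  qed
qed

text \<open>By \<open>local_expansion\<close> the function t - t0 divides every germ vanishing at
  the point. Orders are finite because a numerator divides its norm, which is (t - t0)^k times a
  polynomial nonzero at t0.\<close>

lemma dvr_at_chart:
  assumes v0: "pt v0 \<in> M" "a v0 \<noteq> 0" "b v0 \<noteq> 0"
  shows "dvr_at (pt v0) (\<lambda>Q. ratio c a Q - c v0 / a v0)" (is "dvr_at ?P ?t")
proof -
  have nv: "?P \<in> nonvanishing a" using v0 by (simp add: nonvanishing_pt[OF linear(1)])
  have ae: "form UNIV n (\<lambda>v. a v ^ n)" for n using form_power[OF linear(1), of n] by simp
  have nva: "?P \<in> nonvanishing (\<lambda>v. a v ^ n)" for n using v0 by (simp add: nonvanishing_pt[OF ae])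
  have t: "?t \<in> regular_at \<M> ?P"
    by (intro regular_at_diff regular_coord regular_at_const v0 nv)
  have t0: "?t ?P = 0" by (simp add: ratio_coord)
  have unif: "uniformizer \<M> ?P ?t"
    unfolding uniformizer_iff
  proof (intro conjI ballI impI t t0)
    fix g assume g: "g \<in> regular_at \<M> ?P" "g ?P = 0"
    from regular_atE[OF g(1) refl] obtain d G H where GH: "form UNIV d G" "form UNIV d H" "H v0 \<noteq> 0"
      "\<And>v. pt v \<in> M \<Longrightarrow> H v \<noteq> 0 \<Longrightarrow> g (pt v) = G v / H v" by blast
    have "G v0 = 0" using GH(3) GH(4)[OF v0(1)] g(2) by simp
    with local_expansion[OF v0 GH(1)] obtain h where h: "h \<in> regular_at \<M> ?P"
      "\<forall>\<^sub>F Q in gen. \<forall>v. Q = pt v \<longrightarrow> G v / a v ^ d = (c v / a v - c v0 / a v0) * h Q" by auto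
    have nvH: "?P \<in> nonvanishing H" using GH by (simp add: nonvanishing_pt[OF GH(2)])
    have "(\<lambda>Q. h Q * ratio (\<lambda>v. a v ^ d) H Q) \<in> regular_at \<M> ?P"
      by (intro regular_at_mult h regular_at_ratio[OF v0(1) ae GH(2) nvH])
    moreover have "\<forall>\<^sub>F Q in gen. Q \<in> nonvanishing H"
      using finite_zeros[OF GH(2) v0(1) GH(3)] by (simp add: eventually_generic)
    then have "\<forall>\<^sub>F Q in gen. g Q = ?t Q * (h Q * ratio (\<lambda>v. a v ^ d) H Q)"
      using h(2) eventually_chart
    proof eventually_elim
      case (elim Q)
      then obtain v where v: "Q = pt v" "pt v \<in> M" "a v \<noteq> 0" by blast
      then have "H v \<noteq> 0" using elim nonvanishing_pt[OF GH(2)] by auto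
      have "?t Q * h Q = G v / a v ^ d" using elim v by (simp add: ratio_coord)
      then show ?case
        using GH(4)[OF v(2) \<open>H v \<noteq> 0\<close>] v by (simp add: ratio_pt[OF ae GH(2)] flip: mult.assoc)
    qed
    ultimately show "\<exists>h\<in>regular_at \<M> ?P. \<forall>\<^sub>F Q in gen. g Q = ?t Q * h Q"
      by (intro bexI[of _ "\<lambda>Q. h Q * ratio (\<lambda>v. a v ^ d) H Q"])
  qed
  have tn: "\<forall>\<^sub>F Q in gen. ?t Q \<noteq> 0"
  proof -
    have "{Q \<in> M. \<not> ?t Q \<noteq> 0} \<subseteq> {Q \<in> M. Q \<notin> nonvanishing a} \<union>
        {Q \<in> M \<inter> nonvanishing a. ratio c a Q \<in> {c v0 / a v0}}" by auto
    then show ?thesis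
      unfolding eventually_generic using finite_line finite_fibre[of "{c v0 / a v0}"] finite_subset by blast
  qed
  have "(\<forall>\<^sub>F Q in gen. g Q = 0) \<or>
        (\<exists>n u. u \<in> regular_at \<M> ?P \<and> u ?P \<noteq> 0 \<and> (\<forall>\<^sub>F Q in gen. g Q = ?t Q ^ n * u Q))"
    if g: "g \<in> regular_at \<M> ?P" for g
  proof -
    from regular_atE[OF g refl] obtain d G H where GH: "form UNIV d G" "form UNIV d H" "H v0 \<noteq> 0"
      "\<And>v. pt v \<in> M \<Longrightarrow> H v \<noteq> 0 \<Longrightarrow> g (pt v) = G v / H v" by blast
    have nvH: "?P \<in> nonvanishing H" using GH by (simp add: nonvanishing_pt[OF GH(2)])
    have evH: "\<forall>\<^sub>F Q in gen. Q \<in> nonvanishing H"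
      using finite_zeros[OF GH(2) v0(1) GH(3)] by (simp add: eventually_generic)
    have gG: "\<forall>\<^sub>F Q in gen. g Q = ratio G (\<lambda>v. a v ^ d) Q * ratio (\<lambda>v. a v ^ d) H Q"
      using evH eventually_chart
    proof eventually_elim
      case (elim Q)
      then obtain v where v: "Q = pt v" "pt v \<in> M" "a v \<noteq> 0" by blast
      then have "H v \<noteq> 0" using elim nonvanishing_pt[OF GH(2)] by auto
      then show ?case
        using GH(4)[OF v(2)] v by (simp add: ratio_pt[OF ae GH(2)] ratio_pt[OF GH(1) ae])
    qed
    show ?thesis
    proof (cases "\<exists>v1. pt v1 \<in> M \<and> a v1 \<noteq> 0 \<and> G v1 \<noteq> 0")
      case True
      then obtain v1 where v1: "pt v1 \<in> M" "a v1 \<noteq> 0" "G v1 \<noteq> 0" by blast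
      obtain N g' where N: "N \<noteq> 0" "\<And>P. P \<in> M \<Longrightarrow> P \<in> nonvanishing a \<Longrightarrow> g' \<in> regular_at \<M> P"
        "\<And>v. pt v \<in> M \<Longrightarrow> a v \<noteq> 0 \<Longrightarrow> G v / a v ^ d * g' (pt v) = poly N (c v / a v)"
        using chart_norm[OF GH(1) v1] by blast
      define k where "k = Polynomial.order (c v0 / a v0) N"
      from order_decomp[OF N(1), of "c v0 / a v0"] obtain N1 where N1:
        "N = [:- (c v0 / a v0), 1:] ^ k * N1" "\<not> [:- (c v0 / a v0), 1:] dvd N1"
        unfolding k_def by blast
      have r1: "(\<lambda>Q. poly N1 (ratio c a Q)) \<in> regular_at \<M> ?P"
        by (intro regular_at_poly regular_coord v0 nv)
      have r2: "poly N1 (ratio c a ?P) \<noteq> 0" using N1(2) by (simp add: ratio_coord poly_eq_0_iff_dvd)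
      have r3: "g' \<in> regular_at \<M> ?P" using N(2) v0 nv by blast
      have r4: "ratio G (\<lambda>v. a v ^ d) \<in> regular_at \<M> ?P"
        by (intro regular_at_ratio[OF v0(1) GH(1) ae nva])
      have r5: "\<forall>\<^sub>F Q in gen. ratio G (\<lambda>v. a v ^ d) Q * g' Q = ?t Q ^ k * poly N1 (ratio c a Q)"
        using eventually_chart
      proof eventually_elim
        case (elim Q)
        then obtain v where v: "Q = pt v" "pt v \<in> M" "a v \<noteq> 0" by blast
        then show ?case
          using N(3)[OF v(2,3)] by (simp add: ratio_coord ratio_pt[OF GH(1) ae] N1(1))
      qed
      from divisor_of_uniformizer_power[OF unif tn r1 r2 r3 r4 r5]
      obtain j w where w: "w \<in> regular_at \<M> ?P" "w ?P \<noteq> 0"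
        "\<forall>\<^sub>F Q in gen. ratio G (\<lambda>v. a v ^ d) Q = ?t Q ^ j * w Q" by blast
      have "(\<lambda>Q. w Q * ratio (\<lambda>v. a v ^ d) H Q) \<in> regular_at \<M> ?P"
        by (intro regular_at_mult w regular_at_ratio[OF v0(1) ae GH(2) nvH])
      moreover have "w ?P * ratio (\<lambda>v. a v ^ d) H ?P \<noteq> 0"
        using w v0 GH by (simp add: ratio_pt[OF ae GH(2)])
      moreover have "\<forall>\<^sub>F Q in gen. g Q = ?t Q ^ j * (w Q * ratio (\<lambda>v. a v ^ d) H Q)"
        using gG w(3) by eventually_elim simp
      ultimately show ?thesis by blast
    next
      case False
      have "\<forall>\<^sub>F Q in gen. g Q = 0"
        using gG eventually_chart
      proof eventually_elim
        case (elim Q)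
        then obtain v where v: "Q = pt v" "pt v \<in> M" "a v \<noteq> 0" by blast
        then show ?case using False elim by (auto simp: ratio_pt[OF GH(1) ae])
      qed
      then show ?thesis by blast
    qed
  qed
  then show ?thesis unfolding dvr_at_def using unif tn by blast
qed

sublocale smooth_zcurve M
proof
  fix P assume "P \<in> M"
  then obtain v where v: "P = pt v" "pt v \<in> M" using repr by blast
  interpret R: fermat_cubic M b c a by (rule rotate)
  interpret RR: fermat_cubic M c a b by (rule R.rotate)
  consider "a v \<noteq> 0" "b v \<noteq> 0" | "b v \<noteq> 0" "c v \<noteq> 0" | "c v \<noteq> 0" "a v \<noteq> 0"
    using two_nonzero[OF v(2)] by blast
  then show "\<exists>t. dvr_at P t"
    unfolding v(1) by cases (use dvr_at_chart R.dvr_at_chart RR.dvr_at_chart v(2) in blast)+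
qed

end

section \<open>The quotient of the Fermat cubic by a diagonal automorphism\<close>

lemma (in zcurve) dvr_at_unit:
  assumes t: "dvr_at P t" and u: "u \<in> regular_at \<M> P" "u P \<noteq> 0"
    and t': "t' \<in> regular_at \<M> P" "\<forall>\<^sub>F Q in gen. t' Q = t Q * u Q"
  shows "dvr_at P t'"
proof -
  have tr: "t \<in> regular_at \<M> P" "t P = 0" and tn: "\<forall>\<^sub>F Q in gen. t Q \<noteq> 0"
    using t by (auto simp: dvr_at_def uniformizer_iff)
  have un: "\<forall>\<^sub>F Q in gen. u Q \<noteq> 0" by (rule eventually_nonzero[OF u])
  have t'P: "t' P = 0"
    using regular_at_eq_at[OF t'(1) regular_at_mult[OF tr(1) u(1)] t'(2)] tr(2) by simp
  have iu: "(\<lambda>Q. inverse (u Q)) \<in> regular_at \<M> P" by (rule regular_at_inverse[OF u])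
  have t'n: "\<forall>\<^sub>F Q in gen. t' Q \<noteq> 0" using t'(2) tn un by eventually_elim auto
  have 1: "\<exists>h\<in>regular_at \<M> P. \<forall>\<^sub>F Q in gen. g Q = t' Q * h Q" if "g \<in> regular_at \<M> P" "g P = 0" for g
  proof -
    from t that obtain h where h: "h \<in> regular_at \<M> P" "\<forall>\<^sub>F Q in gen. g Q = t Q * h Q"
      by (auto simp: dvr_at_def uniformizer_iff)
    have "\<forall>\<^sub>F Q in gen. g Q = t' Q * (inverse (u Q) * h Q)"
      using h(2) t'(2) un by eventually_elim simp
    with regular_at_mult[OF iu h(1)] show ?thesis
      by (intro bexI[of _ "\<lambda>Q. inverse (u Q) * h Q"])
  qed
  have 2: "\<exists>n w. w \<in> regular_at \<M> P \<and> w P \<noteq> 0 \<and> (\<forall>\<^sub>F Q in gen. g Q = t' Q ^ n * w Q)"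
    if "w \<in> regular_at \<M> P" "w P \<noteq> 0" "\<forall>\<^sub>F Q in gen. g Q = t Q ^ n * w Q" for g w n
  proof -
    have "\<forall>\<^sub>F Q in gen. g Q = t' Q ^ n * (inverse (u Q) ^ n * w Q)"
      using that(3) t'(2) un by eventually_elim (simp add: power_mult_distrib field_simps)
    moreover have "(\<lambda>Q. inverse (u Q) ^ n * w Q) \<in> regular_at \<M> P"
      by (intro regular_at_mult regular_at_power iu that)
    moreover have "inverse (u P) ^ n * w P \<noteq> 0" using u that by simp
    ultimately show ?thesis by blast
  qed
  show ?thesis
    unfolding dvr_at_def uniformizer_iff
  proof (intro conjI ballI impI t'(1) t'P t'n)
    fix g assume g: "g \<in> regular_at \<M> P"
    show "\<exists>h\<in>regular_at \<M> P. \<forall>\<^sub>F Q in gen. g Q = t' Q * h Q" if "g P = 0" by (rule 1[OF g that])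
    from t g consider "\<forall>\<^sub>F Q in gen. g Q = 0"
      | n w where "w \<in> regular_at \<M> P" "w P \<noteq> 0" "\<forall>\<^sub>F Q in gen. g Q = t Q ^ n * w Q"
      unfolding dvr_at_def by blast
    then show "(\<forall>\<^sub>F Q in gen. g Q = 0) \<or>
        (\<exists>n u. u \<in> regular_at \<M> P \<and> u P \<noteq> 0 \<and> (\<forall>\<^sub>F Q in gen. g Q = t' Q ^ n * u Q))"
      by cases (simp, rule disjI2, rule 2)
  qed
qed

text \<open>The forms \<xi>, \<eta>, \<kappa>, \<tau> stand for a^3, b^3, c^3, abc, which are
  invariant because the eigenvalues \<open>\<omega>\<^sup>2\<close>, \<omega>, 1 of r have product
  1. The values of F are prescribed on the cone only, since identifying them involves the equation
  of the curve.\<close>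

locale cubic_cover = C: fermat_cubic C a b c
  for C :: "('k::alg_closed_field^3) set set" and a b c :: "'k^3 \<Rightarrow> 'k" +
  fixes E :: "('k^3) set set" and \<xi> \<eta> \<kappa> \<tau> :: "'k^3 \<Rightarrow> 'k" and \<omega> :: 'k and r :: "'k^3 \<Rightarrow> 'k^3"
    and F :: "3 \<Rightarrow> 'k^3 \<Rightarrow> 'k" and \<rho> \<pi> :: "('k^3) set \<Rightarrow> ('k^3) set"
  assumes omega: "\<omega>\<^sup>2 + \<omega> + 1 = 0"
    and r_linear: "\<And>i. form UNIV 1 (\<lambda>v. r v $ i)"
    and r_abc: "\<And>v. a (r v) = \<omega>\<^sup>2 * a v" "\<And>v. b (r v) = \<omega> * b v" "\<And>v. c (r v) = c v"
    and linear_E: "form UNIV 1 \<xi>" "form UNIV 1 \<eta>" "form UNIV 1 \<kappa>" "form UNIV 1 \<tau>"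
    and sum_E: "\<And>w. \<xi> w + \<eta> w + \<kappa> w = 0"
    and E_eq: "E = {pt w | w. w \<noteq> 0 \<and> \<xi> w * \<eta> w * \<kappa> w = \<tau> w ^ 3}"
    and E_inj: "\<And>w w'. \<xi> w = \<xi> w' \<Longrightarrow> \<eta> w = \<eta> w' \<Longrightarrow> \<tau> w = \<tau> w' \<Longrightarrow> w = w'"
    and F_form: "\<And>i. form UNIV 3 (F i)"
    and F_values: "\<And>v. a v ^ 3 + b v ^ 3 + c v ^ 3 = 0 \<Longrightarrow> \<xi> (\<chi> i. F i v) = a v ^ 3 \<and>
      \<eta> (\<chi> i. F i v) = b v ^ 3 \<and> \<tau> (\<chi> i. F i v) = a v * b v * c v"
    and rho: "\<And>P. \<rho> P = r ` P"
    and pi: "\<And>v. pt v \<in> C \<Longrightarrow> \<pi> (pt v) = pt (\<chi> i. F i v)"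
begin

abbreviation "cone v \<equiv> a v ^ 3 + b v ^ 3 + c v ^ 3 = 0"
abbreviation "\<Psi> v \<equiv> (\<chi> i. F i v)"
abbreviation "\<C> \<equiv> proj_var C"
abbreviation "\<E> \<equiv> proj_var E"

lemma omega3: "\<omega> ^ 3 = 1"
  using omega by Groebner_Basis.algebra

lemma omega_neq: "\<omega> \<noteq> 0" "\<omega> \<noteq> 1" "\<omega>\<^sup>2 \<noteq> 1" "\<omega>\<^sup>2 \<noteq> \<omega>"
proof -
  show 0: "\<omega> \<noteq> 0" using omega by auto
  show 1: "\<omega> \<noteq> 1" using omega C.three by (auto simp: one_add_one)
  show "\<omega>\<^sup>2 \<noteq> \<omega>" using 0 1 by (auto simp: power2_eq_square)
  show "\<omega>\<^sup>2 \<noteq> 1"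
  proof
    assume "\<omega>\<^sup>2 = 1"
    then have "\<omega> ^ 3 = \<omega>" by (simp add: power3_eq_cube power2_eq_square)
    then show False using omega3 1 by simp
  qed
qed

lemma cube_root_of_unity: "x ^ 3 = 1 \<Longrightarrow> x = 1 \<or> x = \<omega> \<or> x = \<omega>\<^sup>2"
proof -
  assume "x ^ 3 = 1"
  then have "(x - 1) * (x - \<omega>) * (x - \<omega>\<^sup>2) = 0" using omega by Groebner_Basis.algebra
  then show ?thesis by auto
qed

text \<open>Exchanging a and b replaces \<omega> by the other primitive cube root of unity. This
  supplies the second affine chart of \<open>E\<close>.\<close>

lemma swap: "cubic_cover C b a c E \<eta> \<xi> \<kappa> \<tau> (\<omega>\<^sup>2) r F \<rho> \<pi>"
proof -
  interpret S: fermat_cubic C b a c by (rule C.swap)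
  have "(\<omega>\<^sup>2)\<^sup>2 = \<omega>" using omega by Groebner_Basis.algebra
  moreover have "(\<omega>\<^sup>2)\<^sup>2 + \<omega>\<^sup>2 + 1 = 0" using omega by Groebner_Basis.algebra
  ultimately show ?thesis
    by unfold_locales
      (auto simp: r_linear r_abc linear_E sum_E E_eq F_form F_values rho pi mult.commute add.commute
        intro: E_inj, metis sum_E add.commute)
qed

lemma r_scale: "r (k *s v) = k *s r v"
  using form_scale[OF r_linear] by (simp add: vec_eq_iff)

lemma r_r_r: "r (r (r v)) = v"
proof (rule C.vec_eqI)
  have "\<omega>\<^sup>2 * (\<omega>\<^sup>2 * (\<omega>\<^sup>2 * a v)) = (\<omega> ^ 3) ^ 2 * a v" by (simp add: power2_eq_square power3_eq_cube)
  then show "a (r (r (r v))) = a v" by (simp add: r_abc omega3)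
  have "\<omega> * (\<omega> * (\<omega> * b v)) = \<omega> ^ 3 * b v" by (simp add: power3_eq_cube)
  then show "b (r (r (r v))) = b v" by (simp add: r_abc omega3)
qed (simp add: r_abc)

lemma r_eq_0_iff: "r v = 0 \<longleftrightarrow> v = 0"
  using r_r_r r_scale[of 0] by (metis vector_smult_lzero)

lemma cone_r: "cone (r v) \<longleftrightarrow> cone v"
proof -
  have "(\<omega>\<^sup>2 * a v) ^ 3 = a v ^ 3" "(\<omega> * b v) ^ 3 = b v ^ 3"
    using omega3 by Groebner_Basis.algebra+
  then show ?thesis by (simp only: r_abc)
qed

lemma rho_pt: "\<rho> (pt v) = pt (r v)"
  unfolding rho
proof (intro equalityI subsetI)
  fix w assume "w \<in> pt (r v)"
  then obtain k where "k \<noteq> 0" "w = r (k *s v)" by (auto simp: mem_pt r_scale)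
  moreover from this have "k *s v \<in> pt v" by (auto simp: mem_pt)
  ultimately show "w \<in> r ` pt v" by blast
next
  fix w assume "w \<in> r ` pt v"
  then obtain k where "k \<noteq> 0" "w = r (k *s v)" by (auto simp: mem_pt)
  then show "w \<in> pt (r v)" unfolding r_scale mem_pt by blast
qed

lemma rho_mem: "P \<in> C \<Longrightarrow> \<rho> P \<in> C"
  using C.repr[of P] by (auto simp: rho_pt C.mem_M r_eq_0_iff cone_r)

lemma rho3: "P \<in> C \<Longrightarrow> \<rho> (\<rho> (\<rho> P)) = P"
  using C.repr[of P] by (auto simp: rho_pt r_r_r)

text \<open>A fixed point is an eigenvector of r. As the eigenvalues are distinct, it would have
  only one nonzero coordinate, which the cubic excludes.\<close>

lemma rho_neq: "P \<in> C \<Longrightarrow> \<rho> P \<noteq> P"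
proof
  assume P: "P \<in> C" "\<rho> P = P"
  then obtain v where v: "P = pt v" "pt v \<in> C" using C.repr by blast
  with P obtain k where "r v = k *s v" by (auto simp: rho_pt pt_eq_iff)
  then have "\<omega>\<^sup>2 * a v = k * a v" "\<omega> * b v = k * b v" "c v = k * c v"
    by (metis C.scale r_abc)+
  then have "(a v = 0 \<or> k = \<omega>\<^sup>2) \<and> (b v = 0 \<or> k = \<omega>) \<and> (c v = 0 \<or> k = 1)" by auto
  then show False using C.two_nonzero[OF v(2)] omega_neq by metis
qed

lemma rho_funpow: "P \<in> C \<Longrightarrow> (\<rho> ^^ n) P = (if n mod 3 = 0 then P else if n mod 3 = 1 then \<rho> P else \<rho> (\<rho> P))"
proof (induction n)
  case (Suc n)
  have "n mod 3 = 0 \<or> n mod 3 = 1 \<or> n mod 3 = 2" by linarith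
  then show ?case using Suc rho3 by (auto simp: mod_Suc)
qed simp

lemma rho2_neq: "P \<in> C \<Longrightarrow> \<rho> (\<rho> P) \<noteq> P"
  using rho3 rho_neq by metis

lemma rho_funpow_eq_iff: "P \<in> C \<Longrightarrow> (\<rho> ^^ n) P = P \<longleftrightarrow> 3 dvd n"
  using rho_neq rho2_neq by (auto simp: rho_funpow dvd_eq_mod_eq_0)

lemma Psi_scale: "\<Psi> (k *s v) = k ^ 3 *s \<Psi> v"
  using form_scale[OF F_form] by (simp add: vec_eq_iff)

lemma Psi_0: "\<Psi> 0 = 0"
  using Psi_scale[of 0 0] by simp

lemma forms_E_0: "\<xi> 0 = 0" "\<eta> 0 = 0" "\<kappa> 0 = 0" "\<tau> 0 = 0"
  using form_scale[OF linear_E(1), of 0 0] form_scale[OF linear_E(2), of 0 0]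
    form_scale[OF linear_E(3), of 0 0] form_scale[OF linear_E(4), of 0 0] by simp_all

lemma F_value3: "cone v \<Longrightarrow> \<kappa> (\<Psi> v) = c v ^ 3"
proof -
  assume v: "cone v"
  have "\<xi> (\<Psi> v) + \<eta> (\<Psi> v) + \<kappa> (\<Psi> v) = 0" by (rule sum_E)
  then show ?thesis using F_values[OF v] v by (metis add_left_cancel)
qed

lemma Psi_eq_0_iff: "cone v \<Longrightarrow> \<Psi> v = 0 \<longleftrightarrow> v = 0"
proof
  assume "cone v" "\<Psi> v = 0"
  then have "a v ^ 3 = 0" "b v ^ 3 = 0" "c v ^ 3 = 0" using F_values[of v] F_value3[of v] forms_E_0 by auto
  then show "v = 0" by (simp add: C.eq_0_iff)
qed (use Psi_0 in simp)

sublocale E: proj_set E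
  by unfold_locales (auto simp: E_eq)

lemma mem_E: "pt w \<in> E \<longleftrightarrow> w \<noteq> 0 \<and> \<xi> w * \<eta> w * \<kappa> w = \<tau> w ^ 3"
proof
  assume "pt w \<in> E"
  then obtain w' k where "w' \<noteq> 0" "\<xi> w' * \<eta> w' * \<kappa> w' = \<tau> w' ^ 3" "k \<noteq> 0" "w = k *s w'"
    by (auto simp: E_eq pt_eq_iff)
  then show "w \<noteq> 0 \<and> \<xi> w * \<eta> w * \<kappa> w = \<tau> w ^ 3"
    by (simp add: form_scale[OF linear_E(1)] form_scale[OF linear_E(2)] form_scale[OF linear_E(3)]
        form_scale[OF linear_E(4)] power3_eq_cube mult.assoc)
qed (auto simp: E_eq)

lemma pi_mem: "P \<in> C \<Longrightarrow> \<pi> P \<in> E"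
proof -
  assume P: "P \<in> C"
  then obtain v where v: "P = pt v" using C.repr by blast
  then have "v \<noteq> 0" "cone v" using P C.mem_M by auto
  then have "\<xi> (\<Psi> v) * \<eta> (\<Psi> v) * \<kappa> (\<Psi> v) = \<tau> (\<Psi> v) ^ 3"
    using F_values[of v] F_value3[of v] by (simp add: power_mult_distrib)
  then show "\<pi> P \<in> E" using v P \<open>v \<noteq> 0\<close> \<open>cone v\<close> by (simp add: pi mem_E Psi_eq_0_iff)
qed

text \<open>Take cube roots x, y of \<xi> and \<eta>; then z = \<tau>/(xy) is a cube root of
  \<kappa>. If xy = 0, then \<tau> = 0 and any cube root of \<kappa> serves as z. The lift is exact
  on vectors, not only up to scaling.\<close>

lemma Psi_onto:
  assumes "pt w \<in> E"
  obtains v where "pt v \<in> C" "\<Psi> v = w"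
proof -
  from assms have w: "w \<noteq> 0" "\<xi> w * \<eta> w * \<kappa> w = \<tau> w ^ 3" by (auto simp: mem_E)
  obtain x where x: "x ^ 3 = \<xi> w" using nth_root_exists[of 3] by auto
  obtain y where y: "y ^ 3 = \<eta> w" using nth_root_exists[of 3] by auto
  have "\<exists>z. z ^ 3 = \<kappa> w \<and> x * y * z = \<tau> w"
  proof (cases "x * y = 0")
    case True
    moreover have "\<xi> w * \<eta> w = (x * y) ^ 3" by (simp add: x y power_mult_distrib)
    ultimately have "\<tau> w ^ 3 = 0" by (simp flip: w(2))
    then have "\<tau> w = 0" by simp
    moreover obtain z where "z ^ 3 = \<kappa> w" using nth_root_exists[of 3] by auto
    ultimately show ?thesis using True by auto
  next
    case False
    have "(\<tau> w / (x * y)) ^ 3 = \<xi> w * \<eta> w * \<kappa> w / (x ^ 3 * y ^ 3)"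
      unfolding w(2) by (simp add: power_divide power_mult_distrib)
    also have "\<dots> = \<kappa> w" using False x y by auto
    finally show ?thesis using False by (intro exI[of _ "\<tau> w / (x * y)"]) auto
  qed
  then obtain z where z: "z ^ 3 = \<kappa> w" "x * y * z = \<tau> w" by blast
  obtain v where v: "a v = x" "b v = y" "c v = z" using C.onto by blast
  have cone: "cone v" using v x y z sum_E by simp
  then have Pi: "\<Psi> v = w" using F_values[OF cone] v x y z by (intro E_inj) auto
  then have "v \<noteq> 0" using w(1) Psi_0 by auto
  with cone Pi show ?thesis using that C.mem_M by blast
qed

lemma pi_onto: "R \<in> E \<Longrightarrow> \<exists>P\<in>C. \<pi> P = R"
proof -
  assume R: "R \<in> E"
  then obtain w where w: "R = pt w" using E.repr by blast
  with R obtain v where "pt v \<in> C" "\<Psi> v = w" using Psi_onto by metis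
  then show ?thesis using w pi by auto
qed

lemma Psi_r: "cone v \<Longrightarrow> \<Psi> (r v) = \<Psi> v"
proof (rule E_inj)
  assume v: "cone v"
  have o: "(\<omega>\<^sup>2 * a v) ^ 3 = a v ^ 3" "\<omega>\<^sup>2 * a v * (\<omega> * b v) * c v = a v * b v * c v"
    using omega3 by Groebner_Basis.algebra+
  show "\<xi> (\<Psi> (r v)) = \<xi> (\<Psi> v)" "\<eta> (\<Psi> (r v)) = \<eta> (\<Psi> v)" "\<tau> (\<Psi> (r v)) = \<tau> (\<Psi> v)"
    using F_values[OF v] F_values[of "r v"] v o by (auto simp: cone_r r_abc power_mult_distrib omega3)
qed

lemma pi_rho: "P \<in> C \<Longrightarrow> \<pi> (\<rho> P) = \<pi> P"
proof -
  assume P: "P \<in> C"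
  then obtain v where v: "P = pt v" "pt v \<in> C" using C.repr by blast
  then have "pt (r v) \<in> C" using rho_mem rho_pt P by metis
  then show ?thesis using v Psi_r[of v] by (simp add: rho_pt pi C.mem_M)
qed

lemma cube_eq_imp:
  assumes "x ^ 3 = (y::'k) ^ 3"
  shows "\<exists>k. k ^ 3 = 1 \<and> x = k * y"
proof (cases "y = 0")
  case True
  then show ?thesis using assms by (intro exI[of _ 1]) auto
next
  case False
  then show ?thesis using assms by (intro exI[of _ "x / y"]) (auto simp: power_divide)
qed

text \<open>Equal cubes differ by cube roots of unity \<alpha>, \<beta>, \<gamma>, and equality of
  abc forces their product to be 1. Up to the common factor \<gamma> such a triple is determined by
  \<beta>/\<gamma>, which leaves the three powers of r.\<close>

lemma Psi_eq_imp:
  assumes v: "cone v" "cone v'" "\<Psi> v' = \<Psi> v"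
  shows "\<exists>k. k \<noteq> 0 \<and> (v' = k *s v \<or> v' = k *s r v \<or> v' = k *s r (r v))"
proof -
  have eqs: "a v' ^ 3 = a v ^ 3" "b v' ^ 3 = b v ^ 3" "c v' ^ 3 = c v ^ 3"
    "a v' * b v' * c v' = a v * b v * c v"
    using F_values[OF v(1)] F_values[OF v(2)] F_value3[OF v(1)] F_value3[OF v(2)] v(3) by auto
  obtain \<alpha> where \<alpha>: "\<alpha> ^ 3 = 1" "a v' = \<alpha> * a v" using cube_eq_imp[OF eqs(1)] by blast
  obtain \<beta> where \<beta>: "\<beta> ^ 3 = 1" "b v' = \<beta> * b v" using cube_eq_imp[OF eqs(2)] by blast
  obtain \<gamma> where \<gamma>: "\<gamma> ^ 3 = 1" "c v' = \<gamma> * c v" using cube_eq_imp[OF eqs(3)] by blast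
  have "\<exists>\<alpha> \<beta> \<gamma>. \<alpha> ^ 3 = 1 \<and> \<beta> ^ 3 = 1 \<and> \<gamma> ^ 3 = 1 \<and> \<alpha> * \<beta> * \<gamma> = 1 \<and>
      a v' = \<alpha> * a v \<and> b v' = \<beta> * b v \<and> c v' = \<gamma> * c v"
  proof (cases "a v = 0 \<or> b v = 0 \<or> c v = 0")
    \<comment> \<open>The root of unity belonging to a vanishing coordinate is arbitrary, so it can
      be chosen to make the product 1.\<close>
    case True
    have inv: "(x * y) * inverse (x * y) = 1 \<and> inverse (x * y) ^ 3 = 1" if "x ^ 3 = 1" "y ^ 3 = 1" for x y :: 'k
    proof -
      have "x * y \<noteq> 0" using that by auto
      then show ?thesis using that right_inverse[of "x * y"] by (simp add: power_inverse power_mult_distrib)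
    qed
    from True consider "a v = 0" | "b v = 0" | "c v = 0" by blast
    then show ?thesis
    proof cases
      case 1
      then show ?thesis using \<alpha> \<beta> \<gamma> inv[OF \<beta>(1) \<gamma>(1)]
        by (intro exI[of _ "inverse (\<beta> * \<gamma>)"] exI[of _ \<beta>] exI[of _ \<gamma>]) (simp add: ac_simps)
    next
      case 2
      then show ?thesis using \<alpha> \<beta> \<gamma> inv[OF \<alpha>(1) \<gamma>(1)]
        by (intro exI[of _ \<alpha>] exI[of _ "inverse (\<alpha> * \<gamma>)"] exI[of _ \<gamma>]) (simp add: ac_simps)
    next
      case 3
      then show ?thesis using \<alpha> \<beta> \<gamma> inv[OF \<alpha>(1) \<beta>(1)]
        by (intro exI[of _ \<alpha>] exI[of _ \<beta>] exI[of _ "inverse (\<alpha> * \<beta>)"]) (simp add: ac_simps)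
    qed
  next
    case False
    have "\<alpha> * \<beta> * \<gamma> * (a v * b v * c v) = a v * b v * c v"
      using eqs(4) \<alpha>(2) \<beta>(2) \<gamma>(2) by (simp add: ac_simps)
    then have "\<alpha> * \<beta> * \<gamma> = 1" using False by simp
    then show ?thesis using \<alpha> \<beta> \<gamma> by blast
  qed
  then obtain \<alpha> \<beta> \<gamma> where *: "\<alpha> ^ 3 = 1" "\<beta> ^ 3 = 1" "\<gamma> ^ 3 = 1" "\<alpha> * \<beta> * \<gamma> = 1"
    "a v' = \<alpha> * a v" "b v' = \<beta> * b v" "c v' = \<gamma> * c v" by blast
  have nz: "\<gamma> \<noteq> 0" using *(3) by auto
  have "(\<beta> / \<gamma>) ^ 3 = 1" using * by (simp add: power_divide)
  then consider "\<beta> / \<gamma> = 1" | "\<beta> / \<gamma> = \<omega>" | "\<beta> / \<gamma> = \<omega>\<^sup>2" using cube_root_of_unity by blast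
  then consider "\<beta> = \<gamma>" | "\<beta> = \<omega> * \<gamma>" | "\<beta> = \<omega>\<^sup>2 * \<gamma>" using nz by (auto simp: divide_simps)
  then show ?thesis
  proof cases
    case 1
    then have "\<alpha> * \<gamma> ^ 3 = \<alpha> * \<beta> * \<gamma> * \<gamma>" by (simp add: power3_eq_cube)
    then have "\<alpha> = \<gamma>" using *(3,4) by simp
    then have "v' = \<gamma> *s v" using * 1 by (intro C.vec_eqI) (auto simp: C.scale)
    then show ?thesis using nz by blast
  next
    case 2
    then have "\<alpha> * \<gamma> ^ 3 * \<omega> ^ 3 = \<alpha> * \<beta> * \<gamma> * \<gamma> * \<omega>\<^sup>2"
      by (simp add: power3_eq_cube power2_eq_square)
    then have "\<alpha> = \<gamma> * \<omega>\<^sup>2" using *(3,4) omega3 by simp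
    then have "v' = \<gamma> *s r v" using * 2 by (intro C.vec_eqI) (auto simp: C.scale r_abc)
    then show ?thesis using nz by blast
  next
    case 3
    then have "\<alpha> * \<gamma> ^ 3 * (\<omega> ^ 3 * \<omega> ^ 3) = \<alpha> * \<beta> * \<gamma> * \<gamma> * (\<omega>\<^sup>2 * \<omega>\<^sup>2)"
      by (simp add: power3_eq_cube power2_eq_square)
    then have "\<alpha> = \<gamma> * (\<omega>\<^sup>2 * \<omega>\<^sup>2)" using *(3,4) omega3 by simp
    then have "v' = \<gamma> *s r (r v)" using * 3 by (intro C.vec_eqI) (auto simp: C.scale r_abc power2_eq_square)
    then show ?thesis using nz by blast
  qed
qed

lemma pi_eq_iff:
  assumes "P \<in> C" "Q \<in> C"
  shows "\<pi> P = \<pi> Q \<longleftrightarrow> Q = P \<or> Q = \<rho> P \<or> Q = \<rho> (\<rho> P)"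
proof
  assume eq: "\<pi> P = \<pi> Q"
  obtain v where v: "P = pt v" "pt v \<in> C" using assms C.repr by blast
  obtain v' where v': "Q = pt v'" "pt v' \<in> C" using assms C.repr by blast
  have "pt (\<Psi> v') = pt (\<Psi> v)" using eq v v' pi by simp
  then obtain k where k: "k \<noteq> 0" "\<Psi> v' = k *s \<Psi> v" by (auto simp: pt_eq_iff)
  \<comment> \<open>Since \<Psi> has degree 3, a cube root of the scalar turns equality of points
    into equality of vectors.\<close>
  obtain m where m: "m ^ 3 = k" using nth_root_exists[of 3] by auto
  then have "m \<noteq> 0" using k by auto
  then have "pt (m *s v) \<in> C" "pt (m *s v) = P" using v by (auto simp: pt_scale)
  moreover have "\<Psi> v' = \<Psi> (m *s v)" using k m by (simp add: Psi_scale)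
  ultimately obtain l where "l \<noteq> 0"
    "v' = l *s (m *s v) \<or> v' = l *s r (m *s v) \<or> v' = l *s r (r (m *s v))"
    using Psi_eq_imp[of "m *s v" v'] v' by (auto simp: C.mem_M)
  then have "pt v' = pt (m *s v) \<or> pt v' = pt (r (m *s v)) \<or> pt v' = pt (r (r (m *s v)))"
    by (metis pt_scale)
  then show "Q = P \<or> Q = \<rho> P \<or> Q = \<rho> (\<rho> P)"
    using v' \<open>pt (m *s v) = P\<close> by (metis rho_pt)
next
  assume "Q = P \<or> Q = \<rho> P \<or> Q = \<rho> (\<rho> P)"
  then show "\<pi> P = \<pi> Q" using assms pi_rho rho_mem by metis
qed

lemma finite_fibre_pi: "finite {Q \<in> C. \<pi> Q = R}"
proof (cases "\<exists>P\<in>C. \<pi> P = R")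
  case True
  then obtain P where P: "P \<in> C" "\<pi> P = R" by blast
  have "{Q \<in> C. \<pi> Q = R} \<subseteq> {P, \<rho> P, \<rho> (\<rho> P)}" using pi_eq_iff[OF P(1)] P(2) by blast
  then show ?thesis by (rule finite_subset) simp
next
  case False
  then have "{Q \<in> C. \<pi> Q = R} = {}" by blast
  then show ?thesis by (simp only: finite.emptyI)
qed

subsection \<open>Trace and descent of regular functions\<close>

text \<open>Forms as sums of monomials in the eigenvectors: r multiplies each monomial by a power of
  \<omega>, so traces can be computed termwise.\<close>

inductive mspan :: "nat \<Rightarrow> ('k^3 \<Rightarrow> 'k) \<Rightarrow> bool" where
  mono: "i + j + k = d \<Longrightarrow> mspan d (\<lambda>v. x * (a v ^ i * b v ^ j * c v ^ k))"
| add: "mspan d p \<Longrightarrow> mspan d q \<Longrightarrow> mspan d (\<lambda>v. p v + q v)"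

lemma mspan_mono_mult:
  assumes "i + j + k = e"
  shows "mspan d p \<Longrightarrow> mspan (d + e) (\<lambda>v. p v * (x * (a v ^ i * b v ^ j * c v ^ k)))"
proof (induction rule: mspan.induct)
  case (mono i' j' k' d y)
  then have "(i' + i) + (j' + j) + (k' + k) = d + e" using assms by simp
  from mspan.mono[OF this, of "y * x"] show ?case by (simp add: power_add ac_simps)
next
  case (add d p q)
  then show ?case using mspan.add by (simp add: distrib_right)
qed

lemma mspan_mult:
  assumes "mspan d p"
  shows "mspan e q \<Longrightarrow> mspan (d + e) (\<lambda>v. p v * q v)"
proof (induction rule: mspan.induct)
  case (mono i j k e x)
  then show ?case using mspan_mono_mult assms by blast
next
  case (add d p q)
  then show ?case using mspan.add by (simp add: distrib_left)
qed

lemma form_mspan: "form UNIV d G \<Longrightarrow> mspan d G"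
proof (induction rule: form.induct)
  case (form_const x)
  then show ?case using mspan.mono[of 0 0 0 0 x] by simp
next
  case (form_coord i)
  from C.span[of i] obtain \<alpha> \<beta> \<gamma> where *: "\<And>v. v $ i = \<alpha> * a v + \<beta> * b v + \<gamma> * c v" by blast
  have "mspan 1 (\<lambda>v. \<alpha> * (a v ^ 1 * b v ^ 0 * c v ^ 0) + \<beta> * (a v ^ 0 * b v ^ 1 * c v ^ 0)
      + \<gamma> * (a v ^ 0 * b v ^ 0 * c v ^ 1))"
    by (intro mspan.intros) auto
  then show ?case by (simp add: *)
next
  case (form_mult d p e q)
  then show ?case by (simp add: mspan_mult)
qed (rule mspan.add)

definition trace :: "('k^3 \<Rightarrow> 'k) \<Rightarrow> 'k^3 \<Rightarrow> 'k" where
  "trace G v = G v + G (r v) + G (r (r v))"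

text \<open>The trace of a monomial vanishes unless its weight 2i + j is divisible by 3. In that
  case, as the degree is divisible by 3 too, i, j, k are congruent modulo 3, and the monomial is a
  product of cubes and a power of abc.\<close>

lemma trace_descends:
  assumes "form UNIV (3 * m) G"
  shows "\<exists>q. form UNIV m q \<and> (\<forall>v. cone v \<longrightarrow> trace G v = q (\<Psi> v))"
proof -
  have "mspan d G \<Longrightarrow> d = 3 * m \<Longrightarrow> ?thesis" for d
  proof (induction rule: mspan.induct)
    case (mono i j k d x)
    define \<zeta> where "\<zeta> = \<omega> ^ (2 * i + j)"
    have r1: "a (r v) ^ i * b (r v) ^ j * c (r v) ^ k = \<zeta> * (a v ^ i * b v ^ j * c v ^ k)" for v
      by (simp add: r_abc \<zeta>_def power_mult_distrib power_add power_mult)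
    have tr: "trace (\<lambda>v. x * (a v ^ i * b v ^ j * c v ^ k)) v
        = (1 + \<zeta> + \<zeta>\<^sup>2) * (x * (a v ^ i * b v ^ j * c v ^ k))" for v
      unfolding trace_def r1 by (simp add: power2_eq_square algebra_simps)
    show ?case
    proof (cases "3 dvd (2 * i + j)")
      case True
      then obtain l where l: "2 * i + j = 3 * l" by blast
      then have \<zeta>: "\<zeta> = 1" by (simp add: \<zeta>_def power_mult omega3)
      define n where "n = i mod 3"
      have "j + 3 * i = i + 3 * l" "k + 3 * l = i + 3 * m" using l mono.hyps mono.prems by simp_all
      then have "j mod 3 = n" "k mod 3 = n" unfolding n_def by (metis mod_mult_self2)+
      define i' j' k' where "i' = i div 3" and "j' = j div 3" and "k' = k div 3"
      have ijk: "i = 3 * i' + n" "j = 3 * j' + n" "k = 3 * k' + n"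
        using mult_div_mod_eq[of 3 i] mult_div_mod_eq[of 3 j] mult_div_mod_eq[of 3 k]
        unfolding i'_def j'_def k'_def \<open>j mod 3 = n\<close> \<open>k mod 3 = n\<close> n_def[symmetric] by simp_all
      then have m: "m = i' + j' + k' + n" using mono by simp
      show ?thesis
      proof (intro exI conjI allI impI)
        show "form UNIV m (\<lambda>w. 3 * x * (\<xi> w ^ i' * \<eta> w ^ j' * \<kappa> w ^ k' * \<tau> w ^ n))"
          unfolding m using form_power[OF linear_E(1), of i'] form_power[OF linear_E(2), of j']
            form_power[OF linear_E(3), of k'] form_power[OF linear_E(4), of n]
          by (intro form_cmult form_mult) auto
        fix v assume v: "cone v"
        show "trace (\<lambda>v. x * (a v ^ i * b v ^ j * c v ^ k)) v
          = 3 * x * (\<xi> (\<Psi> v) ^ i' * \<eta> (\<Psi> v) ^ j' * \<kappa> (\<Psi> v) ^ k' * \<tau> (\<Psi> v) ^ n)"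
        proof -
          have "a v ^ i = (a v ^ 3) ^ i' * a v ^ n" "b v ^ j = (b v ^ 3) ^ j' * b v ^ n"
            "c v ^ k = (c v ^ 3) ^ k' * c v ^ n" by (simp_all add: ijk power_add power_mult)
          then show ?thesis
            unfolding tr \<zeta> using F_values[OF v] F_value3[OF v] by (simp add: power_mult_distrib)
        qed
      qed
    next
      case False
      then have "(2 * i + j) mod 3 = 1 \<or> (2 * i + j) mod 3 = 2" by presburger
      moreover have "\<zeta> = \<omega> ^ ((2 * i + j) mod 3)"
        unfolding \<zeta>_def by (metis mult_div_mod_eq omega3 power_add power_mult power_one mult_1)
      ultimately have "\<zeta> = \<omega> \<or> \<zeta> = \<omega>\<^sup>2" by auto
      moreover have "1 + \<omega> + \<omega>\<^sup>2 = 0" "1 + \<omega>\<^sup>2 + (\<omega>\<^sup>2)\<^sup>2 = 0" using omega by Groebner_Basis.algebra+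
      ultimately have "1 + \<zeta> + \<zeta>\<^sup>2 = 0" by blast
      then show ?thesis using form_zero by (intro exI[of _ "\<lambda>_. 0"]) (auto simp: tr)
    qed
  next
    case (add d p q)
    then obtain q1 q2 where "form UNIV m q1" "\<forall>v. cone v \<longrightarrow> trace p v = q1 (\<Psi> v)"
      "form UNIV m q2" "\<forall>v. cone v \<longrightarrow> trace q v = q2 (\<Psi> v)" by blast
    moreover have "trace (\<lambda>v. p v + q v) v = trace p v + trace q v" for v by (simp add: trace_def)
    ultimately show ?case
      by (intro exI[of _ "\<lambda>w. q1 w + q2 w"]) (auto intro: form_add)
  qed
  then show ?thesis using form_mspan[OF assms] by blast
qed

text \<open>
  A fraction \<open>G / H\<close> representing an invariant function near \<open>P\<close> is made invariant by multiplying
  numerator and denominator with a form that vanishes at the conjugates of \<open>P\<close> but not at \<open>P\<close>,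
  and then taking traces; the denominator keeps its value at \<open>P\<close>.
\<close>

lemma regular_descends:
  assumes P: "P \<in> C" and f: "f \<circ> \<pi> \<in> regular_at \<C> P"
  shows "f \<in> regular_at \<E> (\<pi> P)"
proof -
  obtain v0 where v0: "v0 \<noteq> 0" "P = pt v0" using P C.repr by blast
  have memr: "pt (r v) \<in> C" if "pt v \<in> C" for v using rho_mem[OF that] by (simp add: rho_pt)
  have pir: "\<pi> (pt (r v)) = \<pi> (pt v)" if "pt v \<in> C" for v using pi_rho[OF that] by (simp add: rho_pt)
  from C.regular_atE[OF f v0(2)] obtain d G H where GH: "form UNIV d G" "form UNIV d H" "H v0 \<noteq> 0"
    "\<And>v. pt v \<in> C \<Longrightarrow> H v \<noteq> 0 \<Longrightarrow> (f \<circ> \<pi>) (pt v) = G v / H v" by blast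
  have S: "pt (r v0) \<noteq> P" "pt (r (r v0)) \<noteq> P" "pt (r v0) \<noteq> pt (r (r v0))"
    using rho_neq[OF P] rho2_neq[OF P] rho_neq[OF rho_mem[OF P]] v0 by (auto simp: rho_pt)
  have "\<exists>l. form UNIV (card {pt (r v0), pt (r (r v0))}) l \<and> l v0 \<noteq> 0 \<and>
      (\<forall>w. pt w \<in> {pt (r v0), pt (r (r v0))} \<longrightarrow> l w = 0)"
    by (rule avoiding_form) (use v0 S r_eq_0_iff in auto)
  moreover have "card {pt (r v0), pt (r (r v0))} = 2" using S(3) by simp
  ultimately obtain l where l: "form UNIV 2 l" "l v0 \<noteq> 0"
    "\<And>w. pt w \<in> {pt (r v0), pt (r (r v0))} \<Longrightarrow> l w = 0" by metis
  from v0 obtain i where i: "v0 $ i \<noteq> 0" by (auto simp: vec_eq_iff)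
  \<comment> \<open>The factor \<open>H\<close> makes f H K = G K valid also where G / H does not
    represent f. The power d + 1 of a coordinate nonzero at v0 brings the degree of G K and H K to 3
    (d + 1), as traces require.\<close>
  define K where "K v = H v * l v * (v $ i) ^ (d + 1)" for v
  have Kf: "form UNIV (d + 2 + (d + 1)) K"
    unfolding K_def using form_power[OF form_coord, of UNIV "d + 1" i]
    by (intro form_mult GH l) auto
  have deg: "d + (d + 2 + (d + 1)) = 3 * (d + 1)" by simp
  have G': "form UNIV (3 * (d + 1)) (\<lambda>v. G v * K v)" unfolding deg[symmetric] by (intro form_mult GH Kf)
  have H': "form UNIV (3 * (d + 1)) (\<lambda>v. H v * K v)" unfolding deg[symmetric] by (intro form_mult GH Kf)
  obtain q where q: "form UNIV (d + 1) q" "\<And>v. cone v \<Longrightarrow> trace (\<lambda>v. G v * K v) v = q (\<Psi> v)"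
    using trace_descends[OF G'] by blast
  obtain q' where q': "form UNIV (d + 1) q'" "\<And>v. cone v \<Longrightarrow> trace (\<lambda>v. H v * K v) v = q' (\<Psi> v)"
    using trace_descends[OF H'] by blast
  have mult: "f (\<pi> (pt v)) * (H v * K v) = G v * K v" if "pt v \<in> C" for v
    using GH(4)[OF that] by (cases "H v = 0") (auto simp: K_def)
  have tr: "f (\<pi> (pt v)) * trace (\<lambda>v. H v * K v) v = trace (\<lambda>v. G v * K v) v" if "pt v \<in> C" for v
    unfolding trace_def distrib_left
    using mult[OF that] mult[OF memr[OF that]] mult[OF memr[OF memr[OF that]]]
    by (simp only: pir that memr)
  have "K (r v0) = 0" "K (r (r v0)) = 0" using l(3) by (auto simp: K_def)
  moreover have "K v0 \<noteq> 0" using GH l i by (simp add: K_def)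
  ultimately have "trace (\<lambda>v. H v * K v) v0 \<noteq> 0" using GH(3) by (simp add: trace_def)
  then have nz: "q' (\<Psi> v0) \<noteq> 0" using q'(2)[of v0] P v0 by (simp add: C.mem_M)
  have "\<pi> P = pt (\<Psi> v0)" using pi P v0 by blast
  moreover have "f \<in> regular_at \<E> (pt (\<Psi> v0))"
  proof (rule E.regular_atI)
    show "pt (\<Psi> v0) \<in> E" using pi_mem[OF P] calculation by simp
    fix w assume w: "pt w \<in> E" "q' w \<noteq> 0"
    obtain v where v: "pt v \<in> C" "\<Psi> v = w" using Psi_onto[OF w(1)] .
    then have "f (pt w) * q' w = q w"
      using tr[OF v(1)] q(2)[of v] q'(2)[of v] pi[OF v(1)] by (auto simp: C.mem_M)
    then show "f (pt w) = q w / q' w" using w by (simp add: field_simps)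
  qed (use q q' nz in auto)
  ultimately show ?thesis by simp
qed

lemma pi_morphism: "fs_morphism \<C> \<E> \<pi>"
  and regular_pullback: "P \<in> C \<Longrightarrow> g \<in> regular_at \<E> (\<pi> P) \<Longrightarrow> g \<circ> \<pi> \<in> regular_at \<C> P"
  using fs_morphism_by_forms[OF C.proj_set_axioms E.proj_set_axioms pi_mem F_form pi] by blast+

lemma regular_rho1:
  assumes "P \<in> C" "g \<in> regular_at \<C> (\<rho> P)"
  shows "(\<lambda>Q. g (\<rho> Q)) \<in> regular_at \<C> P"
proof -
  have "g \<circ> \<rho> \<in> regular_at \<C> P"
    using assms by (rule fs_morphism_by_forms(2)[where F = "\<lambda>i v. r v $ i" and m = 1, OF
          C.proj_set_axioms C.proj_set_axioms rho_mem r_linear, rotated 2]) (simp_all add: rho_pt)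
  then show ?thesis by (simp add: comp_def)
qed

lemma regular_rho2:
  assumes "P \<in> C" "g \<in> regular_at \<C> (\<rho> (\<rho> P))"
  shows "(\<lambda>Q. g (\<rho> (\<rho> Q))) \<in> regular_at \<C> P"
  using regular_rho1[OF assms(1) regular_rho1[OF rho_mem[OF assms(1)] assms(2)]] .

text \<open>One direction rests on surjectivity, the other on finite fibres.\<close>

lemma eventually_pi: "(\<forall>\<^sub>F Q in C.gen. A (\<pi> Q)) \<longleftrightarrow> (\<forall>\<^sub>F R in generic E. A R)"
  unfolding eventually_generic
proof
  assume "finite {Q \<in> C. \<not> A (\<pi> Q)}"
  moreover have "{R \<in> E. \<not> A R} \<subseteq> \<pi> ` {Q \<in> C. \<not> A (\<pi> Q)}" using pi_onto by blast
  ultimately show "finite {R \<in> E. \<not> A R}" using finite_surj by blast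
next
  assume "finite {R \<in> E. \<not> A R}"
  then have "finite (\<Union>R\<in>{R \<in> E. \<not> A R}. {Q \<in> C. \<pi> Q = R})" using finite_fibre_pi by blast
  moreover have "{Q \<in> C. \<not> A (\<pi> Q)} \<subseteq> (\<Union>R\<in>{R \<in> E. \<not> A R}. {Q \<in> C. \<pi> Q = R})"
    using pi_mem by auto
  ultimately show "finite {Q \<in> C. \<not> A (\<pi> Q)}" by (rule rev_finite_subset)
qed

lemma eventually_rho: "(\<forall>\<^sub>F Q in C.gen. A Q) \<Longrightarrow> (\<forall>\<^sub>F Q in C.gen. A (\<rho> Q))"
  unfolding eventually_generic
proof -
  assume fin: "finite {Q \<in> C. \<not> A Q}"
  have "{Q \<in> C. \<not> A (\<rho> Q)} \<subseteq> (\<lambda>Q. \<rho> (\<rho> Q)) ` {Q \<in> C. \<not> A Q}"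
  proof
    fix Q assume "Q \<in> {Q \<in> C. \<not> A (\<rho> Q)}"
    then show "Q \<in> (\<lambda>Q. \<rho> (\<rho> Q)) ` {Q \<in> C. \<not> A Q}"
      using rho3[of Q] rho_mem[of Q] by (intro image_eqI[of _ _ "\<rho> Q"]) auto
  qed
  then show "finite {Q \<in> C. \<not> A (\<rho> Q)}" using fin finite_surj by blast
qed

lemma opens_E_iff:
  assumes W: "W \<subseteq> E"
  shows "W \<in> opens \<E> \<longleftrightarrow> preim \<C> \<pi> W \<in> opens \<C>"
proof
  assume "W \<in> opens \<E>"
  then show "preim \<C> \<pi> W \<in> opens \<C>" using pi_morphism by (auto simp: fs_morphism_def)
next
  assume op: "preim \<C> \<pi> W \<in> opens \<C>"
  show "W \<in> opens \<E>"
  proof (cases "W = {}")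
    case True
    then show ?thesis by (simp add: E.mem_opens)
  next
    case False
    then have "preim \<C> \<pi> W \<noteq> {}" using pi_onto W by (fastforce simp: preim_def)
    then have "finite (C - preim \<C> \<pi> W)" using C.finite_compl op by blast
    moreover have "E - W \<subseteq> \<pi> ` (C - preim \<C> \<pi> W)"
    proof
      fix R assume R: "R \<in> E - W"
      then obtain P where "P \<in> C" "\<pi> P = R" using pi_onto by blast
      with R show "R \<in> \<pi> ` (C - preim \<C> \<pi> W)" by (intro image_eqI[of _ _ P]) (auto simp: preim_def)
    qed
    ultimately show ?thesis using E.cofinite_opens[OF W] finite_surj by blast
  qed
qed

sublocale E: zcurve E
proof
  show "infinite E"
  proof
    assume "finite E"
    then have "\<forall>\<^sub>F R in generic E. False" by (simp add: eventually_generic)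
    then have "\<forall>\<^sub>F Q in C.gen. False" using eventually_pi[of "\<lambda>_. False"] by blast
    then show False by simp
  qed
  fix W assume W: "W \<in> opens \<E>" "W \<noteq> {}"
  then have "W \<subseteq> E" by (simp add: E.opens_subset)
  then have op: "preim \<C> \<pi> W \<in> opens \<C>" "preim \<C> \<pi> W \<noteq> {}"
    using W opens_E_iff pi_onto by (auto simp: preim_def)
  then have "finite (C - preim \<C> \<pi> W)" by (rule C.finite_compl)
  then have "\<forall>\<^sub>F Q in C.gen. \<pi> Q \<in> W"
    unfolding eventually_generic by (rule rev_finite_subset) (auto simp: preim_def)
  then have "\<forall>\<^sub>F R in generic E. R \<in> W" by (simp flip: eventually_pi)
  then show "finite (E - W)" unfolding eventually_generic by (simp add: set_diff_eq)
qed

text \<open>For quotients such as g / t^n, which are regular at P only after cancellation: the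
  default value of the division at \<pi> P is overwritten by the correct one.\<close>

lemma descend:
  assumes P: "P \<in> C" and h: "h \<in> regular_at \<C> P" and f: "\<forall>\<^sub>F Q in C.gen. f (\<pi> Q) = h Q"
  shows "f(\<pi> P := h P) \<in> regular_at \<E> (\<pi> P)"
proof (rule regular_descends[OF P])
  have "\<forall>\<^sub>F Q in C.gen. \<pi> Q \<noteq> \<pi> P" using finite_fibre_pi by (simp add: eventually_generic)
  then have "\<forall>\<^sub>F Q in C.gen. h Q = (f(\<pi> P := h P) \<circ> \<pi>) Q" using f by eventually_elim auto
  then show "f(\<pi> P := h P) \<circ> \<pi> \<in> regular_at \<C> P" by (rule C.regular_at_cong[OF h]) simp
qed

section \<open>Local parameters of the quotient curve and etaleness\<close>

lemma upd_generic: "\<forall>\<^sub>F R in E.gen. (f(y := k)) R = f R"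
proof -
  have "{R \<in> E. (f(y := k)) R \<noteq> f R} \<subseteq> {y}" by auto
  then show ?thesis unfolding eventually_generic using finite_subset by blast
qed

text \<open>Where c is nonzero, the pullback of c^3/a^3 - t0^3 is (t - t0) times a factor with value
  3 t0^2, hence a parameter. Where c = 0 the cube would have order 3; there abc/a^3 = (c/a)(b/a) is
  a parameter, because b/a is a unit.\<close>

lemma pullback_param_chart:
  assumes ferm: "fermat_cubic C a1 b1 c1" and v: "pt v0 \<in> C" "a1 v0 \<noteq> 0" "b1 v0 \<noteq> 0"
    and lin: "form UNIV 1 X1" "form UNIV 1 Z1"
    and X1: "\<And>v. cone v \<Longrightarrow> X1 (\<Psi> v) = a1 v ^ 3" "\<And>v. cone v \<Longrightarrow> Z1 (\<Psi> v) = c1 v ^ 3"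
      "\<And>v. cone v \<Longrightarrow> \<tau> (\<Psi> v) = a1 v * b1 v * c1 v"
  shows "\<exists>t. t \<in> regular_at \<E> (\<pi> (pt v0)) \<and> C.dvr_at (pt v0) (t \<circ> \<pi>)"
proof -
  interpret A: fermat_cubic C a1 b1 c1 by fact
  have cone: "cone v" if "pt v \<in> C" for v using that C.mem_M by blast
  have mem: "pt (\<Psi> v) \<in> E" if "pt v \<in> C" for v using pi_mem[OF that] pi[OF that] by simp
  have nvX: "pt (\<Psi> v0) \<in> nonvanishing X1"
    using v X1(1)[OF cone[OF v(1)]] by (simp add: nonvanishing_pt[OF lin(1)])
  have nva: "pt v0 \<in> nonvanishing a1" using v by (simp add: nonvanishing_pt[OF A.linear(1)])
  define t0 where "t0 = c1 v0 / a1 v0"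
  have dvr: "C.dvr_at (pt v0) (\<lambda>Q. ratio c1 a1 Q - t0)" unfolding t0_def by (rule A.dvr_at_chart[OF v])
  show ?thesis
  proof (cases "c1 v0 = 0")
    case True
    let ?t = "ratio \<tau> X1"
    have reg: "?t \<in> regular_at \<E> (\<pi> (pt v0))"
      unfolding pi[OF v(1)] by (rule E.regular_at_ratio[OF mem[OF v(1)] linear_E(4) lin(1) nvX])
    have "C.dvr_at (pt v0) (?t \<circ> \<pi>)"
    proof (rule C.dvr_at_unit[OF dvr])
      show "ratio b1 a1 \<in> regular_at \<C> (pt v0)" by (rule A.regular_coord[OF v(1) nva])
      show "ratio b1 a1 (pt v0) \<noteq> 0" using v by (simp add: A.ratio_coord)
      show "?t \<circ> \<pi> \<in> regular_at \<C> (pt v0)" by (rule regular_pullback[OF v(1) reg])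
      show "\<forall>\<^sub>F Q in C.gen. (?t \<circ> \<pi>) Q = (ratio c1 a1 Q - t0) * ratio b1 a1 Q"
        using A.eventually_chart
      proof eventually_elim
        case (elim Q)
        then obtain v where v: "Q = pt v" "pt v \<in> C" "a1 v \<noteq> 0" by blast
        show ?case
          using v True X1[OF cone[OF v(2)]]
          by (simp add: pi ratio_pt[OF linear_E(4) lin(1)] A.ratio_coord t0_def power3_eq_cube)
      qed
    qed
    with reg show ?thesis by blast
  next
    case False
    let ?t = "\<lambda>R. ratio Z1 X1 R - t0 ^ 3"
    let ?u = "\<lambda>Q. ratio c1 a1 Q ^ 2 + t0 * ratio c1 a1 Q + t0 ^ 2"
    have reg: "?t \<in> regular_at \<E> (\<pi> (pt v0))"
      unfolding pi[OF v(1)]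
      by (intro E.regular_at_diff E.regular_at_const mem v E.regular_at_ratio[OF mem[OF v(1)] lin(2,1) nvX])
    have "C.dvr_at (pt v0) (?t \<circ> \<pi>)"
    proof (rule C.dvr_at_unit[OF dvr])
      show "?u \<in> regular_at \<C> (pt v0)"
        by (intro C.regular_at_add C.regular_at_power C.regular_at_cmult A.regular_coord
            C.regular_at_const v nva)
      have "?u (pt v0) = 3 * t0\<^sup>2" by (simp add: A.ratio_coord t0_def[symmetric] power2_eq_square)
      then show "?u (pt v0) \<noteq> 0" using False v C.three by (simp add: t0_def)
      show "?t \<circ> \<pi> \<in> regular_at \<C> (pt v0)" by (rule regular_pullback[OF v(1) reg])
      show "\<forall>\<^sub>F Q in C.gen. (?t \<circ> \<pi>) Q = (ratio c1 a1 Q - t0) * ?u Q"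
        using A.eventually_chart
      proof eventually_elim
        case (elim Q)
        then obtain v where v: "Q = pt v" "pt v \<in> C" "a1 v \<noteq> 0" by blast
        define s where "s = c1 v / a1 v"
        have "(?t \<circ> \<pi>) Q = s ^ 3 - t0 ^ 3"
          using v X1[OF cone[OF v(2)]] by (simp add: pi ratio_pt[OF lin(2,1)] power_divide s_def)
        moreover have "ratio c1 a1 Q = s" by (simp add: v A.ratio_coord s_def)
        ultimately show ?case by (simp only:) (simp add: power2_eq_square power3_eq_cube algebra_simps)
      qed
    qed
    with reg show ?thesis by blast
  qed
qed

lemma pullback_param:
  assumes "P \<in> C"
  shows "\<exists>t. t \<in> regular_at \<E> (\<pi> P) \<and> C.dvr_at P (t \<circ> \<pi>)"
proof -
  obtain v where v: "P = pt v" "pt v \<in> C" using assms C.repr by blast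
  interpret R: fermat_cubic C b c a by (rule C.rotate)
  consider "a v \<noteq> 0" "b v \<noteq> 0" | "b v \<noteq> 0" "c v \<noteq> 0" | "c v \<noteq> 0" "a v \<noteq> 0"
    using C.two_nonzero[OF v(2)] by blast
  then show ?thesis unfolding v(1)
  proof cases
    case 1
    then show "\<exists>t. t \<in> regular_at \<E> (\<pi> (pt v)) \<and> C.dvr_at (pt v) (t \<circ> \<pi>)"
      by (intro pullback_param_chart[of a b c v \<xi> \<kappa>])
        (auto simp: v linear_E F_values F_value3 intro: C.fermat_cubic_axioms)
  next
    case 2
    then show "\<exists>t. t \<in> regular_at \<E> (\<pi> (pt v)) \<and> C.dvr_at (pt v) (t \<circ> \<pi>)"
      by (intro pullback_param_chart[of b c a v \<eta> \<xi>])
        (auto simp: v linear_E F_values F_value3 intro: C.rotate)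
  next
    case 3
    then show "\<exists>t. t \<in> regular_at \<E> (\<pi> (pt v)) \<and> C.dvr_at (pt v) (t \<circ> \<pi>)"
      by (intro pullback_param_chart[of c a b v \<kappa> \<eta>])
        (auto simp: v linear_E F_values F_value3 intro: R.rotate)
  qed
qed

text \<open>Factor the pullback of a germ by powers of t upstairs. The cofactor is generically the
  pullback of a quotient on \<open>E\<close>, so it descends to a regular germ with the same
  value.\<close>

lemma dvr_descends:
  assumes P: "P \<in> C" and t: "t \<in> regular_at \<E> (\<pi> P)" "C.dvr_at P (t \<circ> \<pi>)"
  shows "E.dvr_at (\<pi> P) t"
proof -
  let ?y = "\<pi> P"
  have ty: "t ?y = 0" using t(2) by (simp add: C.dvr_at_def C.uniformizer_iff)
  have tC: "\<forall>\<^sub>F Q in C.gen. t (\<pi> Q) \<noteq> 0" using t(2) by (simp add: C.dvr_at_def)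
  then have tE: "\<forall>\<^sub>F R in E.gen. t R \<noteq> 0" by (simp flip: eventually_pi)
  have quot: "\<exists>h'\<in>regular_at \<E> ?y. h' ?y = h P \<and> (\<forall>\<^sub>F R in E.gen. g R = t R ^ n * h' R)"
    if h: "h \<in> regular_at \<C> P" "\<forall>\<^sub>F Q in C.gen. g (\<pi> Q) = t (\<pi> Q) ^ n * h Q" for g h n
  proof -
    define f where "f R = g R / t R ^ n" for R
    have "\<forall>\<^sub>F Q in C.gen. f (\<pi> Q) = h Q" using h(2) tC by eventually_elim (simp add: f_def)
    then have "f(?y := h P) \<in> regular_at \<E> ?y" by (rule descend[OF P h(1)])
    moreover have "\<forall>\<^sub>F R in E.gen. g R = t R ^ n * (f(?y := h P)) R"
      using upd_generic[of f ?y "h P"] tE by eventually_elim (simp only:, simp add: f_def)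
    ultimately show ?thesis by (intro bexI[of _ "f(?y := h P)"]) auto
  qed
  show ?thesis
    unfolding E.dvr_at_def E.uniformizer_iff
  proof (intro conjI ballI impI t(1) ty tE)
    fix g assume g: "g \<in> regular_at \<E> ?y" "g ?y = 0"
    have "g \<circ> \<pi> \<in> regular_at \<C> P" "(g \<circ> \<pi>) P = 0" using regular_pullback[OF P g(1)] g(2) by auto
    then obtain h where h: "h \<in> regular_at \<C> P" "\<forall>\<^sub>F Q in C.gen. (g \<circ> \<pi>) Q = (t \<circ> \<pi>) Q * h Q"
      using t(2) unfolding C.dvr_at_def C.uniformizer_iff by blast
    then have "\<forall>\<^sub>F Q in C.gen. g (\<pi> Q) = t (\<pi> Q) ^ 1 * h Q" by simp
    from quot[OF h(1) this] show "\<exists>h\<in>regular_at \<E> ?y. \<forall>\<^sub>F R in E.gen. g R = t R * h R" by auto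
  next
    fix g assume g: "g \<in> regular_at \<E> ?y"
    have "g \<circ> \<pi> \<in> regular_at \<C> P" using regular_pullback[OF P g] .
    then consider "\<forall>\<^sub>F Q in C.gen. (g \<circ> \<pi>) Q = 0"
      | n u where "u \<in> regular_at \<C> P" "u P \<noteq> 0" "\<forall>\<^sub>F Q in C.gen. (g \<circ> \<pi>) Q = (t \<circ> \<pi>) Q ^ n * u Q"
      using t(2) unfolding C.dvr_at_def by blast
    then show "(\<forall>\<^sub>F R in E.gen. g R = 0) \<or>
        (\<exists>n u. u \<in> regular_at \<E> ?y \<and> u ?y \<noteq> 0 \<and> (\<forall>\<^sub>F R in E.gen. g R = t R ^ n * u R))"
    proof cases
      case 1
      then show ?thesis using eventually_pi[of "\<lambda>R. g R = 0"] by simp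
    next
      case (2 n u)
      then have "\<forall>\<^sub>F Q in C.gen. g (\<pi> Q) = t (\<pi> Q) ^ n * u Q" by simp
      from quot[OF 2(1) this] obtain h' where "h' \<in> regular_at \<E> ?y" "h' ?y = u P"
        "\<forall>\<^sub>F R in E.gen. g R = t R ^ n * h' R" by blast
      then show ?thesis using 2(2) by (intro disjI2 exI[of _ n] exI[of _ h']) simp
    qed
  qed
qed

sublocale E: smooth_zcurve E
proof
  fix R assume "R \<in> E"
  then obtain P where P: "P \<in> C" "\<pi> P = R" using pi_onto by blast
  then show "\<exists>t. E.dvr_at R t" using pullback_param[OF P(1)] dvr_descends[OF P(1)] by blast
qed

text \<open>One uniformizer with this property is known, and any other differs from it by a unit,
  which pulls back to a unit.\<close>

lemma uniformizer_pullback: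
  assumes P: "P \<in> C" and t: "uniformizer \<E> (\<pi> P) t"
  shows "uniformizer \<C> P (t \<circ> \<pi>)"
proof -
  obtain t0 where t0: "t0 \<in> regular_at \<E> (\<pi> P)" "C.dvr_at P (t0 \<circ> \<pi>)" using pullback_param[OF P] by blast
  then have "uniformizer \<E> (\<pi> P) t0" using dvr_descends[OF P] by (simp add: E.dvr_at_def)
  then obtain u where u: "u \<in> regular_at \<E> (\<pi> P)" "u (\<pi> P) \<noteq> 0" "\<forall>\<^sub>F R in E.gen. t R = t0 R * u R"
    using E.uniformizer_unit t by blast
  have "C.dvr_at P (t \<circ> \<pi>)"
  proof (rule C.dvr_at_unit[OF t0(2)])
    show "u \<circ> \<pi> \<in> regular_at \<C> P" by (rule regular_pullback[OF P u(1)])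
    show "t \<circ> \<pi> \<in> regular_at \<C> P" using t by (intro regular_pullback[OF P]) (simp add: E.uniformizer_iff)
    show "\<forall>\<^sub>F Q in C.gen. (t \<circ> \<pi>) Q = (t0 \<circ> \<pi>) Q * (u \<circ> \<pi>) Q"
      using u(3) eventually_pi[of "\<lambda>R. t R = t0 R * u R"] by simp
  qed (use u in auto)
  then show ?thesis by (simp add: C.dvr_at_def)
qed

theorem etale_pi: "etale \<C> \<E> \<pi>"
  unfolding etale_def
proof (intro conjI ballI pi_morphism)
  fix P assume "P \<in> pts \<C>"
  then have P: "P \<in> C" by simp
  show "flat_at \<C> \<E> \<pi> P"
    by (rule flat_at_smooth_zcurve[where f = \<pi>, OF C.zcurve_axioms E.smooth_zcurve_axioms P pi_mem[OF P]])
      (simp_all add: eventually_pi regular_pullback[OF P])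
  obtain t where t: "uniformizer \<E> (\<pi> P) t" using E.ex_dvr pi_mem[OF P] by (auto simp: E.dvr_at_def)
  show "unramified_at \<C> \<E> \<pi> P"
    unfolding unramified_at_def
  proof (intro ballI impI)
    fix g assume "g \<in> regular_at \<C> P" "g P = 0"
    then obtain h where h: "h \<in> regular_at \<C> P" "near \<C> P (\<lambda>Q. g Q = (t \<circ> \<pi>) Q * h Q)"
      using uniformizer_pullback[OF P t] by (auto simp: uniformizer_def)
    show "\<exists>n::nat. \<exists>a h. (\<forall>i<n. a i \<in> regular_at \<E> (\<pi> P) \<and> a i (\<pi> P) = 0 \<and> h i \<in> regular_at \<C> P) \<and>
        near \<C> P (\<lambda>Q. g Q = (\<Sum>i<n. a i (\<pi> Q) * h i Q))"
      by (rule exI[of _ 1], rule exI[of _ "\<lambda>_. t"], rule exI[of _ "\<lambda>_. h"])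
        (use h t in \<open>auto simp: uniformizer_def One_nat_def\<close>)
  qed
qed

section \<open>Descent of invariant functions and the orbit space\<close>

lemma invariant_factors:
  assumes S: "S \<subseteq> C" "\<And>P. P \<in> S \<Longrightarrow> \<rho> P \<in> S" and inv: "\<And>P. P \<in> S \<Longrightarrow> h (\<rho> P) = h P"
  obtains f where "\<And>P. P \<in> S \<Longrightarrow> h P = f (\<pi> P)"
proof
  fix P assume P: "P \<in> S"
  define Q where "Q = (SOME Q. Q \<in> C \<and> \<pi> Q = \<pi> P)"
  have PC: "P \<in> C" using P S(1) by blast
  have Q: "Q \<in> C" "\<pi> Q = \<pi> P"
    unfolding Q_def using someI[of "\<lambda>Q. Q \<in> C \<and> \<pi> Q = \<pi> P" P] PC by auto
  then have "Q = P \<or> Q = \<rho> P \<or> Q = \<rho> (\<rho> P)" using pi_eq_iff[OF PC Q(1)] by simp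
  then show "h P = h (SOME Q. Q \<in> C \<and> \<pi> Q = \<pi> P)"
    unfolding Q_def[symmetric] using inv[OF P] inv[OF S(2)[OF P]] by auto
qed

lemma invariant_descends:
  assumes W: "W \<in> opens \<E>" and h: "h \<in> regular \<C> (preim \<C> \<pi> W)"
    and inv: "\<And>P. P \<in> preim \<C> \<pi> W \<Longrightarrow> h (\<rho> P) = h P"
  shows "\<exists>f\<in>regular \<E> W. \<forall>P\<in>preim \<C> \<pi> W. h P = f (\<pi> P)"
proof -
  have op: "preim \<C> \<pi> W \<in> opens \<C>" using pi_morphism W by (auto simp: fs_morphism_def)
  have "preim \<C> \<pi> W \<subseteq> C" "\<And>P. P \<in> preim \<C> \<pi> W \<Longrightarrow> \<rho> P \<in> preim \<C> \<pi> W"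
    using rho_mem pi_rho by (auto simp: preim_def)
  from invariant_factors[where h = h, OF this inv] obtain f
    where f: "\<And>P. P \<in> preim \<C> \<pi> W \<Longrightarrow> h P = f (\<pi> P)" by blast
  have "f \<in> regular \<E> W"
    unfolding E.regular_iff[OF W]
  proof
    fix R assume R: "R \<in> W"
    then obtain P where P: "P \<in> C" "\<pi> P = R" using pi_onto E.opens_subset[OF W] by blast
    then have PW: "P \<in> preim \<C> \<pi> W" using R by (simp add: preim_def)
    have "\<forall>\<^sub>F Q in C.gen. Q \<in> preim \<C> \<pi> W"
      using C.finite_compl[OF op] PW unfolding eventually_generic by (auto simp: set_diff_eq)
    then have ev: "\<forall>\<^sub>F Q in C.gen. h Q = (f \<circ> \<pi>) Q" by eventually_elim (simp add: f)
    have "h \<in> regular_at \<C> P" using h PW unfolding C.regular_iff[OF op] by blast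
    then have "f \<circ> \<pi> \<in> regular_at \<C> P"
      by (rule C.regular_at_cong[OF _ ev]) (simp add: f[OF PW])
    then show "f \<in> regular_at \<E> R" using regular_descends[OF P(1)] P(2) by simp
  qed
  with f show ?thesis by blast
qed

theorem quotient_pi: "quotient_morphism \<C> \<E> {\<rho> ^^ n | n. True} \<pi>"
  unfolding quotient_morphism_def
proof (intro conjI ballI allI impI pi_morphism)
  show "\<pi> ` pts \<C> = pts \<E>" using pi_mem pi_onto by force
next
  fix P Q assume "P \<in> pts \<C>" "Q \<in> pts \<C>"
  then have P: "P \<in> C" and Q: "Q \<in> C" by auto
  have "(\<exists>g\<in>{\<rho> ^^ n | n. True}. Q = g P) \<longleftrightarrow> Q = P \<or> Q = \<rho> P \<or> Q = \<rho> (\<rho> P)"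
  proof
    assume "\<exists>g\<in>{\<rho> ^^ n | n. True}. Q = g P"
    then show "Q = P \<or> Q = \<rho> P \<or> Q = \<rho> (\<rho> P)" using rho_funpow[OF P] by (auto split: if_splits)
  next
    assume "Q = P \<or> Q = \<rho> P \<or> Q = \<rho> (\<rho> P)"
    moreover have "\<exists>g\<in>{\<rho> ^^ n | n. True}. (\<rho> ^^ n) P = g P" for n by blast
    from this[of 0] this[of 1] this[of 2] have "\<exists>g\<in>{\<rho> ^^ n | n. True}. P = g P"
      "\<exists>g\<in>{\<rho> ^^ n | n. True}. \<rho> P = g P" "\<exists>g\<in>{\<rho> ^^ n | n. True}. \<rho> (\<rho> P) = g P"
      using rho_funpow[OF P] by simp_all
    ultimately show "\<exists>g\<in>{\<rho> ^^ n | n. True}. Q = g P" by blast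
  qed
  then show "\<pi> P = \<pi> Q \<longleftrightarrow> (\<exists>g\<in>{\<rho> ^^ n | n. True}. Q = g P)" using pi_eq_iff[OF P Q] by simp
next
  fix W assume "W \<subseteq> pts \<E>"
  then show "W \<in> opens \<E> \<longleftrightarrow> preim \<C> \<pi> W \<in> opens \<C>" using opens_E_iff by simp
next
  fix W h assume W: "W \<in> opens \<E>" and h: "h \<in> regular \<C> (preim \<C> \<pi> W)"
    and inv: "\<forall>g\<in>{\<rho> ^^ n | n. True}. \<forall>P\<in>preim \<C> \<pi> W. h (g P) = h P"
  have "\<forall>P\<in>preim \<C> \<pi> W. h ((\<rho> ^^ 1) P) = h P" using inv by blast
  then have "h (\<rho> P) = h P" if "P \<in> preim \<C> \<pi> W" for P using that by (simp add: One_nat_def)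
  then show "\<exists>f\<in>regular \<E> W. \<forall>P\<in>preim \<C> \<pi> W. h P = f (\<pi> P)"
    using invariant_descends[OF W h] by blast
qed

end

text \<open>An order is witnessed by some uniformizer; since uniformizers differ by units, it can be
  read with any prescribed one.\<close>

lemma (in smooth_zcurve) has_orderD:
  assumes "has_order \<M> P f n" "uniformizer \<M> P t"
  obtains u where "u \<in> regular_at \<M> P" "u P \<noteq> 0" "\<forall>\<^sub>F Q in gen. f Q = t Q powi n * u Q"
proof -
  from assms(1) obtain s w where s: "uniformizer \<M> P s" and w: "w \<in> regular_at \<M> P" "w P \<noteq> 0"
    and f: "near \<M> P (\<lambda>Q. Q \<noteq> P \<longrightarrow> f Q = s Q powi n * w Q)" unfolding has_order_def by blast
  obtain v where v: "v \<in> regular_at \<M> P" "v P \<noteq> 0" "\<forall>\<^sub>F Q in gen. s Q = t Q * v Q"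
    using uniformizer_unit[OF assms(2) s] by blast
  have "\<forall>\<^sub>F Q in gen. Q \<noteq> P" by (simp add: eventually_generic)
  moreover have "\<forall>\<^sub>F Q in gen. Q \<noteq> P \<longrightarrow> f Q = s Q powi n * w Q" using f by (simp add: near_iff)
  ultimately have "\<forall>\<^sub>F Q in gen. f Q = t Q powi n * (v Q powi n * w Q)"
    using v(3) by eventually_elim (simp add: power_int_mult_distrib)
  moreover have "(\<lambda>Q. v Q powi n * w Q) \<in> regular_at \<M> P"
    by (intro regular_at_mult regular_at_powi v w)
  moreover have "v P powi n * w P \<noteq> 0" using v w by simp
  ultimately show ?thesis using that by blast
qed

lemma (in zcurve) has_orderI:
  assumes t: "uniformizer \<M> P t" and "u \<in> regular_at \<M> P" "u P \<noteq> 0" "\<forall>\<^sub>F Q in gen. f Q = t Q powi n * u Q"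
  shows "has_order \<M> P f n"
proof -
  have "\<forall>\<^sub>F Q in gen. Q \<noteq> P \<longrightarrow> f Q = t Q powi n * u Q" using assms(4) by eventually_elim simp
  moreover have "P \<in> M" using assms(2) by (rule regular_at_mem)
  ultimately have "near \<M> P (\<lambda>Q. Q \<noteq> P \<longrightarrow> f Q = t Q powi n * u Q)" by (simp add: near_iff)
  with assms show ?thesis unfolding has_order_def by blast
qed

section \<open>Eigenfunctions, finiteness and degree\<close>

context cubic_cover
begin

lemma rational_descends:
  assumes k: "k \<in> rational \<C>" and inv: "\<And>Q. Q \<in> C \<Longrightarrow> k (\<rho> Q) = k Q"
  shows "\<exists>f\<in>rational \<E>. \<forall>Q\<in>C. k Q = f (\<pi> Q)"
proof -
  obtain f where f: "\<And>P. P \<in> C \<Longrightarrow> k P = f (\<pi> P)"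
    using invariant_factors[of C k] inv rho_mem by auto
  from k obtain P where P: "k \<in> regular_at \<C> P" unfolding C.rational_iff by blast
  then have PC: "P \<in> C" by (rule C.regular_at_mem)
  have "{Q \<in> C. k Q \<noteq> (f \<circ> \<pi>) Q} = {}" using f by auto
  then have "\<forall>\<^sub>F Q in C.gen. k Q = (f \<circ> \<pi>) Q" unfolding eventually_generic by (simp only: finite.emptyI)
  with P have "f \<circ> \<pi> \<in> regular_at \<C> P" by (rule C.regular_at_cong) (simp add: f[OF PC])
  then have "f \<in> rational \<E>" unfolding E.rational_iff using regular_descends[OF PC] by blast
  with f show ?thesis by blast
qed

text \<open>For \<zeta>^3 = 1, the projection of g to the \<zeta>-eigenspace of \<rho>: the average
  of \<zeta>^(-j) times g after j rotations.\<close>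

definition eig :: "'k \<Rightarrow> (('k^3) set \<Rightarrow> 'k) \<Rightarrow> ('k^3) set \<Rightarrow> 'k" where
  "eig \<zeta> g Q = inverse 3 * (g Q + (\<zeta>\<^sup>2 * g (\<rho> Q) + \<zeta> * g (\<rho> (\<rho> Q))))"

lemma eig_rho:
  assumes "\<zeta> ^ 3 = 1" "Q \<in> C"
  shows "eig \<zeta> g (\<rho> Q) = \<zeta> * eig \<zeta> g Q"
proof -
  have "\<zeta> * (g Q + (\<zeta>\<^sup>2 * g (\<rho> Q) + \<zeta> * g (\<rho> (\<rho> Q)))) =
      \<zeta> ^ 3 * g (\<rho> Q) + (\<zeta>\<^sup>2 * g (\<rho> (\<rho> Q)) + \<zeta> * g Q)"
    by (simp add: power2_eq_square power3_eq_cube algebra_simps)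
  then show ?thesis unfolding eig_def assms(1) rho3[OF assms(2)] by (simp add: mult.left_commute)
qed

lemma eig_sum: "eig 1 g Q + eig \<omega> g Q + eig (\<omega>\<^sup>2) g Q = g Q"
proof -
  have "(\<omega>\<^sup>2)\<^sup>2 = \<omega>" "\<omega>\<^sup>2 = - 1 - \<omega>" using omega by Groebner_Basis.algebra+
  then have "g Q + (1\<^sup>2 * g (\<rho> Q) + 1 * g (\<rho> (\<rho> Q))) + (g Q + (\<omega>\<^sup>2 * g (\<rho> Q) + \<omega> * g (\<rho> (\<rho> Q))))
     + (g Q + ((\<omega>\<^sup>2)\<^sup>2 * g (\<rho> Q) + \<omega>\<^sup>2 * g (\<rho> (\<rho> Q)))) = 3 * g Q"
    by (simp only:) (simp add: algebra_simps)
  then show ?thesis unfolding eig_def distrib_left[symmetric] using C.three by simp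
qed

lemma eig_regular:
  assumes "P \<in> C" "g \<in> regular_at \<C> P" "g \<in> regular_at \<C> (\<rho> P)" "g \<in> regular_at \<C> (\<rho> (\<rho> P))"
  shows "eig \<zeta> g \<in> regular_at \<C> P"
  unfolding eig_def using assms
  by (intro C.regular_at_cmult C.regular_at_add regular_rho1 regular_rho2)

lemma ratio_rho:
  assumes "Q \<in> C"
  shows "ratio b a (\<rho> Q) = \<omega>\<^sup>2 * ratio b a Q" "ratio c a (\<rho> Q) = \<omega> * ratio c a Q"
proof -
  from assms obtain v where v: "Q = pt v" using C.repr by blast
  have i: "\<omega> / \<omega>\<^sup>2 = \<omega>\<^sup>2" "1 / \<omega>\<^sup>2 = \<omega>"
    using omega_neq(1) omega3 by (simp_all add: divide_simps power2_eq_square power3_eq_cube mult.assoc)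
  have "ratio b a (\<rho> Q) = \<omega> / \<omega>\<^sup>2 * (b v / a v)" "ratio c a (\<rho> Q) = 1 / \<omega>\<^sup>2 * (c v / a v)"
    unfolding v rho_pt C.ratio_coord r_abc by simp_all
  then show "ratio b a (\<rho> Q) = \<omega>\<^sup>2 * ratio b a Q" "ratio c a (\<rho> Q) = \<omega> * ratio c a Q"
    unfolding i v C.ratio_coord by simp_all
qed

lemma preim_chart: "preim \<C> \<pi> (E \<inter> nonvanishing \<xi>) = C \<inter> nonvanishing a"
proof (intro equalityI subsetI)
  fix P assume P: "P \<in> preim \<C> \<pi> (E \<inter> nonvanishing \<xi>)"
  then obtain v where v: "P = pt v" "pt v \<in> C" using C.repr by (auto simp: preim_def)
  then show "P \<in> C \<inter> nonvanishing a"
    using P F_values[of v] by (auto simp: preim_def pi nonvanishing_pt[OF linear_E(1)]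
        nonvanishing_pt[OF C.linear(1)] C.mem_M)
next
  fix P assume P: "P \<in> C \<inter> nonvanishing a"
  then obtain v where v: "P = pt v" "pt v \<in> C" using C.repr by blast
  then show "P \<in> preim \<C> \<pi> (E \<inter> nonvanishing \<xi>)"
    using P pi_mem[of P] F_values[of v] by (auto simp: preim_def pi nonvanishing_pt[OF linear_E(1)]
        nonvanishing_pt[OF C.linear(1)] C.mem_M)
qed

text \<open>
  On the chart \<open>s\<^sup>3 + t\<^sup>3 = - 1\<close> the eigenfunctions of \<open>\<rho>\<close> are generated over the invariant functions by
  \<open>1\<close>, by \<open>t\<close> and \<open>s\<^sup>2\<close>, and by \<open>s\<close> and \<open>t\<^sup>2\<close>: multiply an eigenfunction with \<open>- s\<^sup>3 - t\<^sup>3\<close>.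
\<close>

lemma finite_on_chart:
  defines "W \<equiv> E \<inter> nonvanishing \<xi>"
  shows "\<exists>B. finite B \<and> B \<subseteq> regular \<C> (preim \<C> \<pi> W) \<and>
    (\<forall>g\<in>regular \<C> (preim \<C> \<pi> W). \<exists>f. (\<forall>h\<in>B. f h \<in> regular \<E> W) \<and>
       (\<forall>P\<in>preim \<C> \<pi> W. g P = (\<Sum>h\<in>B. f h (\<pi> P) * h P)))"
proof -
  define s where "s = ratio b a"
  define t where "t = ratio c a"
  define h :: "nat \<Rightarrow> ('k^3) set \<Rightarrow> 'k" where
    "h i = (if i = 0 then (\<lambda>_. 1) else if i = 1 then (\<lambda>Q. s Q ^ 2) else if i = 2 then t
      else if i = 3 then s else (\<lambda>Q. t Q ^ 2))" for i
  have W: "W \<in> opens \<E>" unfolding W_def by (rule E.opens_basic[OF linear_E(1)])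
  have pre: "preim \<C> \<pi> W = C \<inter> nonvanishing a" unfolding W_def by (rule preim_chart)
  have op: "C \<inter> nonvanishing a \<in> opens \<C>" by (rule C.opens_basic[OF C.linear(1)])
  have st: "s \<in> regular_at \<C> P" "t \<in> regular_at \<C> P" if "P \<in> C \<inter> nonvanishing a" for P
    using C.regular_coord that by (auto simp: s_def t_def)
  have stab: "\<rho> P \<in> C \<inter> nonvanishing a" if "P \<in> C \<inter> nonvanishing a" for P
    using that rho_mem pi_rho unfolding pre[symmetric] by (auto simp: preim_def)
  have h_reg: "h i \<in> regular_at \<C> P" if "P \<in> C \<inter> nonvanishing a" for i P
    using st[OF that] that by (auto simp: h_def intro: C.regular_at_power)
  have eq: "s P ^ 3 + t P ^ 3 = - 1" if P: "P \<in> C \<inter> nonvanishing a" for P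
  proof -
    obtain v where v: "P = pt v" "pt v \<in> C" using P C.repr by blast
    then have "a v \<noteq> 0" using P nonvanishing_pt[OF C.linear(1)] by auto
    then show ?thesis using C.chart_point[OF v(2)] by (simp add: v s_def t_def C.ratio_coord)
  qed
  have o: "\<omega> * \<omega>\<^sup>2 = 1" "(\<omega>\<^sup>2)\<^sup>2 = \<omega>" "(\<omega>\<^sup>2) ^ 3 = 1" using omega by Groebner_Basis.algebra+
  have rho_s: "s (\<rho> P) = \<omega>\<^sup>2 * s P" and rho_t: "t (\<rho> P) = \<omega> * t P" if "P \<in> C" for P
    using ratio_rho[OF that] by (simp_all add: s_def t_def)
  have main: "\<exists>f. (\<forall>i<5. f i \<in> regular \<E> W) \<and> (\<forall>P\<in>preim \<C> \<pi> W. g P = (\<Sum>i<5. f i (\<pi> P) * h i P))"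
    if g: "g \<in> regular \<C> (preim \<C> \<pi> W)" for g
  proof -
    \<comment> \<open>Both s and t may vanish on this chart, so an eigenfunction cannot be divided
      by either. The factor - s^3 - t^3 = 1 splits it into two terms, each an invariant coefficient
      times a generator.\<close>
    define k :: "nat \<Rightarrow> ('k^3) set \<Rightarrow> 'k" where
      "k i = (if i = 0 then eig 1 g else if i = 1 then (\<lambda>Q. - (eig \<omega> g Q * s Q))
        else if i = 2 then (\<lambda>Q. - (eig \<omega> g Q * t Q ^ 2))
        else if i = 3 then (\<lambda>Q. - (eig (\<omega>\<^sup>2) g Q * s Q ^ 2))
        else (\<lambda>Q. - (eig (\<omega>\<^sup>2) g Q * t Q)))" for i
    have g_reg: "g \<in> regular_at \<C> P" if "P \<in> C \<inter> nonvanishing a" for P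
      using g that unfolding pre C.regular_iff[OF op] by blast
    have e_reg: "eig \<zeta> g \<in> regular_at \<C> P" if "P \<in> C \<inter> nonvanishing a" for P \<zeta>
      using that stab[OF that] stab[OF stab[OF that]] by (intro eig_regular g_reg) auto
    have neg: "(\<lambda>Q. - f Q) \<in> regular_at \<C> P" if "f \<in> regular_at \<C> P" for f P
      using C.regular_at_cmult[OF that, of "- 1"] by simp
    have "k i \<in> regular_at \<C> P" if "P \<in> C \<inter> nonvanishing a" for i P
      unfolding k_def using e_reg[OF that] st[OF that]
      by (auto intro!: neg C.regular_at_mult C.regular_at_power)
    then have k_reg: "k i \<in> regular \<C> (preim \<C> \<pi> W)" for i
      unfolding pre C.regular_iff[OF op] by blast
    have inv: "k i (\<rho> P) = k i P" if P: "P \<in> preim \<C> \<pi> W" for i P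
    proof -
      have PC: "P \<in> C" using P by (simp add: preim_def)
      have e: "eig 1 g (\<rho> P) = eig 1 g P" using eig_rho[of 1 P g] PC by simp
      have ids: "\<omega> * x * (\<omega>\<^sup>2 * y) = x * y" "\<omega> * x * (\<omega> * y) ^ 2 = x * y ^ 2"
        "\<omega>\<^sup>2 * x * (\<omega>\<^sup>2 * y) ^ 2 = x * y ^ 2" "\<omega>\<^sup>2 * x * (\<omega> * y) = x * y" for x y
        using o by Groebner_Basis.algebra+
      show ?thesis
        unfolding k_def if_distribR
        by (simp only: e eig_rho[OF omega3 PC] eig_rho[OF o(3) PC] rho_s[OF PC] rho_t[OF PC] ids)
    qed
    have "\<exists>f\<in>regular \<E> W. \<forall>P\<in>preim \<C> \<pi> W. k i P = f (\<pi> P)" for i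
      by (rule invariant_descends[OF W k_reg inv])
    then obtain f where f: "\<And>i. f i \<in> regular \<E> W" "\<And>i P. P \<in> preim \<C> \<pi> W \<Longrightarrow> k i P = f i (\<pi> P)"
      by metis
    have "g P = (\<Sum>i<5. f i (\<pi> P) * h i P)" if P: "P \<in> preim \<C> \<pi> W" for P
    proof -
      have "(\<Sum>i<5. f i (\<pi> P) * h i P) = (\<Sum>i<5. k i P * h i P)" using f(2)[OF P] by simp
      also have "\<dots> = k 0 P * h 0 P + k 1 P * h 1 P + k 2 P * h 2 P + k 3 P * h 3 P + k 4 P * h 4 P"
        by (simp add: eval_nat_numeral One_nat_def)
      also have "\<dots> = eig 1 g P + eig \<omega> g P * (- (s P ^ 3 + t P ^ 3)) + eig (\<omega>\<^sup>2) g P * (- (s P ^ 3 + t P ^ 3))"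
        by (simp add: k_def h_def power2_eq_square power3_eq_cube algebra_simps)
      also have "\<dots> = g P" using eq[of P] P eig_sum[of g P] unfolding pre by simp
      finally show ?thesis by simp
    qed
    with f show ?thesis by blast
  qed
  show ?thesis
  proof (intro exI[of _ "h ` {..<5}"] conjI ballI)
    show "h ` {..<5} \<subseteq> regular \<C> (preim \<C> \<pi> W)"
      unfolding pre using h_reg by (auto simp: C.regular_iff[OF op])
    fix g assume "g \<in> regular \<C> (preim \<C> \<pi> W)"
    from main[OF this] obtain f where f: "\<And>i. i < 5 \<Longrightarrow> f i \<in> regular \<E> W"
      "\<And>P. P \<in> preim \<C> \<pi> W \<Longrightarrow> g P = (\<Sum>i<5. f i (\<pi> P) * h i P)" by blast
    \<comment> \<open>In \<open>finite_morphism\<close> the generators form a set of functions, so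
      coefficients belonging to equal generators are added up.\<close>
    define f' where "f' x R = (\<Sum>i\<in>{i\<in>{..<5}. h i = x}. f i R)" for x R
    show "\<exists>f. (\<forall>x\<in>h ` {..<5}. f x \<in> regular \<E> W) \<and>
       (\<forall>P\<in>preim \<C> \<pi> W. g P = (\<Sum>x\<in>h ` {..<5}. f x (\<pi> P) * x P))"
    proof (intro exI[of _ f'] conjI ballI)
      fix x show "f' x \<in> regular \<E> W"
        unfolding E.regular_iff[OF W] f'_def
      proof
        fix R assume R: "R \<in> W"
        then have "R \<in> E" by (simp add: W_def)
        then show "(\<lambda>R. \<Sum>i\<in>{i\<in>{..<5}. h i = x}. f i R) \<in> regular_at \<E> R"
          using f(1) R unfolding E.regular_iff[OF W] by (intro E.regular_at_sum) auto
      qed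
    next
      fix P assume P: "P \<in> preim \<C> \<pi> W"
      have "g P = (\<Sum>i\<in>{..<5}. f i (\<pi> P) * h i P)" by (rule f(2)[OF P])
      also have "\<dots> = (\<Sum>x\<in>h ` {..<5}. \<Sum>i\<in>{i\<in>{..<5}. h i = x}. f i (\<pi> P) * h i P)"
        by (rule sum.image_gen) simp
      also have "\<dots> = (\<Sum>x\<in>h ` {..<5}. f' x (\<pi> P) * x P)"
        unfolding f'_def sum_distrib_right by (intro sum.cong) auto
      finally show "g P = (\<Sum>x\<in>h ` {..<5}. f' x (\<pi> P) * x P)" .
    qed
  qed simp
qed

lemma affine_charts:
  "affine_fspace (open_sub \<E> (E \<inter> nonvanishing \<xi>))"
  "affine_fspace (open_sub \<C> (C \<inter> nonvanishing a))"
proof -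
  have p3: "form UNIV 3 (\<lambda>v. l v ^ 3)" if "form UNIV 1 l" for l :: "'k^3 \<Rightarrow> 'k"
    using form_power[OF that, of 3] by simp
  have "form UNIV (1 + 1 + 1) (\<lambda>w. \<xi> w * \<eta> w * \<kappa> w)" by (intro form_mult linear_E)
  then have "form UNIV 3 (\<lambda>w. \<xi> w * \<eta> w * \<kappa> w - \<tau> w ^ 3)"
    by (intro form_diff p3 linear_E) (simp_all add: numeral_3_eq_3 One_nat_def)
  then show "affine_fspace (open_sub \<E> (E \<inter> nonvanishing \<xi>))"
    by (rule affine_complement_of_line[OF linear_E(1)]) (simp add: E_eq)
  have "form UNIV 3 (\<lambda>v. a v ^ 3 + b v ^ 3 + c v ^ 3)"
    by (intro form_add p3 C.linear)
  then show "affine_fspace (open_sub \<C> (C \<inter> nonvanishing a))"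
    by (rule affine_complement_of_line[OF C.linear(1)]) (rule C.M_eq)
qed

lemma finite_near_chart:
  assumes "y \<in> E" "y \<in> nonvanishing \<xi>"
  shows "\<exists>W\<in>opens \<E>. y \<in> W \<and> affine_fspace (open_sub \<E> W) \<and> affine_fspace (open_sub \<C> (preim \<C> \<pi> W)) \<and>
    (\<exists>B. finite B \<and> B \<subseteq> regular \<C> (preim \<C> \<pi> W) \<and>
      (\<forall>g\<in>regular \<C> (preim \<C> \<pi> W). \<exists>f. (\<forall>h\<in>B. f h \<in> regular \<E> W) \<and>
         (\<forall>P\<in>preim \<C> \<pi> W. g P = (\<Sum>h\<in>B. f h (\<pi> P) * h P))))"
  by (rule bexI[OF _ E.opens_basic[OF linear_E(1)]])
    (use assms affine_charts finite_on_chart in \<open>simp add: preim_chart\<close>)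

text \<open>If \<xi> = \<eta> = 0, then \<tau> = 0 by the equation, and the vector is zero. So two
  charts cover \<open>E\<close>, and \<open>swap\<close> carries the first to the second.\<close>

theorem finite_pi: "finite_morphism \<C> \<E> \<pi>"
proof -
  interpret S: cubic_cover C b a c E \<eta> \<xi> \<kappa> \<tau> "\<omega>\<^sup>2" r F \<rho> \<pi> by (rule swap)
  have cover: "y \<in> nonvanishing \<xi> \<or> y \<in> nonvanishing \<eta>" if y: "y \<in> E" for y
  proof -
    obtain w where w: "y = pt w" "w \<noteq> 0" "\<xi> w * \<eta> w * \<kappa> w = \<tau> w ^ 3"
      using y E.repr[OF y] mem_E by auto
    have "\<xi> w \<noteq> 0 \<or> \<eta> w \<noteq> 0"
    proof (rule ccontr)
      assume "\<not> ?thesis"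
      then have "\<xi> w = \<xi> 0" "\<eta> w = \<eta> 0" "\<tau> w = \<tau> 0" using w(3) forms_E_0 by auto
      then show False using E_inj w(2) by blast
    qed
    then show ?thesis by (simp add: w(1) nonvanishing_pt[OF linear_E(1)] nonvanishing_pt[OF linear_E(2)])
  qed
  show ?thesis
    unfolding finite_morphism_def E.pts_M
  proof (intro conjI ballI pi_morphism, goal_cases)
    case (1 y)
    from cover[OF 1] show ?case
    proof
      assume "y \<in> nonvanishing \<xi>"
      then show ?thesis by (rule finite_near_chart[OF 1])
    next
      assume "y \<in> nonvanishing \<eta>"
      then show ?thesis by (rule S.finite_near_chart[OF 1])
    qed
  qed
qed

text \<open>The basis is 1, s, s^2, one nonzero function in each eigenspace. In the function field s
  may be inverted, so each eigencomponent is an invariant times its basis function.\<close>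

theorem degree_pi: "has_degree \<C> \<E> \<pi> 3"
proof -
  define s where "s = ratio b a"
  define h :: "nat \<Rightarrow> ('k^3) set \<Rightarrow> 'k" where "h i Q = s Q ^ i" for i Q
  have o: "\<omega> * \<omega>\<^sup>2 = 1" "(\<omega>\<^sup>2)\<^sup>2 = \<omega>" "(\<omega>\<^sup>2) ^ 3 = 1" using omega by Groebner_Basis.algebra+
  have rho_s: "s (\<rho> P) = \<omega>\<^sup>2 * s P" if "P \<in> C" for P
    using ratio_rho[OF that] by (simp add: s_def)
  interpret R: fermat_cubic C b c a by (rule C.rotate)
  have in_chart: "\<forall>\<^sub>F Q in C.gen. Q \<in> C \<and> s \<in> regular_at \<C> Q \<and> s Q \<noteq> 0"
    using C.eventually_chart R.eventually_chart
  proof eventually_elim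
    case (elim Q)
    then obtain v where v: "Q = pt v" "pt v \<in> C" "a v \<noteq> 0" by blast
    then have nv: "Q \<in> nonvanishing a" by (simp add: nonvanishing_pt[OF C.linear(1)])
    from elim have "Q \<in> nonvanishing b" by (auto simp: nonvanishing_pt[OF C.linear(2)])
    then have "b v \<noteq> 0" using v by (simp add: nonvanishing_pt[OF C.linear(2)])
    then show ?case using v C.regular_coord(1) nv by (simp add: s_def C.ratio_coord)
  qed
  have h_rat: "h i \<in> rational \<C>" for i
    unfolding C.rational_iff_gen h_def using in_chart
    by eventually_elim (auto intro: C.regular_at_power)
  have spanning: "\<exists>f. (\<forall>i<3. f i \<in> rational \<E>) \<and>
      generically \<C> (\<lambda>Q. g Q = (\<Sum>i<3. f i (\<pi> Q) * h i Q))" if g: "g \<in> rational \<C>" for g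
  proof -
    define k :: "nat \<Rightarrow> ('k^3) set \<Rightarrow> 'k" where
      "k i = (if i = 0 then eig 1 g else if i = 1 then (\<lambda>Q. eig (\<omega>\<^sup>2) g Q * inverse (s Q))
        else (\<lambda>Q. eig \<omega> g Q * inverse (s Q) ^ 2))" for i
    have g1: "\<forall>\<^sub>F P in C.gen. g \<in> regular_at \<C> P" using g by (simp add: C.rational_iff_gen)
    note g2 = eventually_rho[OF g1]
    note g3 = eventually_rho[OF g2]
    have k_rat: "k i \<in> rational \<C>" for i
      unfolding C.rational_iff_gen using g1 g2 g3 in_chart
    proof eventually_elim
      case (elim P)
      then have "eig \<zeta> g \<in> regular_at \<C> P" for \<zeta> using eig_regular by blast
      moreover have "(\<lambda>Q. inverse (s Q)) \<in> regular_at \<C> P" using elim C.regular_at_inverse by blast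
      ultimately show ?case by (auto simp: k_def intro!: C.regular_at_mult C.regular_at_power)
    qed
    have inv: "k i (\<rho> P) = k i P" if P: "P \<in> C" for i P
    proof -
      have e: "eig 1 g (\<rho> P) = eig 1 g P" using eig_rho[of 1 P g] P by simp
      have "inverse (\<omega>\<^sup>2) = \<omega>" using o(1) by (simp add: inverse_unique mult.commute)
      then have i: "inverse (\<omega>\<^sup>2 * s P) = \<omega> * inverse (s P)" by simp
      have ids: "\<omega> * x * (\<omega> * y) ^ 2 = x * y ^ 2" "\<omega>\<^sup>2 * x * (\<omega> * y) = x * y" for x y
        using o by Groebner_Basis.algebra+
      show ?thesis
        unfolding k_def if_distribR
        by (simp only: e eig_rho[OF omega3 P] eig_rho[OF o(3) P] rho_s[OF P] i ids)
    qed
    have "\<exists>f\<in>rational \<E>. \<forall>Q\<in>C. k i Q = f (\<pi> Q)" for i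
      by (rule rational_descends[OF k_rat inv])
    then obtain f where f: "\<And>i. f i \<in> rational \<E>" "\<And>i Q. Q \<in> C \<Longrightarrow> k i Q = f i (\<pi> Q)" by metis
    have "\<forall>\<^sub>F Q in C.gen. g Q = (\<Sum>i<3. f i (\<pi> Q) * h i Q)"
      using in_chart
    proof eventually_elim
      case (elim Q)
      have "(\<Sum>i<3. f i (\<pi> Q) * h i Q) = (\<Sum>i<3. k i Q * h i Q)" using f(2) elim by simp
      also have "\<dots> = k 0 Q * h 0 Q + k 1 Q * h 1 Q + k 2 Q * h 2 Q"
        by (simp add: eval_nat_numeral One_nat_def)
      also have "\<dots> = eig 1 g Q + eig \<omega> g Q + eig (\<omega>\<^sup>2) g Q"
        using elim by (simp add: k_def h_def mult.assoc add_ac flip: power_mult_distrib)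
      finally show ?case using eig_sum by simp
    qed
    with f show ?thesis unfolding C.generically_iff by blast
  qed
  have indep: "\<forall>i<3. generically \<E> (\<lambda>R. f i R = 0)"
    if gen0: "generically \<C> (\<lambda>Q. (\<Sum>i<3. f i (\<pi> Q) * h i Q) = 0)" for f
  proof -
    have e1: "\<forall>\<^sub>F Q in C.gen. f 0 (\<pi> Q) + f 1 (\<pi> Q) * s Q + f 2 (\<pi> Q) * s Q ^ 2 = 0"
      using gen0 unfolding C.generically_iff
      by eventually_elim (simp add: h_def eval_nat_numeral One_nat_def)
    note e2 = eventually_rho[OF e1]
    note e3 = eventually_rho[OF e2]
    have "\<forall>\<^sub>F Q in C.gen. f 0 (\<pi> Q) = 0 \<and> f 1 (\<pi> Q) = 0 \<and> f 2 (\<pi> Q) = 0"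
      using e1 e2 e3 in_chart
    proof eventually_elim
      case (elim Q)
      then have Q: "Q \<in> C" "\<rho> Q \<in> C" "s Q \<noteq> 0" using rho_mem by auto
      define A B D where "A = f 0 (\<pi> Q)" and "B = f 1 (\<pi> Q) * s Q" and "D = f 2 (\<pi> Q) * s Q ^ 2"
      have 1: "A + B + D = 0" using elim(1) by (simp add: A_def B_def D_def)
      have 2: "A + \<omega>\<^sup>2 * B + \<omega> * D = 0"
        using elim(2) o(2) unfolding A_def B_def D_def pi_rho[OF Q(1)] rho_s[OF Q(1)]
        by Groebner_Basis.algebra
      have "s (\<rho> (\<rho> Q)) = \<omega> * s Q"
        unfolding rho_s[OF Q(1)] rho_s[OF Q(2)] mult.assoc[symmetric]
        by (simp only: o(2)[unfolded power2_eq_square[of "\<omega>\<^sup>2"]])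
      then have 3: "A + \<omega> * B + \<omega>\<^sup>2 * D = 0"
        using elim(3) o(2) unfolding A_def B_def D_def pi_rho[OF Q(1)] pi_rho[OF Q(2)]
        by Groebner_Basis.algebra
      have 4: "1 + \<omega>\<^sup>2 + \<omega>\<^sup>2 * \<omega>\<^sup>2 = 0" using omega by Groebner_Basis.algebra
      \<comment> \<open>Inversion of the Fourier transform on the group of order 3: the relation and
        its two rotations, weighted by a character, isolate one of the three terms.\<close>
      have "3 * A = (A + B + D) + (A + \<omega>\<^sup>2 * B + \<omega> * D) + (A + \<omega> * B + \<omega>\<^sup>2 * D)
          - (B + D) * (\<omega>\<^sup>2 + \<omega> + 1)" by (simp add: algebra_simps)
      then have "3 * A = 0" unfolding 1 2 3 omega by simp
      moreover have "3 * B = (A + B + D) + \<omega> * (A + \<omega>\<^sup>2 * B + \<omega> * D) + \<omega>\<^sup>2 * (A + \<omega> * B + \<omega>\<^sup>2 * D)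
          - A * (\<omega>\<^sup>2 + \<omega> + 1) - D * (1 + \<omega>\<^sup>2 + \<omega>\<^sup>2 * \<omega>\<^sup>2) - 2 * B * (\<omega> ^ 3 - 1)"
        by (simp add: power2_eq_square power3_eq_cube algebra_simps)
      then have "3 * B = 0" unfolding 1 2 3 4 omega omega3 by simp
      moreover have "3 * D = (A + B + D) + \<omega>\<^sup>2 * (A + \<omega>\<^sup>2 * B + \<omega> * D) + \<omega> * (A + \<omega> * B + \<omega>\<^sup>2 * D)
          - A * (\<omega>\<^sup>2 + \<omega> + 1) - B * (1 + \<omega>\<^sup>2 + \<omega>\<^sup>2 * \<omega>\<^sup>2) - 2 * D * (\<omega> ^ 3 - 1)"
        by (simp add: power2_eq_square power3_eq_cube algebra_simps)
      then have "3 * D = 0" unfolding 1 2 3 4 omega omega3 by simp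
      ultimately show ?case using C.three Q(3) by (simp add: A_def B_def D_def)
    qed
    then have "\<forall>\<^sub>F R in E.gen. f 0 R = 0 \<and> f 1 R = 0 \<and> f 2 R = 0" by (simp flip: eventually_pi)
    then have "\<forall>i\<in>{0,1,2}. \<forall>\<^sub>F R in E.gen. f i R = 0" by (auto elim: eventually_mono)
    moreover have "i \<in> {0,1,2}" if "i < 3" for i :: nat using that by auto
    ultimately show ?thesis unfolding E.generically_iff by blast
  qed
  show ?thesis
    unfolding has_degree_def
    by (rule exI[of _ h]) (use h_rat spanning indep in blast)
qed

section \<open>Compatibility with the group law\<close>

lemma orbit_count:
  assumes "S \<in> C" "P \<in> C"
  shows "of_bool (S = P) + of_bool (\<rho> S = P) + of_bool (\<rho> (\<rho> S) = P) = (of_bool (\<pi> S = \<pi> P) :: int)"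
proof -
  have "S \<noteq> \<rho> S" "S \<noteq> \<rho> (\<rho> S)" "\<rho> S \<noteq> \<rho> (\<rho> S)"
    using rho_neq[OF assms(1)] rho2_neq[OF assms(1)] rho_neq[OF rho_mem[OF assms(1)]] by auto
  then show ?thesis using pi_eq_iff[OF assms] by auto
qed

text \<open>The norm \<open>f \<cdot> f\<circ>\<rho> \<cdot> f\<circ>\<rho>\<^sup>2\<close> descends to a function whose divisor is the image of the divisor of \<open>f\<close>.\<close>

lemma ec_sum_pi:
  assumes mem: "z \<in> C" "P \<in> C" "Q \<in> C" "R \<in> C" and sum: "ec_sum \<C> z P Q R"
  shows "ec_sum \<E> (\<pi> z) (\<pi> P) (\<pi> Q) (\<pi> R)"
proof -
  define n :: "('k^3) set \<Rightarrow> int" where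
    "n S = of_bool (S = P) + of_bool (S = Q) - of_bool (S = R) - of_bool (S = z)" for S
  from sum obtain f where f: "f \<in> rational \<C>" "\<And>S. S \<in> C \<Longrightarrow> has_order \<C> S f (n S)"
    unfolding ec_sum_def n_def by auto
  define N where "N S = f S * (f (\<rho> S) * f (\<rho> (\<rho> S)))" for S
  have f1: "\<forall>\<^sub>F P in C.gen. f \<in> regular_at \<C> P" using f by (simp add: C.rational_iff_gen)
  note f2 = eventually_rho[OF f1]
  note f3 = eventually_rho[OF f2]
  have inC: "\<forall>\<^sub>F P in C.gen. P \<in> C" by (simp add: eventually_generic)
  have N_reg: "(\<lambda>S. u S * (v (\<rho> S) * w (\<rho> (\<rho> S)))) \<in> regular_at \<C> P"
    if "P \<in> C" "u \<in> regular_at \<C> P" "v \<in> regular_at \<C> (\<rho> P)" "w \<in> regular_at \<C> (\<rho> (\<rho> P))" for u v w P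
    using that by (intro C.regular_at_mult regular_rho1 regular_rho2)
  have N_rat: "N \<in> rational \<C>"
    unfolding C.rational_iff_gen N_def using f1 f2 f3 inC by eventually_elim (rule N_reg)
  have "N (\<rho> S) = N S" if "S \<in> C" for S by (simp add: N_def rho3[OF that] ac_simps)
  from rational_descends[OF N_rat this] obtain g where g: "g \<in> rational \<E>" "\<And>S. S \<in> C \<Longrightarrow> N S = g (\<pi> S)"
    by blast
  have "has_order \<E> y g (of_bool (y = \<pi> P) + of_bool (y = \<pi> Q) - of_bool (y = \<pi> R) - of_bool (y = \<pi> z))"
    if "y \<in> E" for y
  proof -
    obtain S where S: "S \<in> C" "\<pi> S = y" using pi_onto \<open>y \<in> E\<close> by blast
    note S1 = rho_mem[OF S(1)]
    note S2 = rho_mem[OF S1]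
    define m where "m = n S + (n (\<rho> S) + n (\<rho> (\<rho> S)))"
    have m: "m = of_bool (y = \<pi> P) + of_bool (y = \<pi> Q) - of_bool (y = \<pi> R) - of_bool (y = \<pi> z)"
      using orbit_count[OF S(1) mem(1)] orbit_count[OF S(1) mem(2)] orbit_count[OF S(1) mem(3)]
        orbit_count[OF S(1) mem(4)] unfolding m_def n_def S(2)[symmetric] by linarith
    obtain t where t: "uniformizer \<E> y t" using E.ex_dvr[OF \<open>y \<in> E\<close>] by (auto simp: E.dvr_at_def)
    \<comment> \<open>As \<pi> is unramified, the same function is a uniformizer at all three points
      of the fibre. So the order of the norm at y is the sum m of the three orders of f.\<close>
    have tS: "uniformizer \<C> S (t \<circ> \<pi>)" by (rule uniformizer_pullback[OF S(1)]) (simp add: S t)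
    have tS1: "uniformizer \<C> (\<rho> S) (t \<circ> \<pi>)"
      by (rule uniformizer_pullback[OF S1]) (simp add: S t pi_rho)
    have tS2: "uniformizer \<C> (\<rho> (\<rho> S)) (t \<circ> \<pi>)"
      by (rule uniformizer_pullback[OF S2]) (simp add: S S1 t pi_rho)
    obtain u where u: "u \<in> regular_at \<C> S" "u S \<noteq> 0"
      "\<forall>\<^sub>F Q in C.gen. f Q = (t \<circ> \<pi>) Q powi n S * u Q" by (rule C.has_orderD[OF f(2)[OF S(1)] tS])
    obtain v where v: "v \<in> regular_at \<C> (\<rho> S)" "v (\<rho> S) \<noteq> 0"
      "\<forall>\<^sub>F Q in C.gen. f Q = (t \<circ> \<pi>) Q powi n (\<rho> S) * v Q" by (rule C.has_orderD[OF f(2)[OF S1] tS1])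
    obtain w where w: "w \<in> regular_at \<C> (\<rho> (\<rho> S))" "w (\<rho> (\<rho> S)) \<noteq> 0"
      "\<forall>\<^sub>F Q in C.gen. f Q = (t \<circ> \<pi>) Q powi n (\<rho> (\<rho> S)) * w Q" by (rule C.has_orderD[OF f(2)[OF S2] tS2])
    define x where "x Q = u Q * (v (\<rho> Q) * w (\<rho> (\<rho> Q)))" for Q
    have x: "x \<in> regular_at \<C> S" "x S \<noteq> 0"
      unfolding x_def using N_reg[OF S(1) u(1) v(1) w(1)] u v w by auto
    have tn: "\<forall>\<^sub>F Q in C.gen. t (\<pi> Q) \<noteq> 0" using C.uniformizer_nonzero[OF tS] by simp
    have "\<forall>\<^sub>F Q in C.gen. g (\<pi> Q) / t (\<pi> Q) powi m = x Q"
      using u(3) eventually_rho[OF v(3)] eventually_rho[OF eventually_rho[OF w(3)]] tn inC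
    proof eventually_elim
      case (elim Q)
      have "N Q = t (\<pi> Q) powi m * x Q"
        unfolding N_def x_def m_def using elim
        by (simp add: pi_rho rho_mem power_int_add)
      then show ?case using g(2) elim by simp
    qed
    from descend[OF S(1) x(1) this, unfolded S(2)]
    have reg: "(\<lambda>R. g R / t R powi m)(y := x S) \<in> regular_at \<E> y" .
    have "\<forall>\<^sub>F R in E.gen. g R = t R powi m * ((\<lambda>R. g R / t R powi m)(y := x S)) R"
      using upd_generic[of "\<lambda>R. g R / t R powi m" y "x S"] E.uniformizer_nonzero[OF t]
      by eventually_elim simp
    then have "has_order \<E> y g m" using x by (intro E.has_orderI[OF t reg]) auto
    then show ?thesis by (simp only: m)
  qed
  then show ?thesis unfolding ec_sum_def E.pts_M by (intro bexI[OF _ g(1)] ballI)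
qed

end

section \<open>The two curves\<close>

definition cubic_C :: "'k::field \<Rightarrow> 'k^3 \<Rightarrow> 'k" where
  "cubic_C e v = v $ 1 * v $ 2 * (v $ 1 + v $ 2) + e * v $ 3 ^ 3"

definition cubic_E :: "'k::field \<Rightarrow> 'k^3 \<Rightarrow> 'k" where
  "cubic_E e w = w $ 2 ^ 2 * w $ 3 + 4 * w $ 1 ^ 3 + 27 * e\<^sup>2 * w $ 3 ^ 3"

definition rot :: "'k::field^3 \<Rightarrow> 'k^3" where
  "rot v = vector [v $ 2, - v $ 1 - v $ 2, v $ 3]"

text \<open>The homogenisation \<open>(U z : V : z\<^sup>3)\<close> of \<open>(U, V)\<close>; it has no base points on the curve.\<close>

definition UV :: "3 \<Rightarrow> 'k::field^3 \<Rightarrow> 'k" where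
  "UV i v = (vector [- (v $ 1 * v $ 1 + v $ 1 * v $ 2 + v $ 2 * v $ 2) * v $ 3,
     (v $ 1 - v $ 2) * (v $ 1 + 2 * v $ 2) * (- 2 * v $ 1 - v $ 2), v $ 3 ^ 3] :: 'k^3) $ i"

text \<open>The choice of representative is immaterial, since all components of \<open>UV\<close>
  have degree 3.\<close>

definition pi_map :: "('k::field^3) set \<Rightarrow> ('k^3) set" where
  "pi_map P = pt (\<chi> i. UV i (SOME v. v \<in> P))"

lemma numeral_mem:
  assumes "1 \<in> k" "\<And>x y. x \<in> k \<Longrightarrow> y \<in> k \<Longrightarrow> x + y \<in> (k :: 'k::field set)"
  shows "numeral n \<in> k"
proof (induction n rule: num_induct)
  case (inc n)
  then show ?case unfolding numeral_inc by (intro assms)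
qed (simp add: assms)

text \<open>One treatment of coefficients for both purposes: the image of the given field for
  rationality statements, and the whole closure for geometric ones.\<close>

locale subring_of =
  fixes k :: "'k::field set"
  assumes one_mem: "1 \<in> k" and minus_one_mem: "- 1 \<in> k"
    and add_mem: "x \<in> k \<Longrightarrow> y \<in> k \<Longrightarrow> x + y \<in> k" and mult_mem: "x \<in> k \<Longrightarrow> y \<in> k \<Longrightarrow> x * y \<in> k"
begin

lemma form_power': "form k 1 p \<Longrightarrow> form k n (\<lambda>v. p v ^ n)"
  using form_power[of k 1 p n] one_mem by simp

lemma form_mult2: "form k 1 p \<Longrightarrow> form k 1 q \<Longrightarrow> form k 2 (\<lambda>v. p v * q v)"
  using form_mult[of k 1 p 1 q] by (simp add: numeral_2_eq_2 One_nat_def)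

lemma form_mult3: "form k 2 p \<Longrightarrow> form k 1 q \<Longrightarrow> form k 3 (\<lambda>v. p v * q v)"
  using form_mult[of k 2 p 1 q] by (simp add: numeral_3_eq_3 numeral_2_eq_2 One_nat_def)

lemma form_cubic_C: "e \<in> k \<Longrightarrow> form k 3 (cubic_C e)"
  unfolding cubic_C_def[abs_def] by (intro form_add form_mult3 form_mult2 form_cmult form_power' form_coord)

lemma form_cubic_E: "e \<in> k \<Longrightarrow> form k 3 (cubic_E e)"
  unfolding cubic_E_def[abs_def] power2_eq_square[of e]
  by (intro form_add form_mult3 form_cmult form_power' form_coord mult_mem numeral_mem one_mem add_mem)

lemma form_rot: "form k 1 (\<lambda>v. rot v $ i)"
  unfolding rot_def
  by (rule form_vector3) (intro form_diff form_uminus form_coord minus_one_mem)+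

lemma form_UV: "form k 3 (UV i)"
  unfolding UV_def[abs_def]
proof (rule form_vector3)
  show "form k 3 (\<lambda>v. - (v $ 1 * v $ 1 + v $ 1 * v $ 2 + v $ 2 * v $ 2) * v $ 3)"
    by (intro form_mult3 form_uminus form_add form_mult2 form_coord minus_one_mem)
  have "- 2 \<in> k" using mult_mem[OF minus_one_mem numeral_mem[OF one_mem add_mem], of "num.Bit0 num.One"] by simp
  then show "form k 3 (\<lambda>v. (v $ 1 - v $ 2) * (v $ 1 + 2 * v $ 2) * (- 2 * v $ 1 - v $ 2))"
    by (intro form_mult3 form_mult2 form_diff form_add form_cmult form_coord minus_one_mem
        numeral_mem one_mem add_mem)
  show "form k 3 (\<lambda>v. v $ 3 ^ 3)" by (intro form_power' form_coord)
qed

end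

lemma subring_UNIV: "subring_of UNIV"
  by unfold_locales auto

lemma subring_to_ac: "subring_of (range (to_ac :: 'a::field \<Rightarrow> 'a alg_closure))"
proof
  show "1 \<in> range (to_ac :: 'a \<Rightarrow> 'a alg_closure)" by (metis rangeI to_ac_1)
  show "- 1 \<in> range (to_ac :: 'a \<Rightarrow> 'a alg_closure)" by (metis rangeI to_ac_1 to_ac_minus)
qed (auto simp flip: to_ac_add to_ac_mult)

section \<open>Diagonalisation of the two given curves\<close>

locale curve_data =
  fixes e \<omega> \<kappa> :: "'k::alg_closed_field"
  assumes two: "(2::'k) \<noteq> 0" and three: "(3::'k) \<noteq> 0" and e_nz: "e \<noteq> 0"
    and omega: "\<omega>\<^sup>2 + \<omega> + 1 = 0" and kappa: "\<kappa> ^ 3 = e"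
begin

definition "C = {pt v | v. v \<noteq> 0 \<and> cubic_C e v = 0}"
definition "E = {pt w | w. w \<noteq> 0 \<and> cubic_E e w = 0}"

text \<open>The eigenvectors of the rotation, with \<open>c\<close> normalised so that \<open>a\<^sup>3 + b\<^sup>3 + c\<^sup>3\<close> is a multiple of \<open>cubic_C\<close>.\<close>

definition a :: "'k^3 \<Rightarrow> 'k" where "a v = (1 - \<omega>\<^sup>2) * v $ 1 + (\<omega> - \<omega>\<^sup>2) * v $ 2"
definition b :: "'k^3 \<Rightarrow> 'k" where "b v = (1 - \<omega>) * v $ 1 + (\<omega>\<^sup>2 - \<omega>) * v $ 2"
definition c :: "'k^3 \<Rightarrow> 'k" where "c v = - 3 * \<kappa> * v $ 3"

text \<open>At w = (U z : V : z^3) these forms have to give a^3, b^3, c^3 and abc. On the curve a^3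
  + b^3 = 27 e z^3 and \<open>a^3 - b^3 = - 3 (\<omega> - \<omega>\<^sup>2) V\<close>, which
  determines \<xi> and \<eta>. Moreover c^3 = - 27 e z^3, and ab = - 3 U with c = - 3 \<kappa> z
  gives abc = 9 \<kappa> U z.\<close>

definition \<xi> :: "'k^3 \<Rightarrow> 'k" where "\<xi> w = 27 * e / 2 * w $ 3 - 3 * (\<omega> - \<omega>\<^sup>2) / 2 * w $ 2"
definition \<eta> :: "'k^3 \<Rightarrow> 'k" where "\<eta> w = 27 * e / 2 * w $ 3 + 3 * (\<omega> - \<omega>\<^sup>2) / 2 * w $ 2"
definition \<zeta> :: "'k^3 \<Rightarrow> 'k" where "\<zeta> w = - 27 * e * w $ 3"
definition \<tau> :: "'k^3 \<Rightarrow> 'k" where "\<tau> w = 9 * \<kappa> * w $ 1"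

lemma omega2: "\<omega>\<^sup>2 = - 1 - \<omega>"
  using omega by Groebner_Basis.algebra

lemma nz: "(9::'k) \<noteq> 0" "(27::'k) \<noteq> 0" "(4::'k) \<noteq> 0" "(12::'k) \<noteq> 0" "\<kappa> \<noteq> 0" "\<omega> - \<omega>\<^sup>2 \<noteq> 0"
proof -
  have "(9::'k) = 3 * 3" "(27::'k) = 3 * 3 * 3" "(4::'k) = 2 * 2" "(12::'k) = 2 * 2 * 3" by simp_all
  then show "(9::'k) \<noteq> 0" "(27::'k) \<noteq> 0" "(4::'k) \<noteq> 0" "(12::'k) \<noteq> 0"
    using two three by (metis mult_eq_0_iff)+
  show "\<kappa> \<noteq> 0" using kappa e_nz by auto
  have "(\<omega> - \<omega>\<^sup>2) * (\<omega> - \<omega>\<^sup>2) = - 3" using omega by Groebner_Basis.algebra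
  then show "\<omega> - \<omega>\<^sup>2 \<noteq> 0" using three by auto
qed

lemma abc_cubic: "a v ^ 3 + b v ^ 3 + c v ^ 3 = - 27 * cubic_C e v"
proof -
  have "a v ^ 3 + b v ^ 3 = - 27 * (v $ 1 * v $ 2 * (v $ 1 + v $ 2))"
    unfolding a_def b_def using omega by Groebner_Basis.algebra
  moreover have "c v ^ 3 = - 27 * (e * v $ 3 ^ 3)"
    unfolding c_def kappa[symmetric] by (simp add: power3_eq_cube)
  ultimately show ?thesis by (simp add: cubic_C_def distrib_left)
qed

lemma linear: "form UNIV 1 a" "form UNIV 1 b" "form UNIV 1 c"
  "form UNIV 1 \<xi>" "form UNIV 1 \<eta>" "form UNIV 1 \<zeta>" "form UNIV 1 \<tau>"
  unfolding a_def[abs_def] b_def[abs_def] c_def[abs_def] \<xi>_def[abs_def] \<eta>_def[abs_def]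
    \<zeta>_def[abs_def] \<tau>_def[abs_def]
  by (intro form_add form_diff form_cmult form_coord UNIV_I)+

sublocale C: fermat_cubic C a b c
proof
  show "(3::'k) \<noteq> 0" by (rule three)
  show "form UNIV 1 a" "form UNIV 1 b" "form UNIV 1 c" by (rule linear)+
  show "C = {pt v | v. v \<noteq> 0 \<and> a v ^ 3 + b v ^ 3 + c v ^ 3 = 0}"
    unfolding C_def abc_cubic using nz(2) by simp
next
  fix i :: 3
  have 1: "v $ 1 = inverse 3 * a v + inverse 3 * b v + 0 * c v" for v
  proof -
    have "a v + b v = 3 * v $ 1" unfolding a_def b_def omega2 by (simp add: algebra_simps)
    then have "inverse 3 * (a v + b v) = v $ 1" using three by simp
    then show ?thesis by (simp only: distrib_left mult_zero_left add_0_right)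
  qed
  have 2: "v $ 2 = inverse 3 * \<omega>\<^sup>2 * a v + inverse 3 * \<omega> * b v + 0 * c v" for v
  proof -
    have "\<omega>\<^sup>2 * a v + \<omega> * b v = 3 * v $ 2"
      unfolding a_def b_def using omega by Groebner_Basis.algebra
    then have "inverse 3 * (\<omega>\<^sup>2 * a v + \<omega> * b v) = v $ 2" using three by simp
    then show ?thesis by (simp only: distrib_left mult.assoc mult_zero_left add_0_right)
  qed
  have 3: "v $ 3 = 0 * a v + 0 * b v + inverse (- 3 * \<kappa>) * c v" for v
    using three nz by (simp add: c_def)
  show "\<exists>\<alpha> \<beta> \<gamma>. \<forall>v. v $ i = \<alpha> * a v + \<beta> * b v + \<gamma> * c v"
    using exhaust_3[of i] 1 2 3 by blast
next
  fix x y z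
  define v :: "'k^3" where
    "v = vector [inverse 3 * (x + y), inverse 3 * (\<omega>\<^sup>2 * x + \<omega> * y), inverse (- 3 * \<kappa>) * z]"
  have "3 * v $ 1 = x + y" "3 * v $ 2 = \<omega>\<^sup>2 * x + \<omega> * y" using three by (simp_all add: v_def)
  then have "3 * a v = 3 * x" "3 * b v = 3 * y"
    unfolding a_def b_def using omega by Groebner_Basis.algebra+
  then have "a v = x" "b v = y" using three by simp_all
  moreover have "c v = z" using three nz by (simp add: c_def v_def)
  ultimately show "\<exists>v. a v = x \<and> b v = y \<and> c v = z" by blast
qed

lemma two_xi: "2 * \<xi> w = 27 * e * w $ 3 - 3 * (\<omega> - \<omega>\<^sup>2) * w $ 2"
  and two_eta: "2 * \<eta> w = 27 * e * w $ 3 + 3 * (\<omega> - \<omega>\<^sup>2) * w $ 2"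
proof -
  have half: "2 * (x / 2 * y) = x * y" for x y :: 'k using two by simp
  show "2 * \<xi> w = 27 * e * w $ 3 - 3 * (\<omega> - \<omega>\<^sup>2) * w $ 2"
    "2 * \<eta> w = 27 * e * w $ 3 + 3 * (\<omega> - \<omega>\<^sup>2) * w $ 2" 
    unfolding \<xi>_def \<eta>_def right_diff_distrib[of 2] distrib_left[of 2] half by (rule refl)+
qed

text \<open>The product of 2 \<xi> and 2 \<eta> is a difference of squares, and the square of
  \<open>\<omega> - \<omega>\<^sup>2\<close> is -3, so \<omega> disappears. The factor 4 clears the
  halves; 729 is the cube of the 9 in \<tau>.\<close>

lemma xi_eta_tau_cubic: "4 * (\<xi> w * \<eta> w * \<zeta> w - \<tau> w ^ 3) = - 729 * e * cubic_E e w"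
proof -
  define x y where "x = 2 * \<xi> w" and "y = 2 * \<eta> w"
  have x: "x = 27 * e * w $ 3 - 3 * (\<omega> - \<omega>\<^sup>2) * w $ 2" and y: "y = 27 * e * w $ 3 + 3 * (\<omega> - \<omega>\<^sup>2) * w $ 2"
    unfolding x_def y_def by (rule two_xi two_eta)+
  have 1: "4 * (\<xi> w * \<eta> w * \<zeta> w - \<tau> w ^ 3) = x * y * \<zeta> w - 4 * \<tau> w ^ 3"
    by (simp add: x_def y_def algebra_simps)
  have 2: "x * y = 27 * (27 * e\<^sup>2 * w $ 3 ^ 2 + w $ 2 ^ 2)"
    unfolding x y using omega by Groebner_Basis.algebra
  have 3: "\<tau> w ^ 3 = 729 * e * w $ 1 ^ 3"
    unfolding \<tau>_def kappa[symmetric] by (simp add: power_mult_distrib)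
  show ?thesis
    unfolding 1 unfolding 2 3 \<zeta>_def cubic_E_def by (simp add: power2_eq_square power3_eq_cube algebra_simps)
qed

lemma cubic_E_iff: "\<xi> w * \<eta> w * \<zeta> w = \<tau> w ^ 3 \<longleftrightarrow> cubic_E e w = 0"
proof -
  have "(729::'k) = 27 * 27" by simp
  then have "(729::'k) \<noteq> 0" using nz by (metis mult_eq_0_iff)
  moreover have "\<xi> w * \<eta> w * \<zeta> w = \<tau> w ^ 3 \<longleftrightarrow> 4 * (\<xi> w * \<eta> w * \<zeta> w - \<tau> w ^ 3) = 0" using nz by simp
  ultimately show ?thesis unfolding xi_eta_tau_cubic using e_nz by simp
qed

lemma UV_values:
  assumes "cubic_C e v = 0"
  shows "\<xi> (\<chi> i. UV i v) = a v ^ 3" "\<eta> (\<chi> i. UV i v) = b v ^ 3" "\<tau> (\<chi> i. UV i v) = a v * b v * c v"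
proof -
  have ez: "e * v $ 3 ^ 3 = - (v $ 1 * v $ 2 * (v $ 1 + v $ 2))"
    using assms by (simp add: cubic_C_def add_eq_0_iff)
  define x y where "x = v $ 1" and "y = v $ 2"
  define V where "V = (x - y) * (x + 2 * y) * (- 2 * x - y)"
  have "2 * \<xi> (\<chi> i. UV i v) = 27 * (e * v $ 3 ^ 3) - 3 * (\<omega> - \<omega>\<^sup>2) * V"
    "2 * \<eta> (\<chi> i. UV i v) = 27 * (e * v $ 3 ^ 3) + 3 * (\<omega> - \<omega>\<^sup>2) * V"
    unfolding two_xi two_eta by (simp_all add: UV_def V_def x_def y_def)
  moreover have "27 * (e * v $ 3 ^ 3) - 3 * (\<omega> - \<omega>\<^sup>2) * V = 2 * a v ^ 3"
    "27 * (e * v $ 3 ^ 3) + 3 * (\<omega> - \<omega>\<^sup>2) * V = 2 * b v ^ 3"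
    unfolding ez a_def b_def V_def x_def[symmetric] y_def[symmetric] using omega by Groebner_Basis.algebra+
  ultimately show "\<xi> (\<chi> i. UV i v) = a v ^ 3" "\<eta> (\<chi> i. UV i v) = b v ^ 3" using two by simp_all
  have "a v * b v = 3 * (x * x + x * y + y * y)"
    unfolding a_def b_def x_def[symmetric] y_def[symmetric] using omega by Groebner_Basis.algebra
  then have "a v * b v * c v = 3 * (x * x + x * y + y * y) * (- 3 * \<kappa> * v $ 3)" by (simp add: c_def)
  also have "\<dots> = 9 * \<kappa> * (- (x * x + x * y + y * y) * v $ 3)" by (simp add: algebra_simps)
  also have "\<dots> = \<tau> (\<chi> i. UV i v)" by (simp add: \<tau>_def UV_def x_def y_def)
  finally show "\<tau> (\<chi> i. UV i v) = a v * b v * c v" by simp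
qed

lemma C_cone: "a v ^ 3 + b v ^ 3 + c v ^ 3 = 0 \<longleftrightarrow> cubic_C e v = 0"
  unfolding abc_cubic using nz by simp

lemma pi_map_pt: "pi_map (pt v) = pt (\<chi> i. UV i (v :: 'k^3))"
proof -
  interpret subring_of "UNIV :: 'k set" by (rule subring_UNIV)
  have "(SOME w. w \<in> pt v) \<in> pt v" by (rule someI[of _ v]) simp
  then obtain k where k: "k \<noteq> 0" "(SOME w. w \<in> pt v) = k *s v" by (auto simp: mem_pt)
  have "(\<chi> i. UV i (k *s v)) = k ^ 3 *s (\<chi> i. UV i v)"
    using form_scale[OF form_UV] by (simp add: vec_eq_iff)
  then show ?thesis using k by (simp add: pi_map_def pt_scale)
qed

sublocale cubic_cover C a b c E \<xi> \<eta> \<zeta> \<tau> \<omega> rot UV rho pi_map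
proof -
  interpret subring_of "UNIV :: 'k set" by (rule subring_UNIV)
  show "cubic_cover C a b c E \<xi> \<eta> \<zeta> \<tau> \<omega> rot UV rho pi_map"
  proof
    show "\<omega>\<^sup>2 + \<omega> + 1 = 0" by (rule omega)
    show "form UNIV 1 (\<lambda>v :: 'k^3. rot v $ i)" for i by (rule form_rot)
    show "a (rot v) = \<omega>\<^sup>2 * a v" "b (rot v) = \<omega> * b v" for v
      unfolding a_def b_def rot_def vector_3 using omega by Groebner_Basis.algebra+
    show "c (rot v) = c v" for v by (simp add: c_def rot_def)
    show "\<xi> w + \<eta> w + \<zeta> w = 0" for w
    proof -
      have "2 * (\<xi> w + \<eta> w + \<zeta> w) = 2 * \<xi> w + 2 * \<eta> w + 2 * \<zeta> w" by (simp add: distrib_left)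
      also have "\<dots> = 0" unfolding two_xi two_eta by (simp add: \<zeta>_def)
      finally show ?thesis using two by (metis mult_eq_0_iff)
    qed
    show "E = {pt w | w. w \<noteq> 0 \<and> \<xi> w * \<eta> w * \<zeta> w = \<tau> w ^ 3}" by (simp add: E_def cubic_E_iff)
    show "w = w'" if eq: "\<xi> w = \<xi> w'" "\<eta> w = \<eta> w'" "\<tau> w = \<tau> w'" for w w'
    proof -
      have "2 * (27 * e) * w $ 3 = 2 * (27 * e) * w' $ 3" "2 * (3 * (\<omega> - \<omega>\<^sup>2)) * w $ 2 = 2 * (3 * (\<omega> - \<omega>\<^sup>2)) * w' $ 2"
        using two_xi[of w] two_xi[of w'] two_eta[of w] two_eta[of w'] eq by Groebner_Basis.algebra+
      moreover have "2 * (27 * e) \<noteq> 0" "2 * (3 * (\<omega> - \<omega>\<^sup>2)) \<noteq> 0"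
        using two three nz(2,6) e_nz by (metis mult_eq_0_iff)+
      ultimately have "w $ 3 = w' $ 3" "w $ 2 = w' $ 2" by (metis mult_left_cancel)+
      moreover have "w $ 1 = w' $ 1" using eq(3) nz by (simp add: \<tau>_def)
      ultimately show ?thesis by (simp add: vec3_eq_iff)
    qed
    show "form UNIV 3 (UV i :: 'k^3 \<Rightarrow> 'k)" for i by (rule form_UV)
    show "\<xi> (\<chi> i. UV i v) = a v ^ 3 \<and> \<eta> (\<chi> i. UV i v) = b v ^ 3 \<and> \<tau> (\<chi> i. UV i v) = a v * b v * c v"
      if "a v ^ 3 + b v ^ 3 + c v ^ 3 = 0" for v using that UV_values[of v] by (simp add: C_cone)
    show "rho P = rot ` P" for P :: "('k^3) set" by (simp add: rho_def rot_def[abs_def])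
    show "pi_map (pt v) = pt (\<chi> i. UV i v)" for v :: "'k^3" by (rule pi_map_pt)
  qed (rule linear)+
qed

lemma mem_C: "pt v \<in> C \<longleftrightarrow> v \<noteq> 0 \<and> cubic_C e v = 0"
  by (simp add: C.mem_M C_cone)

lemma mem_E_cubic: "pt w \<in> E \<longleftrightarrow> w \<noteq> 0 \<and> cubic_E e w = 0"
  by (simp add: mem_E cubic_E_iff)

section \<open>Smoothness\<close>

lemma smooth_C:
  assumes "subring_of k" "e \<in> k"
  shows "smooth_plane_cubic k C"
  unfolding smooth_plane_cubic_def
proof (intro exI[of _ "cubic_C e"] conjI allI impI)
  interpret subring_of k by fact
  show "form k 3 (cubic_C e)" by (rule form_cubic_C[OF assms(2)])
  show "C = {pt v | v. v \<noteq> 0 \<and> cubic_C e v = 0}" by (simp add: C_def)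
  fix v :: "'k^3" assume v: "v \<noteq> 0 \<and> cubic_C e v = 0"
  define x y z where "x = v $ 1" and "y = v $ 2" and "z = v $ 3"
  have *: "\<exists>w p. (\<forall>s. cubic_C e (v + s *s w) = poly p s) \<and> poly.coeff p 1 \<noteq> 0"
    if "\<And>s. cubic_C e (v + s *s w) = poly p s" "poly.coeff p 1 \<noteq> 0" for w p using that by blast
  \<comment> \<open>The three partial derivatives. The polynomials given below are the Taylor
    expansions along the coordinate directions, with these as linear coefficients.\<close>
  consider "y * (2 * x + y) \<noteq> 0" | "x * (x + 2 * y) \<noteq> 0" | "3 * e * z ^ 2 \<noteq> 0"
  proof -
    have False if "y * (2 * x + y) = 0" "x * (x + 2 * y) = 0" "3 * e * z ^ 2 = 0"
    proof -
      have "z = 0" using that(3) three e_nz by simp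
      moreover have "3 * (x * x) = 0" "3 * (y * y) = 0" using that(1,2) by Groebner_Basis.algebra+
      then have "x = 0" "y = 0" using three by simp_all
      ultimately show False using v by (simp add: vec3_eq_iff x_def y_def z_def)
    qed
    then show thesis using that by blast
  qed
  then show "\<exists>w p. (\<forall>s. cubic_C e (v + s *s w) = poly p s) \<and> poly.coeff p 1 \<noteq> 0"
  proof cases
    case 1
    show ?thesis
      by (rule *[of "vector [1, 0, 0]" "[:cubic_C e v, y * (2 * x + y), y:]"])
        (use 1 in \<open>simp_all add: cubic_C_def x_def y_def algebra_simps One_nat_def\<close>)
  next
    case 2
    show ?thesis
      by (rule *[of "vector [0, 1, 0]" "[:cubic_C e v, x * (x + 2 * y), x:]"])
        (use 2 in \<open>simp_all add: cubic_C_def x_def y_def algebra_simps One_nat_def\<close>)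
  next
    case 3
    show ?thesis
      by (rule *[of "vector [0, 0, 1]" "[:cubic_C e v, 3 * e * z ^ 2, 3 * e * z, e:]"])
        (use 3 in \<open>simp_all add: cubic_C_def x_def y_def z_def algebra_simps One_nat_def power2_eq_square power3_eq_cube\<close>)
  qed
qed

lemma smooth_E: "smooth_plane_cubic UNIV E"
  unfolding smooth_plane_cubic_def
proof (intro exI[of _ "cubic_E e"] conjI allI impI)
  interpret subring_of "UNIV :: 'k set" by (rule subring_UNIV)
  show "form UNIV 3 (cubic_E e)" by (rule form_cubic_E) simp
  show "E = {pt v | v. v \<noteq> 0 \<and> cubic_E e v = 0}" by (simp add: E_def)
  fix v :: "'k^3" assume v: "v \<noteq> 0 \<and> cubic_E e v = 0"
  define x y z where "x = v $ 1" and "y = v $ 2" and "z = v $ 3"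
  have *: "\<exists>w p. (\<forall>s. cubic_E e (v + s *s w) = poly p s) \<and> poly.coeff p 1 \<noteq> 0"
    if "\<And>s. cubic_E e (v + s *s w) = poly p s" "poly.coeff p 1 \<noteq> 0" for w p using that by blast
  \<comment> \<open>Again the partial derivatives: if yz = 0, the vanishing of the third one makes
    both y and z zero.\<close>
  consider "12 * x\<^sup>2 \<noteq> 0" | "2 * y * z \<noteq> 0" | "y\<^sup>2 + 81 * e\<^sup>2 * z\<^sup>2 \<noteq> 0"
  proof -
    have False if "12 * x\<^sup>2 = 0" "2 * y * z = 0" "y\<^sup>2 + 81 * e\<^sup>2 * z\<^sup>2 = 0"
    proof -
      have "x = 0" using that(1) nz by simp
      have "(81::'k) = 9 * 9" by simp
      then have 81: "(81::'k) \<noteq> 0" using nz by (metis mult_eq_0_iff)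
      have "y = 0 \<or> z = 0" using that(2) two by simp
      then have "y = 0 \<and> z = 0" using that(3) 81 e_nz by auto
      with \<open>x = 0\<close> show False using v by (simp add: vec3_eq_iff x_def y_def z_def)
    qed
    then show thesis using that by blast
  qed
  then show "\<exists>w p. (\<forall>s. cubic_E e (v + s *s w) = poly p s) \<and> poly.coeff p 1 \<noteq> 0"
  proof cases
    case 1
    show ?thesis
      by (rule *[of "vector [1, 0, 0]" "[:cubic_E e v, 12 * x\<^sup>2, 12 * x, 4:]"])
        (use 1 in \<open>simp_all add: cubic_E_def x_def algebra_simps One_nat_def power2_eq_square power3_eq_cube\<close>)
  next
    case 2
    show ?thesis
      by (rule *[of "vector [0, 1, 0]" "[:cubic_E e v, 2 * y * z, z:]"])
        (use 2 in \<open>simp_all add: cubic_E_def y_def z_def algebra_simps One_nat_def power2_eq_square power3_eq_cube\<close>)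
  next
    case 3
    show ?thesis
      by (rule *[of "vector [0, 0, 1]" "[:cubic_E e v, y\<^sup>2 + 81 * e\<^sup>2 * z\<^sup>2, 81 * e\<^sup>2 * z, 27 * e\<^sup>2:]"])
        (use 3 in \<open>simp_all add: cubic_E_def y_def z_def algebra_simps One_nat_def power2_eq_square power3_eq_cube\<close>)
  qed
qed

section \<open>The affine part, its closure and the points at infinity\<close>

definition "affine_pts = {pt (vector [x1, x2, 1] :: 'k^3) | x1 x2 x3. (x1, x2, x3) \<in> affine_C e}"

lemma mem_affine: "pt v \<in> affine_pts \<longleftrightarrow> pt v \<in> C \<and> v $ 3 \<noteq> 0"
proof
  assume "pt v \<in> affine_pts"
  then obtain x1 x2 x3 where x: "(x1, x2, x3) \<in> affine_C e" "pt v = pt (vector [x1, x2, 1])"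
    by (auto simp: affine_pts_def)
  have "x1 + x2 + x3 = 0" and x3': "x1 * x2 * x3 = e" using x(1) by (auto simp: affine_C_def)
  then have x3: "x3 = - (x1 + x2)" by (simp add: add_eq_0_iff)
  have "e = - (x1 * x2 * (x1 + x2))" using x3' unfolding x3 mult_minus_right by (rule sym)
  then have "cubic_C e (vector [x1, x2, 1]) = 0" by (simp add: cubic_C_def)
  then have "pt v \<in> C" unfolding x(2) by (simp add: mem_C vec3_eq_iff)
  moreover have "v $ 3 \<noteq> 0" using x(2) by (auto simp: pt_eq_iff)
  ultimately show "pt v \<in> C \<and> v $ 3 \<noteq> 0" ..
next
  assume v: "pt v \<in> C \<and> v $ 3 \<noteq> 0"
  define x y z where "x = v $ 1" and "y = v $ 2" and "z = v $ 3"
  have z: "z \<noteq> 0" using v by (simp add: z_def)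
  have "x * y * (x + y) + e * z ^ 3 = 0" using v by (simp add: mem_C cubic_C_def x_def y_def z_def)
  then have "x * y * (x + y) = - e * z ^ 3" by (simp add: add_eq_0_iff2)
  then have "(x / z) * (y / z) * (- (x / z) - y / z) = e"
    using z by (simp add: divide_simps power3_eq_cube) Groebner_Basis.algebra
  then have "(x / z, y / z, - (x / z) - y / z) \<in> affine_C e" by (simp add: affine_C_def)
  then have "pt (vector [x / z, y / z, 1]) \<in> affine_pts" by (auto simp: affine_pts_def)
  moreover have "v = z *s vector [x / z, y / z, 1]" using z by (simp add: vec3_eq_iff x_def y_def z_def)
  then have "pt v = pt (vector [x / z, y / z, 1])" using pt_scale[OF z] by metis
  ultimately show "pt v \<in> affine_pts" by simp
qed

text \<open>A form that is nonzero somewhere on the cubic has finitely many zeros there, so it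
  cannot vanish on the affine part, which omits only finitely many points.\<close>

lemma closure_affine: "proj_closure affine_pts = C"
proof (intro equalityI subsetI)
  interpret subring_of "UNIV :: 'k set" by (rule subring_UNIV)
  fix P assume "P \<in> proj_closure affine_pts"
  then obtain v where v: "P = pt v" "v \<noteq> 0"
    "\<And>d p. form UNIV d p \<Longrightarrow> (\<forall>w. w \<noteq> 0 \<and> pt w \<in> affine_pts \<longrightarrow> p w = 0) \<Longrightarrow> p v = 0"
    unfolding proj_closure_def by blast
  have "cubic_C e v = 0"
    by (rule v(3)[OF form_cubic_C]) (auto simp: mem_affine mem_C)
  then show "P \<in> C" using v by (simp add: mem_C)
next
  fix P assume P: "P \<in> C"
  then obtain v where v: "P = pt v" "v \<noteq> 0" using C.repr by blast
  have "p v = 0" if p: "form UNIV d p" "\<forall>w. w \<noteq> 0 \<and> pt w \<in> affine_pts \<longrightarrow> p w = 0" for d p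
  proof (rule ccontr)
    assume "p v \<noteq> 0"
    then have "finite {Q \<in> C. Q \<notin> nonvanishing p}" using C.finite_zeros[OF p(1)] P v by blast
    then have "\<forall>\<^sub>F Q in C.gen. Q \<in> nonvanishing p" by (simp add: eventually_generic)
    moreover interpret R: fermat_cubic C b c a by (rule C.rotate)
    interpret RR: fermat_cubic C c a b by (rule R.rotate)
    note RR.eventually_chart
    ultimately have "\<forall>\<^sub>F Q in C.gen. False"
    proof eventually_elim
      case (elim Q)
      then obtain w where w: "Q = pt w" "pt w \<in> C" "c w \<noteq> 0" by blast
      then have "w \<noteq> 0" "pt w \<in> affine_pts" by (auto simp: mem_affine mem_C c_def)
      then have "p w = 0" using p(2) by blast
      then show False using elim w by (simp add: nonvanishing_pt[OF p(1)])
    qed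
    then show False by simp
  qed
  then show "P \<in> proj_closure affine_pts" unfolding proj_closure_def using v by blast
qed

lemma infinity_pts:
  "{P \<in> C. \<forall>v\<in>P. v $ 3 = 0} = {pt (vector [1, 0, 0]), pt (vector [0, 1, 0]), pt (vector [1, - 1, 0])}"
  (is "?I = ?S")
proof (intro equalityI subsetI)
  fix P assume P: "P \<in> ?I"
  then obtain v where v: "P = pt v" "v \<noteq> 0" "cubic_C e v = 0" "v $ 3 = 0"
    using C.repr mem_C by (metis (mono_tags, lifting) mem_Collect_eq self_in_pt)
  have "v $ 1 * v $ 2 * (v $ 1 + v $ 2) = 0" using v by (simp add: cubic_C_def)
  then consider "v $ 1 = 0" | "v $ 2 = 0" | "v $ 2 = - v $ 1" by (auto simp: add_eq_0_iff)
  then show "P \<in> ?S"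
  proof cases
    case 1
    then have "v $ 2 \<noteq> 0" "v = v $ 2 *s vector [0, 1, 0]" using v by (auto simp: vec3_eq_iff)
    then have "P = pt (vector [0, 1, 0])" using v(1) pt_scale by metis
    then show ?thesis by simp
  next
    case 2
    then have "v $ 1 \<noteq> 0" "v = v $ 1 *s vector [1, 0, 0]" using v by (auto simp: vec3_eq_iff)
    then have "P = pt (vector [1, 0, 0])" using v(1) pt_scale by metis
    then show ?thesis by simp
  next
    case 3
    then have "v $ 1 \<noteq> 0" "v = v $ 1 *s vector [1, - 1, 0]" using v by (auto simp: vec3_eq_iff)
    then have "P = pt (vector [1, - 1, 0])" using v(1) pt_scale by metis
    then show ?thesis by simp
  qed
next
  fix P assume "P \<in> ?S"
  then obtain v where v: "P = pt v" "v \<noteq> 0" "cubic_C e v = 0" "v $ 3 = 0"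
    by (auto simp: cubic_C_def vec3_eq_iff)
  then show "P \<in> ?I" by (auto simp: mem_C mem_pt)
qed

lemma card_infinity: "card {P \<in> C. \<forall>v\<in>P. v $ 3 = 0} = 3"
proof -
  have "pt (vector [1, 0, 0] :: 'k^3) \<noteq> pt (vector [0, 1, 0])"
    "pt (vector [1, 0, 0] :: 'k^3) \<noteq> pt (vector [1, - 1, 0])"
    "pt (vector [0, 1, 0] :: 'k^3) \<noteq> pt (vector [1, - 1, 0])"
    by (auto simp: pt_eq_iff vec3_eq_iff)
  then show ?thesis unfolding infinity_pts by simp
qed

text \<open>At z = 0 only the middle component of \<open>UV\<close> survives. The common image is
  what allows any of the three points to be taken as origin.\<close>

lemma pi_infinity: "z \<in> {P \<in> C. \<forall>v\<in>P. v $ 3 = 0} \<Longrightarrow> pi_map z = pt (vector [0, 1, 0])"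
proof -
  assume z: "z \<in> {P \<in> C. \<forall>v\<in>P. v $ 3 = 0}"
  then obtain v where v: "z = pt v" "pt v \<in> C" "v $ 3 = 0"
    using C.repr by (metis (mono_tags, lifting) mem_Collect_eq self_in_pt)
  have "(\<chi> i. UV i v) = UV 2 v *s vector [0, 1, 0]" using v by (simp add: vec3_eq_iff UV_def)
  moreover have "(\<chi> i. UV i v) \<noteq> 0" using v(2) Psi_eq_0_iff by (simp add: C.mem_M)
  ultimately show ?thesis using v pt_scale by (metis pi vector_smult_lzero)
qed

section \<open>Rationality, uniqueness and the isogeny\<close>

lemma proj_morphism_rho: "subring_of k \<Longrightarrow> proj_morphism k C C rho"
  unfolding proj_morphism_def
proof (intro conjI ballI)
  assume "subring_of k"
  then interpret subring_of k .
  show "rho ` C \<subseteq> C" using rho_mem by blast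
  fix P assume P: "P \<in> C"
  show "\<exists>d G. (\<forall>i. form k d (G i)) \<and> (\<forall>v\<in>P. (\<chi> i. G i v) \<noteq> 0) \<and>
        (\<forall>Q\<in>C. \<forall>v\<in>Q. (\<chi> i. G i v) \<noteq> 0 \<longrightarrow> rho Q = pt (\<chi> i. G i v))"
  proof (rule exI[of _ 1], rule exI[of _ "\<lambda>i v. rot v $ i"], intro conjI allI ballI impI form_rot)
    fix v assume "v \<in> P"
    then show "(\<chi> i. rot v $ i) \<noteq> 0" using C.mem_repr[OF P] r_eq_0_iff by simp
  next
    fix Q v assume "Q \<in> C" "v \<in> Q"
    then show "rho Q = pt (\<chi> i. rot v $ i)" using C.mem_repr[of Q v] rho_pt by simp
  qed
qed

lemma proj_morphism_pi: "subring_of k \<Longrightarrow> proj_morphism k C E pi_map"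
  unfolding proj_morphism_def
proof (intro conjI ballI)
  assume "subring_of k"
  then interpret subring_of k .
  show "pi_map ` C \<subseteq> E" using pi_mem by blast
  fix P assume P: "P \<in> C"
  show "\<exists>d G. (\<forall>i. form k d (G i)) \<and> (\<forall>v\<in>P. (\<chi> i. G i v) \<noteq> 0) \<and>
        (\<forall>Q\<in>C. \<forall>v\<in>Q. (\<chi> i. G i v) \<noteq> 0 \<longrightarrow> pi_map Q = pt (\<chi> i. G i v))"
  proof (rule exI[of _ 3], rule exI[of _ UV], intro conjI allI ballI impI form_UV)
    fix v assume "v \<in> P"
    then have "v \<noteq> 0" "pt v \<in> C" using C.mem_repr[OF P] P by auto
    then show "(\<chi> i. UV i v) \<noteq> 0" using Psi_eq_0_iff by (simp add: C.mem_M)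
  next
    fix Q v assume "Q \<in> C" "v \<in> Q"
    then show "pi_map Q = pt (\<chi> i. UV i v)" using C.mem_repr[of Q v] pi_map_pt by simp
  qed
qed

lemma pi_affine:
  assumes "(x1, x2, x3) \<in> affine_C e"
  shows "pi_map (pt (vector [x1, x2, 1])) =
    pt (vector [x1 * x2 + x1 * x3 + x2 * x3, (x1 - x2) * (x2 - x3) * (x3 - x1), 1])"
proof -
  have "x1 + x2 + x3 = 0" using assms by (simp add: affine_C_def)
  then have x3: "x3 = - (x1 + x2)" by (simp add: add_eq_0_iff)
  have "(\<chi> i. UV i (vector [x1, x2, 1] :: 'k^3)) =
    vector [x1 * x2 + x1 * x3 + x2 * x3, (x1 - x2) * (x2 - x3) * (x3 - x1), 1]"
    unfolding vec3_eq_iff by (simp add: UV_def x3 algebra_simps)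
  then show ?thesis by (simp add: pi_map_pt)
qed

text \<open>The minors of the two coordinate vectors vanish on the affine part, hence on its closure.\<close>

lemma pi_unique:
  assumes f: "proj_morphism k C E f" and agree: "\<And>P. P \<in> affine_pts \<Longrightarrow> f P = pi_map P" and P: "P \<in> C"
  shows "f P = pi_map P"
proof -
  interpret subring_of "UNIV :: 'k set" by (rule subring_UNIV)
  obtain v where v: "P = pt v" "v \<noteq> 0" using P C.repr by blast
  have "\<exists>d G. (\<forall>i. form k d (G i)) \<and> (\<forall>v\<in>P. (\<chi> i. G i v) \<noteq> 0) \<and>
      (\<forall>Q\<in>C. \<forall>v\<in>Q. (\<chi> i. G i v) \<noteq> 0 \<longrightarrow> f Q = pt (\<chi> i. G i v))"
    using f P unfolding proj_morphism_def by simp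
  then obtain d G where G': "\<forall>i. form k d (G i)" "\<forall>v\<in>P. (\<chi> i. G i v) \<noteq> 0"
    "\<forall>Q\<in>C. \<forall>v\<in>Q. (\<chi> i. G i v) \<noteq> 0 \<longrightarrow> f Q = pt (\<chi> i. G i v)" by (elim exE conjE)
  note G = G'[rule_format]
  have minor: "G i v * UV j v - G j v * UV i v = 0" for i j
  proof -
    have form: "form UNIV (d + 3) (\<lambda>v. G i v * UV j v - G j v * UV i v)"
      using form_mono[OF G(1)] by (intro form_diff form_mult form_UV) auto
    have "G i w * UV j w - G j w * UV i w = 0" if "pt w \<in> affine_pts" for w
    proof (cases "(\<chi> i. G i w) = 0")
      case True
      then have "G i w = 0" for i by (metis vec_lambda_beta zero_index)
      then show ?thesis by simp
    next
      case False
      have "pt w \<in> C" using that by (simp add: mem_affine)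
      then have "pt (\<chi> i. G i w) = pt (\<chi> i. UV i w)"
        using G(3)[of "pt w" w] False agree[OF that] pi_map_pt by simp
      then obtain c where "(\<chi> i. G i w) = c *s (\<chi> i. UV i w)" by (auto simp: pt_eq_iff)
      then have "G i w = c * UV i w" for i by (metis vec_lambda_beta vector_smult_component)
      then show ?thesis by simp
    qed
    moreover have "pt v \<in> proj_closure affine_pts" using P v by (simp add: closure_affine)
    then obtain u where u: "pt v = pt u"
      "\<And>d p. form UNIV d p \<Longrightarrow> (\<forall>w. w \<noteq> 0 \<and> pt w \<in> affine_pts \<longrightarrow> p w = 0) \<Longrightarrow> p u = 0"
      unfolding proj_closure_def by blast
    ultimately have "G i u * UV j u - G j u * UV i u = 0" using u(2)[OF form] by blast
    moreover obtain c where "v = c *s u" using u(1) by (auto simp: pt_eq_iff)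
    ultimately show ?thesis using form_scale[OF form, of c u] by simp
  qed
  have "(\<chi> i. UV i v) \<noteq> 0" using P v Psi_eq_0_iff by (simp add: C.mem_M)
  moreover have "(\<chi> i. G i v) \<noteq> 0" using G(2) v by simp
  ultimately have "pt (\<chi> i. G i v) = pt (\<chi> i. UV i v)"
    using pt_neq_imp_minor[of "\<chi> i. G i v" "\<chi> i. UV i v"] minor by auto
  then show ?thesis using G(3)[OF P, of v] \<open>(\<chi> i. G i v) \<noteq> 0\<close> v pi_map_pt by simp
qed

lemma isogeny_pi:
  assumes z: "z \<in> {P \<in> C. \<forall>v\<in>P. v $ 3 = 0}"
  shows "isogeny C z E (pt (vector [0, 1, 0])) pi_map"
  unfolding isogeny_def elliptic_curve_def
proof (intro conjI ballI impI smooth_C subring_UNIV UNIV_I smooth_E pi_morphism pi_infinity[OF z])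
  show zC: "z \<in> C" using z by simp
  show "pt (vector [0, 1, 0]) \<in> E" by (simp add: mem_E_cubic cubic_E_def vec3_eq_iff)
  show "pi_map ` C = E" using pi_mem pi_onto by blast
  show "finite {P \<in> C. pi_map P = pt (vector [0, 1, 0])}" by (rule finite_fibre_pi)
  fix P Q R assume "P \<in> C" "Q \<in> C" "R \<in> C" "ec_sum (proj_var C) z P Q R"
  then show "ec_sum (proj_var E) (pt (vector [0, 1, 0])) (pi_map P) (pi_map Q) (pi_map R)"
    using ec_sum_pi[OF zC] pi_infinity[OF z] by metis
qed

end

section \<open>Transfer to the curves over the given field\<close>

theorem theorem2p1:
  fixes \<epsilon> :: "'a::field"
  assumes "CHAR('a) \<noteq> 2" and "CHAR('a) \<noteq> 3" and "\<epsilon> \<noteq> 0"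
  shows
    "smooth_plane_cubic (range (to_ac :: 'a \<Rightarrow> 'a alg_closure)) (curve_C \<epsilon>) \<and>
     proj_morphism (range (to_ac :: 'a \<Rightarrow> 'a alg_closure)) (curve_C \<epsilon>) (curve_C \<epsilon>) rho \<and>
     (\<forall>x1 x2 x3. (x1, x2, x3) \<in> affine_C (to_ac \<epsilon>) \<longrightarrow>
        rho (pt (vector [x1, x2, 1])) = pt (vector [x2, x3, 1])) \<and>
     (\<forall>P\<in>curve_C \<epsilon>. \<forall>n. (rho ^^ n) P = P \<longleftrightarrow> 3 dvd n) \<and>
     card (infinity_C \<epsilon>) = 3 \<and>
     (\<exists>\<pi>. UV_morphism \<epsilon> \<pi> \<and>
        (\<forall>\<pi>'. UV_morphism \<epsilon> \<pi>' \<longrightarrow> (\<forall>P\<in>curve_C \<epsilon>. \<pi>' P = \<pi> P)) \<and>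
        (\<forall>P\<in>curve_C \<epsilon>. \<pi> (rho P) = \<pi> P) \<and>
        finite_morphism (proj_var (curve_C \<epsilon>)) (proj_var (curve_E \<epsilon>)) \<pi> \<and>
        etale (proj_var (curve_C \<epsilon>)) (proj_var (curve_E \<epsilon>)) \<pi> \<and>
        quotient_morphism (proj_var (curve_C \<epsilon>)) (proj_var (curve_E \<epsilon>)) {rho ^^ n | n. True} \<pi> \<and>
        (\<forall>z\<in>infinity_C \<epsilon>.
           isogeny (curve_C \<epsilon>) z (curve_E \<epsilon>) (pt (vector [0, 1, 0])) \<pi> \<and>
           has_degree (proj_var (curve_C \<epsilon>)) (proj_var (curve_E \<epsilon>)) \<pi> 3))"
proof -
  let ?k = "range (to_ac :: 'a \<Rightarrow> 'a alg_closure)"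
  define e where "e = to_ac \<epsilon>"
  have "CHAR('a) \<noteq> 1" by (simp add: One_nat_def)
  have two: "(2::'a alg_closure) \<noteq> 0"
  proof
    assume "(2::'a alg_closure) = 0"
    then have "CHAR('a) dvd 2" using of_nat_eq_0_iff_char_dvd[where 'a = "'a alg_closure", of 2] by simp
    then show False using assms(1) \<open>CHAR('a) \<noteq> 1\<close> by (metis prime_nat_iff two_is_prime_nat)
  qed
  have three: "(3::'a alg_closure) \<noteq> 0"
  proof
    assume "(3::'a alg_closure) = 0"
    then have "CHAR('a) dvd 3" using of_nat_eq_0_iff_char_dvd[where 'a = "'a alg_closure", of 3] by simp
    moreover have "prime (3::nat)" by simp
    ultimately show False using assms(2) \<open>CHAR('a) \<noteq> 1\<close> by (metis prime_nat_iff)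
  qed
  have "\<exists>\<omega>. poly [:1, 1, 1:] (\<omega> :: 'a alg_closure) = 0" by (rule alg_closed_imp_poly_has_root) simp
  then obtain \<omega> :: "'a alg_closure" where \<omega>: "\<omega>\<^sup>2 + \<omega> + 1 = 0"
    by (auto simp: power2_eq_square algebra_simps)
  obtain \<kappa> where \<kappa>: "\<kappa> ^ 3 = e" using nth_root_exists[of 3 e] by auto
  interpret curve_data e \<omega> \<kappa>
    by unfold_locales (use two three \<omega> \<kappa> assms(3) in \<open>auto simp: e_def\<close>)
  have "curve_C \<epsilon> = proj_closure affine_pts"
    unfolding curve_C_def affine_pts_def e_def[symmetric] ..
  then have C: "curve_C \<epsilon> = C" by (simp only: closure_affine)
  have E: "curve_E \<epsilon> = E"
  proof -
    have "cubic_E e (vector [u, v, w]) = 0 \<longleftrightarrow> v\<^sup>2 * w = - 4 * u ^ 3 - 27 * (to_ac \<epsilon>)\<^sup>2 * w ^ 3" for u v w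
      unfolding cubic_E_def vector_3 e_def[symmetric] by Groebner_Basis.algebra
    then have "curve_E \<epsilon> = {pt (vector [u, v, w]) | u v w. vector [u, v, w] \<noteq> (0 :: 'a alg_closure ^ 3) \<and>
        cubic_E e (vector [u, v, w]) = 0}" unfolding curve_E_def by simp
    also have "\<dots> = E"
    proof (intro equalityI subsetI)
      fix P assume "P \<in> E"
      then obtain x where "P = pt x" "x \<noteq> 0" "cubic_E e x = 0" unfolding E_def by blast
      then show "P \<in> {pt (vector [u, v, w]) | u v w. vector [u, v, w] \<noteq> (0 :: 'a alg_closure ^ 3) \<and>
          cubic_E e (vector [u, v, w]) = 0}"
        by (intro CollectI exI[of _ "x $ 1"] exI[of _ "x $ 2"] exI[of _ "x $ 3"]) (simp add: vec3_eta)
    qed (auto simp: E_def)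
    finally show ?thesis .
  qed
  have I: "infinity_C \<epsilon> = {P \<in> C. \<forall>v\<in>P. v $ 3 = 0}" by (simp add: infinity_C_def C)
  have UV: "UV_morphism \<epsilon> pi_map"
    unfolding UV_morphism_def C E e_def[symmetric] using proj_morphism_pi[OF subring_to_ac] pi_affine by blast
  have unique: "f P = pi_map P" if f: "UV_morphism \<epsilon> f" "P \<in> C" for f P
  proof (rule pi_unique[of ?k, OF _ _ that(2)])
    show "proj_morphism ?k C E f" using that(1) by (simp add: UV_morphism_def C E)
    show "f Q = pi_map Q" if Q: "Q \<in> affine_pts" for Q
    proof -
      obtain x1 x2 x3 where x: "Q = pt (vector [x1, x2, 1])" "(x1, x2, x3) \<in> affine_C e"
        using Q unfolding affine_pts_def by blast
      then show ?thesis
        using f pi_affine[OF x(2)] unfolding UV_morphism_def e_def[symmetric] by simp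
    qed
  qed
  have rho_affine: "rho (pt (vector [x1, x2, 1])) = pt (vector [x2, x3, 1])"
    if "(x1, x2, x3) \<in> affine_C e" for x1 x2 x3
  proof -
    have "x1 + x2 + x3 = 0" using that by (simp add: affine_C_def)
    then have "x3 = - x1 - x2" by (simp add: add_eq_0_iff)
    then show ?thesis by (simp add: rho_pt rot_def)
  qed
  have "e \<in> ?k" by (simp add: e_def)
  show ?thesis
    unfolding C E I e_def[symmetric]
    by (intro conjI ballI allI impI exI[of _ pi_map] smooth_C subring_to_ac \<open>e \<in> ?k\<close> proj_morphism_rho
        rho_affine rho_funpow_eq_iff card_infinity UV unique pi_rho finite_pi etale_pi quotient_pi
        isogeny_pi degree_pi)
qed

end
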